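(* Let $\mathsf H$ be a quaternionic Hilbert space and let $\imath\in\mathbb S$. Given a normal operator $T\in\mathfrak B(\mathsf H)$, there exists a bounded iqPVM $\mathcal P=(P,\mathcal L)$ over $\mathbb C_\imath^+$ in $\mathsf H$ such that $$T=\int_{\mathbb C_\imath^+}\mathit{id}\,d\mathcal P,$$ where $\mathit{id}:\mathbb C_\imath^+\hookrightarrow\mathbb H$ is the inclusion map. The following additional facts hold. (a) $T$ determines uniquely $P$ and the restriction of $L_q=\mathcal L(q)$ to $\mathrm{Ker}(T-T^* )^\perp$ for every $q\in\mathbb C_\imath$. More precisely, if $\mathcal P'=(P',\mathcal L')$ is any bounded iqPVM over $\mathbb C_\imath^+$ in $\mathsf H$ such that $T=\int_{\mathbb C_\imath^+}\mathit{id}\,d\mathcal P'$, and $L'_q=\mathcal L'(q)$, then $P'=P$ and $L'_qu=L_qu$ for every $u\in\mathrm{Ker}(T-T^* )^\perp$ and every $q\in\mathbb C_\imath$. Furthermore: (i) $L'_\imath T=TL'_\imath$ and $L'_\imath T^*=T^*L'_\imath$; (ii) $L'_\jmath T=T^*L'_\jmath$ for every $\jmath\in\mathbb S$ with $\imath\jmath=-\jmath\imath$; (iii) $-L'_\imath(T-T^* )=|T-T^*|=\int_{\mathbb C_\imath^+}2\beta\,d\mathcal P'$, where $2\beta$ denotes the function $\alpha+\imath\beta\mapsto2\beta$. (b) $\mathrm{supp}(P)=\sigma_S(T)\cap\mathbb C_\imath^+$. (c) $P(\mathbb R)(\mathsf H)=\mathrm{Ker}(T-T^* )$ and hence $P(\mathbb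 C_\imath^+\setminus\mathbb R)(\mathsf H)=\mathrm{Ker}(T-T^* )^\perp$. (d) Concerning the spherical spectrum: (i) $q\in\sigma_{pS}(T)$ if and only if $P(\mathbb S_q\cap\mathbb C_\imath^+)\ne0$; in particular every isolated point of $\sigma_S(T)\cap\mathbb C_\imath^+$ belongs to $\sigma_{pS}(T)$. (ii) $\sigma_{rS}(T)=\emptyset$. (iii) $q\in\sigma_{cS}(T)$ if and only if $P(\mathbb S_q\cap\mathbb C_\imath^+)=0$ and $P(U)\ne0$ for every open subset $U$ of $\mathbb C_\imath^+$ containing $\mathbb S_q\cap\mathbb C_\imath^+$. Furthermore, if $q\in\sigma_{cS}(T)$, then for every real $\epsilon>0$ there exists $u_\epsilon\in\mathsf H$ with $\|u_\epsilon\|=1$ and $\|Tu_\epsilon-u_\epsilon q\|<\epsilon$.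
   Context: $\mathbb H$ denotes the quaternions, $\mathbb S=\{q\in\mathbb H: q^2=-1\}$. For $q\in\mathbb H$, $\mathbb S_q=\{x\in\mathbb H:\mathrm{Re}(x)=\mathrm{Re}(q),|x|=|q|\}$. For $\imath\in\mathbb S$: $\mathbb C_\imath=\{\alpha+\imath\beta:\alpha,\beta\in\mathbb R\}$ and $\mathbb C_\imath^+=\{\alpha+\imath\beta:\alpha,\beta\in\mathbb R,\ \beta\ge0\}$, with Euclidean topology and Borel $\sigma$-algebra $\mathscr B(\mathbb C_\imath^+)$. A quaternionic Hilbert space $\mathsf H$ is a non-zero right $\mathbb H$-module with an additive $\mathbb H$-valued product satisfying $\langle u|vp+wq\rangle=\langle u|v\rangle p+\langle u|w\rangle q$, $\langle u|v\rangle=\overline{\langle v|u\rangle}$, $\langle u|u\rangle\ge0$, such that $\|u\|=\sqrt{\langle u|u\rangle}$ is a complete norm. Operators are right $\mathbb H$-linear; $\mathfrak B(\mathsf H)$ is the set of bounded operators $\mathsf H\to\mathsf H$; $T$ is normal if $TT^*=T^*T$, positive ($T\ge0$) if $\langle u|Tu\rangle\in[0,\infty)$ for all $u$. For $S\in\mathfrak B(\mathsf H)$, $|S|=\sqrt{S^*S}$ is the unique positive square root of $S^*S$. Left scalar multiplication of $\mathsf H$: a map $\mathcal L:\mathbb H\to\mathfrak B(\mathsf H)$, $\mathcal L(q)=L_q$, of the form $L_qu=\sum_{z\in N}zq\langle z|u\rangle$ for some Hilbert (orthonormal, total) basis $N$. qPVM over $\mathbb C_\imath^+$ in $\mathsf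 H$: a map $P:\mathscr B(\mathbb C_\imath^+)\to\mathfrak B(\mathsf H)$ with $P(E)\ge0$, $P(\mathbb C_\imath^+)=I$, $P(E)P(E')=P(E\cap E')$, and $\sum_nP(E_n)u=P(\bigcup_nE_n)u$ for all $u$ and all countable families of pairwise disjoint Borel sets. $\mathrm{supp}(P)$ is the complement of the union of all open $O\subset\mathbb C_\imath^+$ with $P(O)=0$. An iqPVM is a pair $\mathcal P=(P,\mathcal L)$ with $P$ a qPVM and $\mathcal L$ a left scalar multiplication with $P(E)L_q=L_qP(E)$ for all $E,q$; it is bounded if $\mathrm{supp}(P)$ is bounded. Integral: for simple $s=\sum_\ell S_\ell\chi_{E_\ell}$ ($S_\ell\in\mathbb H$, $E_\ell$ disjoint Borel), $\int s\,d\mathcal P=\sum_\ell L_{S_\ell}P(E_\ell)$; for bounded Borel $\varphi:\mathbb C_\imath^+\to\mathbb H$, $\int\varphi\,d\mathcal P$ is the norm limit of $\int s_n\,d\mathcal P$, $s_n$ simple, $s_n\to\varphi$ uniformly. If $\psi$ is bounded and Borel on $\mathrm{supp}(P)$, $\int_{\mathbb C_\imath^+}\psi\,d\mathcal P$ is the integral of the function equal to $\psi$ on $\mathrm{supp}(P)$ and $0$ elsewhere. Spherical spectrum: for $q\in\mathbb H$, $\Delta_q(T)=T^2-T(2\mathrm{Re}(q))+I|q|^2$. $q$ lies in the spherical resolvent set iff $\mathrm{Ker}\,\Delta_q(T)=\{0\}$, $\mathrm{Ran}\,\Delta_q(T)$ is dense and $\Delta_q(T)^{-1}:\mathrm{Ran}\,\Delta_q(T)\to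 D(T^2)$ is bounded; $\sigma_S(T)$ is its complement in $\mathbb H$. $\sigma_{pS}(T)$: $\mathrm{Ker}\,\Delta_q(T)\ne\{0\}$; $\sigma_{rS}(T)$: $\mathrm{Ker}\,\Delta_q(T)=\{0\}$ and $\mathrm{Ran}\,\Delta_q(T)$ not dense; $\sigma_{cS}(T)$: $\mathrm{Ker}\,\Delta_q(T)=\{0\}$, $\mathrm{Ran}\,\Delta_q(T)$ dense, $\Delta_q(T)^{-1}$ not bounded. *)

theory Defs
  imports "HOL-Analysis.Analysis"
begin

section \<open>The quaternions\<close>

datatype quat = Quat (qRe: real) (qIm1: real) (qIm2: real) (qIm3: real)

lemma quat_eq_iff:
  "p = q \<longleftrightarrow> qRe p = qRe q \<and> qIm1 p = qIm1 q \<and> qIm2 p = qIm2 q \<and> qIm3 p = qIm3 q"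
  by (cases p; cases q) auto

instantiation quat :: ab_group_add
begin

definition "0 = Quat 0 0 0 0"
definition "p + q = Quat (qRe p + qRe q) (qIm1 p + qIm1 q) (qIm2 p + qIm2 q) (qIm3 p + qIm3 q)"
definition "p - q = Quat (qRe p - qRe q) (qIm1 p - qIm1 q) (qIm2 p - qIm2 q) (qIm3 p - qIm3 q)"
definition "- q = Quat (- qRe q) (- qIm1 q) (- qIm2 q) (- qIm3 q)"

instance
  by standard
    (simp_all add: quat_eq_iff zero_quat_def plus_quat_def minus_quat_def uminus_quat_def)

end

lemma quat_sel_zero [simp]: "qRe 0 = 0" "qIm1 0 = 0" "qIm2 0 = 0" "qIm3 0 = 0"
  by (simp_all add: zero_quat_def)

lemma quat_sel_add [simp]:
  "qRe (p + q) = qRe p + qRe q" "qIm1 (p + q) = qIm1 p + qIm1 q"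
  "qIm2 (p + q) = qIm2 p + qIm2 q" "qIm3 (p + q) = qIm3 p + qIm3 q"
  by (simp_all add: plus_quat_def)

lemma quat_sel_diff [simp]:
  "qRe (p - q) = qRe p - qRe q" "qIm1 (p - q) = qIm1 p - qIm1 q"
  "qIm2 (p - q) = qIm2 p - qIm2 q" "qIm3 (p - q) = qIm3 p - qIm3 q"
  by (simp_all add: minus_quat_def)

lemma quat_sel_minus [simp]:
  "qRe (- q) = - qRe q" "qIm1 (- q) = - qIm1 q" "qIm2 (- q) = - qIm2 q" "qIm3 (- q) = - qIm3 q"
  by (simp_all add: uminus_quat_def)

instantiation quat :: ring_1
begin

definition "1 = Quat 1 0 0 0"
definition "p * q = Quat
  (qRe p * qRe q - qIm1 p * qIm1 q - qIm2 p * qIm2 q - qIm3 p * qIm3 q)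
  (qRe p * qIm1 q + qIm1 p * qRe q + qIm2 p * qIm3 q - qIm3 p * qIm2 q)
  (qRe p * qIm2 q - qIm1 p * qIm3 q + qIm2 p * qRe q + qIm3 p * qIm1 q)
  (qRe p * qIm3 q + qIm1 p * qIm2 q - qIm2 p * qIm1 q + qIm3 p * qRe q)"

instance
  by standard
    (simp_all add: quat_eq_iff one_quat_def times_quat_def algebra_simps)

end

lemma quat_sel_one [simp]: "qRe 1 = 1" "qIm1 1 = 0" "qIm2 1 = 0" "qIm3 1 = 0"
  by (simp_all add: one_quat_def)

lemma quat_sel_mult [simp]:
  "qRe (p * q) = qRe p * qRe q - qIm1 p * qIm1 q - qIm2 p * qIm2 q - qIm3 p * qIm3 q"
  "qIm1 (p * q) = qRe p * qIm1 q + qIm1 p * qRe q + qIm2 p * qIm3 q - qIm3 p * qIm2 q"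
  "qIm2 (p * q) = qRe p * qIm2 q - qIm1 p * qIm3 q + qIm2 p * qRe q + qIm3 p * qIm1 q"
  "qIm3 (p * q) = qRe p * qIm3 q + qIm1 p * qIm2 q - qIm2 p * qIm1 q + qIm3 p * qRe q"
  by (simp_all add: times_quat_def)

instantiation quat :: real_algebra_1
begin

definition "r *\<^sub>R q = Quat (r * qRe q) (r * qIm1 q) (r * qIm2 q) (r * qIm3 q)"

instance
  by standard (simp_all add: quat_eq_iff scaleR_quat_def algebra_simps)

end

lemma quat_sel_scaleR [simp]:
  "qRe (r *\<^sub>R q) = r * qRe q" "qIm1 (r *\<^sub>R q) = r * qIm1 q"
  "qIm2 (r *\<^sub>R q) = r * qIm2 q" "qIm3 (r *\<^sub>R q) = r * qIm3 q"
  by (simp_all add: scaleR_quat_def)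

lemma quat_sel_of_real [simp]:
  "qRe (of_real r) = r" "qIm1 (of_real r) = 0" "qIm2 (of_real r) = 0" "qIm3 (of_real r) = 0"
  by (simp_all add: of_real_def)

instantiation quat :: real_inner
begin

definition "inner p q = qRe p * qRe q + qIm1 p * qIm1 q + qIm2 p * qIm2 q + qIm3 p * qIm3 q"
definition "norm (q :: quat) = sqrt (inner q q)"
definition "dist (p :: quat) q = norm (p - q)"
definition "sgn (q :: quat) = q /\<^sub>R norm q"
definition "(uniformity :: (quat \<times> quat) filter) = (INF e\<in>{0 <..}. principal {(x, y). dist x y < e})"
definition "open (U :: quat set) = (\<forall>x\<in>U. \<forall>\<^sub>F (x', y) in uniformity. x' = x \<longrightarrow> y \<in> U)"

instance
proof
  fix x y z :: quat and r :: real
  show "inner x y = inner y x" and "inner (x + y) z = inner x z + inner y z"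
    and "inner (r *\<^sub>R x) y = r * inner x y" and "0 \<le> inner x x"
    by (simp_all add: inner_quat_def algebra_simps)
  have *: "a = 0 \<and> b = 0 \<and> c = 0 \<and> d = 0"
    if "a * a + b * b + c * c + d * d = 0" for a b c d :: real
  proof -
    have "a * a = 0 \<and> b * b = 0 \<and> c * c = 0 \<and> d * d = 0"
      using that zero_le_square [of a] zero_le_square [of b] zero_le_square [of c]
        zero_le_square [of d] by linarith
    then show ?thesis
      by simp
  qed
  show "inner x x = 0 \<longleftrightarrow> x = 0"
  proof
    show "x = 0" if "inner x x = 0"
      using * [OF that [unfolded inner_quat_def]] by (simp add: quat_eq_iff)
  qed (simp add: inner_quat_def)
qed (simp_all only: norm_quat_def dist_quat_def sgn_quat_def uniformity_quat_def open_quat_def)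

end

instantiation quat :: real_normed_div_algebra
begin

definition "inverse q =
  Quat (qRe q / inner q q) (- qIm1 q / inner q q) (- qIm2 q / inner q q) (- qIm3 q / inner q q)"
definition "p div (q :: quat) = p * inverse q"

instance
proof
  fix p q :: quat
  show "norm (p * q) = norm p * norm q"
    unfolding norm_quat_def real_sqrt_mult [symmetric]
    by (simp add: inner_quat_def algebra_simps)
  show "p div q = p * inverse q"
    by (simp add: divide_quat_def)
  show "inverse (0 :: quat) = 0"
    by (simp add: inverse_quat_def quat_eq_iff)
  assume "q \<noteq> 0"
  then have nz: "inner q q \<noteq> 0"
    by simp
  have e: "inner q q = qRe q * qRe q + qIm1 q * qIm1 q + qIm2 q * qIm2 q + qIm3 q * qIm3 q"
    by (simp add: inner_quat_def)
  show "inverse q * q = 1" "q * inverse q = 1"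
    using nz e
    by (simp_all add: quat_eq_iff inverse_quat_def add_divide_distrib [symmetric]
        diff_divide_distrib [symmetric])
qed

end

instantiation quat :: euclidean_space
begin

definition "Basis = {Quat 1 0 0 0, Quat 0 1 0 0, Quat 0 0 1 0, Quat 0 0 0 1}"

instance
proof
  fix u v x :: quat
  show "(Basis :: quat set) \<noteq> {}" and "finite (Basis :: quat set)"
    by (simp_all add: Basis_quat_def)
  show "inner u v = (if u = v then 1 else 0)" if "u \<in> Basis" "v \<in> Basis"
    using that unfolding Basis_quat_def inner_quat_def
    by (elim insertE emptyE) simp_all
  show "(\<forall>u\<in>Basis. inner x u = 0) \<longleftrightarrow> x = 0"
    by (simp add: Basis_quat_def inner_quat_def quat_eq_iff [of x 0])
qed

end

definition qcnj :: "quat \<Rightarrow> quat"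
  where "qcnj q = Quat (qRe q) (- qIm1 q) (- qIm2 q) (- qIm3 q)"

definition imag_units :: "quat set"
  where "imag_units = {q. q ^ 2 = - 1}"

definition qsphere :: "quat \<Rightarrow> quat set"
  where "qsphere q = {x. qRe x = qRe q \<and> norm x = norm q}"

definition slice :: "quat \<Rightarrow> quat set"
  where "slice \<iota> = {of_real \<alpha> + \<iota> * of_real \<beta> | \<alpha> \<beta>. True}"

definition half_slice :: "quat \<Rightarrow> quat set"
  where "half_slice \<iota> = {of_real \<alpha> + \<iota> * of_real \<beta> | \<alpha> \<beta>. \<beta> \<ge> 0}"

definition slice_im :: "quat \<Rightarrow> quat \<Rightarrow> real"
  where "slice_im \<iota> x = (THE \<beta>. \<exists>\<alpha>. x = of_real \<alpha> + \<iota> * of_real \<beta>)"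

abbreviation borel_half_slice :: "quat \<Rightarrow> quat measure"
  where "borel_half_slice \<iota> \<equiv> restrict_space borel (half_slice \<iota>)"


section \<open>Quaternionic Hilbert spaces\<close>

text \<open>
  The real vector space structure and the norm are those induced by the right
  \<open>\<H>\<close>-module structure and the inner product (axioms \<open>scaleR_scaleQ\<close> and \<open>norm_qinner\<close>);
  completeness and definiteness of the norm come from \<^class>\<open>banach\<close>.
\<close>

class quat_hilbert = banach +
  fixes scaleQ :: "'a \<Rightarrow> quat \<Rightarrow> 'a"  (infixl \<open>\<cdot>\<^sub>Q\<close> 75)
    and qinner :: "'a \<Rightarrow> 'a \<Rightarrow> quat"
  assumes nontrivial: "\<exists>u. u \<noteq> 0"
    and scaleQ_add_left: "(u + v) \<cdot>\<^sub>Q q = u \<cdot>\<^sub>Q q + v \<cdot>\<^sub>Q q"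
    and scaleQ_add_right: "u \<cdot>\<^sub>Q (p + q) = u \<cdot>\<^sub>Q p + u \<cdot>\<^sub>Q q"
    and scaleQ_mult: "u \<cdot>\<^sub>Q (p * q) = u \<cdot>\<^sub>Q p \<cdot>\<^sub>Q q"
    and scaleQ_one: "u \<cdot>\<^sub>Q 1 = u"
    and scaleR_scaleQ: "r *\<^sub>R u = u \<cdot>\<^sub>Q of_real r"
    and qinner_linear_right: "qinner u (v \<cdot>\<^sub>Q p + w \<cdot>\<^sub>Q q) = qinner u v * p + qinner u w * q"
    and qinner_qcnj: "qinner u v = qcnj (qinner v u)"
    and qinner_nonneg: "qinner u u \<in> of_real ` {0..}"
    and norm_qinner: "norm u = sqrt (qRe (qinner u u))"

instantiation quat :: quat_hilbert
begin

definition "scaleQ (p :: quat) q = p * q"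
definition "qinner (p :: quat) q = qcnj p * q"

instance
proof
  fix u v w p q :: quat and r :: real
  show "\<exists>u :: quat. u \<noteq> 0"
    by (rule exI [of _ 1]) simp
  have "qinner u u = of_real (inner u u)"
    by (simp add: qinner_quat_def quat_eq_iff qcnj_def inner_quat_def)
  then show "qinner u u \<in> of_real ` {0..}" and "norm u = sqrt (qRe (qinner u u))"
    by (simp_all add: norm_quat_def)
qed (simp_all add: scaleQ_quat_def qinner_quat_def qcnj_def quat_eq_iff algebra_simps)

end


section \<open>Bounded operators\<close>

text \<open>
  \<open>\<BB>(H)\<close>, inside the real Banach space of bounded real-linear operators; the operator norm
  is the same.
\<close>

definition qbounded_ops :: "('h::quat_hilbert \<Rightarrow>\<^sub>L 'h) set"
  where "qbounded_ops = {T :: 'h \<Rightarrow>\<^sub>L 'h. \<forall>u q. T (u \<cdot>\<^sub>Q q) = T u \<cdot>\<^sub>Q q}"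

definition qadj :: "('h::quat_hilbert \<Rightarrow>\<^sub>L 'h) \<Rightarrow> 'h \<Rightarrow>\<^sub>L 'h"
  where "qadj T = (THE S. S \<in> qbounded_ops \<and> (\<forall>u v. qinner (S u) v = qinner u (T v)))"

definition qnormal :: "('h::quat_hilbert \<Rightarrow>\<^sub>L 'h) \<Rightarrow> bool"
  where "qnormal T \<longleftrightarrow> T o\<^sub>L qadj T = qadj T o\<^sub>L T"

definition qpositive :: "('h::quat_hilbert \<Rightarrow>\<^sub>L 'h) \<Rightarrow> bool"
  where "qpositive T \<longleftrightarrow> (\<forall>u. qinner u (T u) \<in> of_real ` {0..})"

definition qabs :: "('h::quat_hilbert \<Rightarrow>\<^sub>L 'h) \<Rightarrow> 'h \<Rightarrow>\<^sub>L 'h"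
  where "qabs S = (THE A. A \<in> qbounded_ops \<and> qpositive A \<and> A o\<^sub>L A = qadj S o\<^sub>L S)"

definition qker :: "('h::quat_hilbert \<Rightarrow>\<^sub>L 'h) \<Rightarrow> 'h set"
  where "qker T = {u. T u = 0}"

definition qperp :: "'h::quat_hilbert set \<Rightarrow> 'h set"
  where "qperp M = {u. \<forall>v\<in>M. qinner v u = 0}"


section \<open>Left scalar multiplications\<close>

definition qspan :: "'h::quat_hilbert set \<Rightarrow> 'h set"
  where "qspan N = {\<Sum>z\<in>F. z \<cdot>\<^sub>Q c z | F c. finite F \<and> F \<subseteq> N}"

definition hilbert_basis :: "'h::quat_hilbert set \<Rightarrow> bool"
  where "hilbert_basis N \<longleftrightarrow>
    (\<forall>z\<in>N. \<forall>w\<in>N. qinner z w = (if z = w then 1 else 0)) \<and> closure (qspan N) = UNIV"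

definition left_mult :: "(quat \<Rightarrow> 'h::quat_hilbert \<Rightarrow>\<^sub>L 'h) \<Rightarrow> bool"
  where "left_mult L \<longleftrightarrow> (\<forall>q. L q \<in> qbounded_ops) \<and>
    (\<exists>N. hilbert_basis N \<and>
      (\<forall>q u. ((\<lambda>z. z \<cdot>\<^sub>Q q \<cdot>\<^sub>Q qinner z u) has_sum L q u) N))"


section \<open>Quaternionic projection-valued measures and integrals\<close>

text \<open>
  A qPVM is a map on Borel sets; its values \<open>P E\<close> on other sets \<open>E\<close> are irrelevant.
  Finite disjoint families are covered by padding with empty sets.
\<close>

definition qPVM :: "quat \<Rightarrow> (quat set \<Rightarrow> 'h::quat_hilbert \<Rightarrow>\<^sub>L 'h) \<Rightarrow> bool"
  where "qPVM \<iota> P \<longleftrightarrow>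
    (\<forall>E\<in>sets (borel_half_slice \<iota>). P E \<in> qbounded_ops \<and> qpositive (P E)) \<and>
    P (half_slice \<iota>) = id_blinfun \<and>
    (\<forall>E\<in>sets (borel_half_slice \<iota>). \<forall>E'\<in>sets (borel_half_slice \<iota>).
      P E o\<^sub>L P E' = P (E \<inter> E')) \<and>
    (\<forall>E :: nat \<Rightarrow> quat set. range E \<subseteq> sets (borel_half_slice \<iota>) \<longrightarrow> disjoint_family E \<longrightarrow>
      (\<forall>u. (\<lambda>n. P (E n) u) sums P (\<Union>n. E n) u))"

definition qsupp :: "quat \<Rightarrow> (quat set \<Rightarrow> 'h::quat_hilbert \<Rightarrow>\<^sub>L 'h) \<Rightarrow> quat set"
  where "qsupp \<iota> P =
    half_slice \<iota> - \<Union>{U. openin (top_of_set (half_slice \<iota>)) U \<and> P U = 0}"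

definition iqPVM ::
  "quat \<Rightarrow> (quat set \<Rightarrow> 'h::quat_hilbert \<Rightarrow>\<^sub>L 'h) \<Rightarrow> (quat \<Rightarrow> 'h \<Rightarrow>\<^sub>L 'h) \<Rightarrow> bool"
  where "iqPVM \<iota> P L \<longleftrightarrow> qPVM \<iota> P \<and> left_mult L \<and>
    (\<forall>E\<in>sets (borel_half_slice \<iota>). \<forall>q. P E o\<^sub>L L q = L q o\<^sub>L P E)"

definition bounded_iqPVM ::
  "quat \<Rightarrow> (quat set \<Rightarrow> 'h::quat_hilbert \<Rightarrow>\<^sub>L 'h) \<Rightarrow> (quat \<Rightarrow> 'h \<Rightarrow>\<^sub>L 'h) \<Rightarrow> bool"
  where "bounded_iqPVM \<iota> P L \<longleftrightarrow> iqPVM \<iota> P L \<and> bounded (qsupp \<iota> P)"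

text \<open>The canonical representation \<open>s = \<Sum>\<^sub>y y \<chi>\<^bsub>{s = y}\<^esub>\<close> of a simple function is used.\<close>

definition iq_simple_integral :: "quat \<Rightarrow> (quat set \<Rightarrow> 'h::quat_hilbert \<Rightarrow>\<^sub>L 'h) \<Rightarrow>
    (quat \<Rightarrow> 'h \<Rightarrow>\<^sub>L 'h) \<Rightarrow> (quat \<Rightarrow> quat) \<Rightarrow> 'h \<Rightarrow>\<^sub>L 'h"
  where "iq_simple_integral \<iota> P L s =
    (\<Sum>y\<in>s ` half_slice \<iota>. L y o\<^sub>L P (s -` {y} \<inter> half_slice \<iota>))"

text \<open>
  \<open>A = \<integral>\<phi> d\<P>\<close> for bounded Borel \<open>\<phi>\<close> on the half-slice. Boundedness and measurability
  of \<open>\<phi>\<close> are implied, since \<open>\<phi>\<close> is a uniform limit of simple functions.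
\<close>

definition has_iq_integral_bdd :: "quat \<Rightarrow> (quat set \<Rightarrow> 'h::quat_hilbert \<Rightarrow>\<^sub>L 'h) \<Rightarrow>
    (quat \<Rightarrow> 'h \<Rightarrow>\<^sub>L 'h) \<Rightarrow> (quat \<Rightarrow> quat) \<Rightarrow> ('h \<Rightarrow>\<^sub>L 'h) \<Rightarrow> bool"
  where "has_iq_integral_bdd \<iota> P L \<phi> A \<longleftrightarrow>
    (\<exists>s :: nat \<Rightarrow> quat \<Rightarrow> quat.
      (\<forall>n. simple_function (borel_half_slice \<iota>) (s n)) \<and>
      uniform_limit (half_slice \<iota>) s \<phi> sequentially \<and>
      (\<lambda>n. iq_simple_integral \<iota> P L (s n)) \<longlonglongrightarrow> A)"

text \<open>\<open>A = \<integral>\<psi> d\<P>\<close> for \<open>\<psi>\<close> bounded and Borel on the support, extended by \<open>0\<close> outside it.\<close>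

definition has_iq_integral :: "quat \<Rightarrow> (quat set \<Rightarrow> 'h::quat_hilbert \<Rightarrow>\<^sub>L 'h) \<Rightarrow>
    (quat \<Rightarrow> 'h \<Rightarrow>\<^sub>L 'h) \<Rightarrow> (quat \<Rightarrow> quat) \<Rightarrow> ('h \<Rightarrow>\<^sub>L 'h) \<Rightarrow> bool"
  where "has_iq_integral \<iota> P L \<psi> A \<longleftrightarrow>
    has_iq_integral_bdd \<iota> P L (\<lambda>x. if x \<in> qsupp \<iota> P then \<psi> x else 0) A"


section \<open>The spherical spectrum of a bounded operator\<close>

text \<open>
  Domains are trivial for bounded \<open>T\<close>, and \<open>T (2 Re q)\<close> is the map \<open>u \<mapsto> T (u \<cdot> 2 Re q)\<close>, a real
  multiple of \<open>T\<close>. Note that \<open>o\<^sub>L\<close> binds more weakly than \<open>+\<close> and \<open>-\<close>.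
\<close>

definition qDelta :: "quat \<Rightarrow> ('h::quat_hilbert \<Rightarrow>\<^sub>L 'h) \<Rightarrow> 'h \<Rightarrow>\<^sub>L 'h"
  where "qDelta q T = (T o\<^sub>L T) - (2 * qRe q) *\<^sub>R T + (norm q)\<^sup>2 *\<^sub>R id_blinfun"

definition dense_range :: "('h::quat_hilbert \<Rightarrow>\<^sub>L 'h) \<Rightarrow> bool"
  where "dense_range S \<longleftrightarrow> closure (range (blinfun_apply S)) = UNIV"

text \<open>Only used for injective \<open>S\<close>, where it says that \<open>S\<^sup>-\<^sup>1 : Ran S \<rightarrow> H\<close> is bounded.\<close>

definition bounded_inverse :: "('h::quat_hilbert \<Rightarrow>\<^sub>L 'h) \<Rightarrow> bool"
  where "bounded_inverse S \<longleftrightarrow>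
    (\<exists>K. \<forall>v\<in>range (blinfun_apply S). norm (inv (blinfun_apply S) v) \<le> K * norm v)"

definition spherical_resolvent_set :: "('h::quat_hilbert \<Rightarrow>\<^sub>L 'h) \<Rightarrow> quat set"
  where "spherical_resolvent_set T =
    {q. qker (qDelta q T) = {0} \<and> dense_range (qDelta q T) \<and> bounded_inverse (qDelta q T)}"

definition spherical_spectrum :: "('h::quat_hilbert \<Rightarrow>\<^sub>L 'h) \<Rightarrow> quat set"
  where "spherical_spectrum T = - spherical_resolvent_set T"

definition spherical_point_spectrum :: "('h::quat_hilbert \<Rightarrow>\<^sub>L 'h) \<Rightarrow> quat set"
  where "spherical_point_spectrum T = {q. qker (qDelta q T) \<noteq> {0}}"

definition spherical_residual_spectrum :: "('h::quat_hilbert \<Rightarrow>\<^sub>L 'h) \<Rightarrow> quat set"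
  where "spherical_residual_spectrum T =
    {q. qker (qDelta q T) = {0} \<and> \<not> dense_range (qDelta q T)}"

definition spherical_continuous_spectrum :: "('h::quat_hilbert \<Rightarrow>\<^sub>L 'h) \<Rightarrow> quat set"
  where "spherical_continuous_spectrum T =
    {q. qker (qDelta q T) = {0} \<and> dense_range (qDelta q T) \<and> \<not> bounded_inverse (qDelta q T)}"

end

theory Submission
  imports Defs
begin

text \<open>
  Everything is done in the real Hilbert space \<open>(H, Re \<langle>u|v\<rangle>)\<close>, where right linearity of an operator
  means that it commutes with the right multiplications and is hence inherited by every operator
  in a bicommutant. Write \<open>T = A + C\<close> with \<open>A\<close> self-adjoint and \<open>C\<close> skew-adjoint, and \<open>B = |C|\<close>.
  The binary digits of the commuting contractions obtained from \<open>A\<close> and \<open>B\<close> by an affine change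
  are commuting spectral projections; Caratheodory's theorem on the Cantor space turns them
  into a projection-valued measure, whose image under the digit expansion is \<open>P\<close>.

  Zorn's lemma yields a real form of \<open>H\<close> that is invariant under \<open>B\<close> and all \<open>P(E)\<close> and on which
  \<open>C u = (B u) \<iota>\<close>. The left multiplication of an orthonormal basis of this real form
  commutes with \<open>P\<close> and satisfies \<open>C = L\<^sub>\<iota> B\<close>, so that \<open>T = A + L\<^sub>\<iota> B\<close> is the integral of
  the identity.

  The spectral statements follow from \<open>\<Delta>\<^sub>q(T) = (T - L\<^sub>q)(T - L\<^sub>p)\<close>, where \<open>p\<close> is the conjugate of
  \<open>q\<close>, and \<open>\<parallel>(T - L\<^sub>q) u\<parallel>\<^sup>2 = \<integral> |x - q|\<^sup>2 d\<mu>\<^sub>u(x)\<close>. For uniqueness, another measure \<open>P'\<close>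
  commutes with \<open>P\<close>, and a nonzero vector in \<open>P(\<alpha> \<le> t) P'(\<alpha> > t) H\<close> would give
  \<open>\<langle>u|A u\<rangle>\<close> two incompatible bounds.
\<close>

section \<open>Quaternions\<close>

text \<open>The identity \<open>C = L \<iota> o\<^sub>L B\<close> prescribes
  \<open>L \<iota>\<close> on the closure of the range of \<open>B\<close> only, which is why
  uniqueness stops at the complement of the kernel of \<open>T - radj T\<close>. A left
  multiplication needs a whole Hilbert basis on which \<open>L q\<close> is right multiplication by
  \<open>q\<close>, and it must commute with all \<open>P E\<close>, although joint eigenvectors
  need not exist. The invariant real form takes the place of an eigenbasis: any real orthonormal
  basis of it serves.

  Binary digits replace a continuous functional calculus: the only analytic input is the square root
  of a positive operator, each digit is one spectral projection, and countable additivity on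
  cylinders is automatic, because they are clopen in a compact space. All projections so obtained
  commute with every operator that commutes with \<open>A\<close> and \<open>B\<close>. Hence
  \<open>P\<close> commutes with any operator that commutes with \<open>T\<close> and its adjoint,
  in particular with a competing \<open>P'\<close>, which puts the uniqueness argument among
  commuting projections.\<close>

lemma quat_sel_numeral [simp]:
  "qRe (numeral w) = numeral w" "qIm1 (numeral w) = 0" "qIm2 (numeral w) = 0" "qIm3 (numeral w) = 0"
  using quat_sel_of_real [of "numeral w"] by simp_all

lemma qcnj_sel [simp]:
  "qRe (qcnj q) = qRe q" "qIm1 (qcnj q) = - qIm1 q" "qIm2 (qcnj q) = - qIm2 q"
  "qIm3 (qcnj q) = - qIm3 q"
  by (simp_all add: qcnj_def)

lemma qcnj_simps [simp]:
  "qcnj (qcnj q) = q" "qcnj (of_real r) = of_real r" "qcnj 0 = 0" "qcnj 1 = 1"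
  "qcnj (- q) = - qcnj q"
  by (simp_all add: quat_eq_iff)

lemma qcnj_add: "qcnj (p + q) = qcnj p + qcnj q"
  and qcnj_mult: "qcnj (p * q) = qcnj q * qcnj p"
  by (simp_all add: quat_eq_iff algebra_simps)

lemma norm_quat_sq: "(norm q)\<^sup>2 = (qRe q)\<^sup>2 + (qIm1 q)\<^sup>2 + (qIm2 q)\<^sup>2 + (qIm3 q)\<^sup>2"
  by (simp add: norm_quat_def inner_quat_def power2_eq_square)

lemma norm_quat_mult_self:
  "norm q * norm q = qRe q * qRe q + qIm1 q * qIm1 q + qIm2 q * qIm2 q + qIm3 q * qIm3 q"
  using norm_quat_sq [of q] by (simp add: power2_eq_square)

lemma norm_qcnj [simp]: "norm (qcnj q) = norm q"
  by (simp add: norm_quat_def inner_quat_def)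

lemma qcnj_mult_self: "qcnj q * q = of_real ((norm q)\<^sup>2)" "q * qcnj q = of_real ((norm q)\<^sup>2)"
  by (simp_all add: quat_eq_iff norm_quat_mult_self power2_eq_square)

text \<open>Multiplying by 1, i, j, k moves each component into the real part up to sign. Identities
  of quaternion-valued inner products thereby follow from real ones.\<close>

lemma quat_eqI_qRe_mult:
  assumes "\<And>q. qRe (x * q) = qRe (y * q)"
  shows "x = y"
  using assms [of 1] assms [of "Quat 0 1 0 0"] assms [of "Quat 0 0 1 0"] assms [of "Quat 0 0 0 1"]
  by (simp add: quat_eq_iff)

lemma abs_qRe_le: "\<bar>qRe q\<bar> \<le> norm q"
  unfolding norm_quat_def inner_quat_def by (rule real_le_rsqrt) (simp add: power2_eq_square)

lemma bounded_linear_qRe: "bounded_linear qRe"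
  by (rule bounded_linear_intro [of _ 1]) (simp_all add: abs_qRe_le)

lemma bounded_linear_qcnj: "bounded_linear qcnj"
  by (rule bounded_linear_intro [of _ 1]) (simp_all add: quat_eq_iff)

lemma imag_units_iff: "q \<in> imag_units \<longleftrightarrow> qRe q = 0 \<and> norm q = 1"
proof -
  have "q ^ 2 = - 1 \<longleftrightarrow> qRe q = 0 \<and> (norm q)\<^sup>2 = 1"
  proof
    assume h: "q ^ 2 = - 1"
    then have e: "qRe q * qRe q - qIm1 q * qIm1 q - qIm2 q * qIm2 q - qIm3 q * qIm3 q = - 1"
      and z: "qRe q * qIm1 q = 0" "qRe q * qIm2 q = 0" "qRe q * qIm3 q = 0"
      by (auto simp: quat_eq_iff power2_eq_square algebra_simps)
    \<comment> \<open>The imaginary components of \<open>q ^ 2\<close> are those of \<open>q\<close>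
      times \<open>2 * qRe q\<close>; with a nonzero real part \<open>q\<close> would be real and
      have a negative square.\<close>
    have "qRe q = 0"
    proof (rule ccontr)
      assume "qRe q \<noteq> 0"
      with z e have "qRe q * qRe q = - 1"
        by simp
      then show False
        using zero_le_square [of "qRe q"] by linarith
    qed
    with e show "qRe q = 0 \<and> (norm q)\<^sup>2 = 1"
      by (simp add: norm_quat_mult_self power2_eq_square)
  next
    assume "qRe q = 0 \<and> (norm q)\<^sup>2 = 1"
    then have "qRe q = 0" "qIm1 q * qIm1 q + qIm2 q * qIm2 q + qIm3 q * qIm3 q = 1"
      by (auto simp: norm_quat_mult_self power2_eq_square)
    then show "q ^ 2 = - 1"
      by (simp add: quat_eq_iff power2_eq_square)
  qed
  then show ?thesis
    by (simp add: imag_units_def power2_eq_1_iff) (use norm_ge_zero [of q] in linarith)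
qed

lemma imag_unit_simps:
  assumes "\<iota> \<in> imag_units"
  shows "qRe \<iota> = 0" "norm \<iota> = 1" "\<iota> * \<iota> = - 1" "qcnj \<iota> = - \<iota>" "\<iota> * (\<iota> * x) = - x"
    "x * \<iota> * \<iota> = - x" "\<iota> \<bullet> \<iota> = 1"
proof -
  show 1: "qRe \<iota> = 0" "norm \<iota> = 1"
    using assms by (auto simp: imag_units_iff)
  show 2: "\<iota> * \<iota> = - 1"
    using assms by (simp add: imag_units_def power2_eq_square)
  show "qcnj \<iota> = - \<iota>"
    using 1 by (simp add: quat_eq_iff)
  show "\<iota> * (\<iota> * x) = - x" "x * \<iota> * \<iota> = - x"
    using 2 by (simp_all add: mult.assoc [symmetric], simp add: mult.assoc)
  show "\<iota> \<bullet> \<iota> = 1"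
    using 1 by (simp add: norm_eq_sqrt_inner)
qed

text \<open>Imaginary quaternions orthogonal to \<open>\<iota>\<close> anticommute with it; the two
  cases supply an explicit one that does not vanish.\<close>

lemma anticommuting_imag_unit:
  assumes "\<iota> \<in> imag_units"
  obtains j where "j \<in> imag_units" "\<iota> * j = - (j * \<iota>)"
proof -
  have "\<exists>v. v \<noteq> 0 \<and> qRe v = 0 \<and> \<iota> \<bullet> v = 0"
  proof (cases "qIm1 \<iota> = 0 \<and> qIm2 \<iota> = 0")
    case True
    then show ?thesis
      by (intro exI [of _ "Quat 0 1 0 0"]) (simp add: quat_eq_iff inner_quat_def)
  next
    case False
    then show ?thesis
      by (intro exI [of _ "Quat 0 (qIm2 \<iota>) (- qIm1 \<iota>) 0"]) (auto simp add: quat_eq_iff inner_quat_def)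
  qed
  then obtain v where v: "v \<noteq> 0" "qRe v = 0" "\<iota> \<bullet> v = 0"
    by blast
  define j where "j = (1 / norm v) *\<^sub>R v"
  have j: "qRe j = 0" "norm j = 1" "\<iota> \<bullet> j = 0"
    using v by (simp_all add: j_def)
  have "\<iota> * j = - (j * \<iota>)"
    using j imag_unit_simps(1) [OF assms] by (simp add: quat_eq_iff inner_quat_def algebra_simps)
  with j that show ?thesis
    by (simp add: imag_units_iff)
qed

section \<open>Slices as real planes with coordinates \<open>qRe x\<close> and
  \<open>\<iota> \<bullet> x\<close>\<close>

lemma half_slice_subset: "half_slice \<iota> \<subseteq> slice \<iota>"
  by (auto simp: half_slice_def slice_def)

lemma slice_eq:
  assumes "\<iota> \<in> imag_units" "x \<in> slice \<iota>"
  shows "x = of_real (qRe x) + \<iota> * of_real (\<iota> \<bullet> x)"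
proof -
  obtain a b where x: "x = of_real a + \<iota> * of_real b"
    using assms by (auto simp: slice_def)
  have "\<iota> \<bullet> x = b * (\<iota> \<bullet> \<iota>)"
    using imag_unit_simps(1) [OF assms(1)] by (simp add: x inner_quat_def algebra_simps)
  then show ?thesis
    using imag_unit_simps [OF assms(1)] by (simp add: x)
qed

lemma half_slice_iff:
  assumes "\<iota> \<in> imag_units"
  shows "x \<in> half_slice \<iota> \<longleftrightarrow> x = of_real (qRe x) + \<iota> * of_real (\<iota> \<bullet> x) \<and> 0 \<le> \<iota> \<bullet> x"
proof
  assume "x \<in> half_slice \<iota>"
  then obtain a b where x: "x = of_real a + \<iota> * of_real b" "b \<ge> 0"
    by (auto simp: half_slice_def)
  have "\<iota> \<bullet> x = b * (\<iota> \<bullet> \<iota>)"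
    using imag_unit_simps(1) [OF assms(1)] by (simp add: x inner_quat_def algebra_simps)
  then show "x = of_real (qRe x) + \<iota> * of_real (\<iota> \<bullet> x) \<and> 0 \<le> \<iota> \<bullet> x"
    using imag_unit_simps [OF assms(1)] x by simp
next
  assume "x = of_real (qRe x) + \<iota> * of_real (\<iota> \<bullet> x) \<and> 0 \<le> \<iota> \<bullet> x"
  then show "x \<in> half_slice \<iota>"
    unfolding half_slice_def by blast
qed

lemma slice_coords:
  assumes "\<iota> \<in> imag_units"
  shows "qRe (of_real a + \<iota> * of_real b) = a" "\<iota> \<bullet> (of_real a + \<iota> * of_real b) = b"
proof -
  have "\<iota> \<bullet> (of_real a + \<iota> * of_real b) = b * (\<iota> \<bullet> \<iota>)"
    using imag_unit_simps(1) [OF assms(1)] by (simp add: inner_quat_def algebra_simps)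
  then show "qRe (of_real a + \<iota> * of_real b) = a" "\<iota> \<bullet> (of_real a + \<iota> * of_real b) = b"
    using imag_unit_simps [OF assms] by simp_all
qed

lemma half_sliceI:
  assumes "\<iota> \<in> imag_units" "b \<ge> 0"
  shows "of_real a + \<iota> * of_real b \<in> half_slice \<iota>"
  using assms by (auto simp: half_slice_def)

lemma slice_im_eq:
  assumes "\<iota> \<in> imag_units" "x \<in> slice \<iota>"
  shows "slice_im \<iota> x = \<iota> \<bullet> x"
  unfolding slice_im_def
  using slice_eq [OF assms] slice_coords [OF assms(1)] by (intro the_equality) (blast, metis)

lemma norm_slice_sq:
  assumes "\<iota> \<in> imag_units"
  shows "(norm (of_real a + \<iota> * of_real b))\<^sup>2 = a\<^sup>2 + b\<^sup>2"
proof -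
  have "(norm (of_real a + \<iota> * of_real b))\<^sup>2 = a\<^sup>2 + b\<^sup>2 * (norm \<iota>)\<^sup>2"
    unfolding norm_quat_sq using imag_unit_simps(1) [OF assms]
    by (simp add: power_mult_distrib algebra_simps)
  then show ?thesis
    using imag_unit_simps [OF assms] by simp
qed

text \<open>The one point in which the sphere of \<open>q\<close> meets the half-slice. As
  \<open>qDelta q T\<close> depends on \<open>q\<close> only through its real part and norm, this
  point stands in for \<open>q\<close> in spectral questions.\<close>

definition half_slice_rep :: "quat \<Rightarrow> quat \<Rightarrow> quat" where
  "half_slice_rep \<iota> q = of_real (qRe q) + \<iota> * of_real (norm (q - of_real (qRe q)))"

lemma half_slice_rep:
  assumes "\<iota> \<in> imag_units"
  shows "half_slice_rep \<iota> q \<in> half_slice \<iota>" "qRe (half_slice_rep \<iota> q) = qRe q"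
    "norm (half_slice_rep \<iota> q) = norm q"
proof -
  show "half_slice_rep \<iota> q \<in> half_slice \<iota>" "qRe (half_slice_rep \<iota> q) = qRe q"
    using assms slice_coords by (auto simp: half_slice_rep_def intro: half_sliceI)
  have "(norm (half_slice_rep \<iota> q))\<^sup>2 = (norm q)\<^sup>2"
    unfolding half_slice_rep_def norm_slice_sq [OF assms] by (simp add: norm_quat_sq)
  then show "norm (half_slice_rep \<iota> q) = norm q"
    by simp
qed

lemma half_slice_eqI:
  assumes "\<iota> \<in> imag_units" "x \<in> half_slice \<iota>" "y \<in> half_slice \<iota>" "qRe x = qRe y" "norm x = norm y"
  shows "x = y"
proof -
  have "(norm x)\<^sup>2 = (qRe x)\<^sup>2 + (\<iota> \<bullet> x)\<^sup>2" "(norm y)\<^sup>2 = (qRe y)\<^sup>2 + (\<iota> \<bullet> y)\<^sup>2" "\<iota> \<bullet> x \<ge> 0" "\<iota> \<bullet> y \<ge> 0"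
    using assms half_slice_iff [OF assms(1)] norm_slice_sq [OF assms(1)] by metis+
  with assms have "\<iota> \<bullet> x = \<iota> \<bullet> y"
    by (metis add_left_cancel power2_eq_iff_nonneg)
  then show ?thesis
    using assms half_slice_iff [OF assms(1)] by metis
qed

lemma qsphere_Int_half_slice:
  assumes "\<iota> \<in> imag_units"
  shows "qsphere q \<inter> half_slice \<iota> = {half_slice_rep \<iota> q}"
  using half_slice_rep [OF assms, of q] half_slice_eqI [OF assms] by (auto simp: qsphere_def)

lemma half_slice_rep_id:
  assumes "\<iota> \<in> imag_units" "q \<in> half_slice \<iota>"
  shows "half_slice_rep \<iota> q = q"
  using half_slice_eqI [OF assms(1) half_slice_rep(1) [OF assms(1)] assms(2)] half_slice_rep [OF assms(1)]
  by blast

text \<open>Imaginary \<open>v\<close> and \<open>w\<close> of equal norm satisfy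
  \<open>v * v = w * w\<close>, so \<open>s = v + w\<close> gives \<open>s * v = w * s\<close>. If
  \<open>v + w = 0\<close>, a unit anticommuting with \<open>\<iota>\<close> does the same. The
  conjugation converts an approximate eigenvalue on the half-slice into \<open>q\<close>
  itself.\<close>

lemma half_slice_rep_conjugate:
  assumes "\<iota> \<in> imag_units"
  obtains s where "norm s = 1" "s * q = half_slice_rep \<iota> q * s"
proof -
  define v where "v = q - of_real (qRe q)"
  have v: "qRe v = 0" by (simp add: v_def)
  have q: "q = of_real (qRe q) + v" by (simp add: v_def)
  have "\<exists>s. s \<noteq> 0 \<and> s * v = (\<iota> * of_real (norm v)) * s"
  proof (cases "v = - (\<iota> * of_real (norm v))")
    case True
    obtain j where j: "j \<in> imag_units" "\<iota> * j = - (j * \<iota>)"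
      using anticommuting_imag_unit [OF assms] .
    have "j * v = \<iota> * of_real (norm v) * j"
      by (subst True) (simp add: j mult.assoc scaleR_conv_of_real [symmetric] of_real_def)
    moreover have "j \<noteq> 0"
      using imag_unit_simps(2) [OF j(1)] by auto
    ultimately show ?thesis by blast
  next
    case False
    have vv: "v * v = - of_real ((norm v)\<^sup>2)"
      using v by (simp add: quat_eq_iff norm_quat_mult_self power2_eq_square)
    define w where "w = \<iota> * of_real (norm v)"
    have ww: "w * w = - of_real ((norm v)\<^sup>2)"
      using imag_unit_simps [OF assms]
      by (simp add: w_def of_real_def power2_eq_square mult_scaleR_right)
    have "(v + w) * v = w * (v + w)"
      by (simp add: ring_distribs vv ww)
    moreover have "v + w \<noteq> 0"
      using False by (metis add_eq_0_iff2 w_def)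
    ultimately show ?thesis unfolding w_def by blast
  qed
  then obtain s where s: "s \<noteq> 0" "s * v = (\<iota> * of_real (norm v)) * s"
    by blast
  define s' where "s' = (1 / norm s) *\<^sub>R s"
  have "norm s' = 1"
    using s by (simp add: s'_def)
  moreover have "s' * v = (\<iota> * of_real (norm v)) * s'"
    using s by (simp add: s'_def)
  then have "s' * q = half_slice_rep \<iota> q * s'"
    using arg_cong [OF q, of "(*) s'"] unfolding half_slice_rep_def v_def [symmetric]
    by (simp add: ring_distribs of_real_def)
  ultimately show ?thesis
    using that by blast
qed

section \<open>The real Hilbert space underlying a quaternionic Hilbert space\<close>

lemma scaleQ_zero_right [simp]: "u \<cdot>\<^sub>Q 0 = (0 :: 'h::quat_hilbert)"
  using scaleQ_add_right [of u 0 0] by simp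

lemma scaleQ_zero_left [simp]: "0 \<cdot>\<^sub>Q q = (0 :: 'h::quat_hilbert)"
  using scaleQ_add_left [of 0 0 q] by simp

lemma scaleQ_minus_left: "(- u) \<cdot>\<^sub>Q q = - (u \<cdot>\<^sub>Q q :: 'h::quat_hilbert)"
  using scaleQ_add_left [of u "- u" q] by (simp add: minus_unique)

lemma scaleQ_minus_right: "u \<cdot>\<^sub>Q (- q) = - (u \<cdot>\<^sub>Q q :: 'h::quat_hilbert)"
  using scaleQ_add_right [of u q "- q"] by (simp add: minus_unique)

lemma scaleQ_diff_left: "(u - v) \<cdot>\<^sub>Q q = u \<cdot>\<^sub>Q q - (v \<cdot>\<^sub>Q q :: 'h::quat_hilbert)"
  using scaleQ_add_left [of u "- v" q] by (simp add: scaleQ_minus_left)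

lemma scaleQ_diff_right: "u \<cdot>\<^sub>Q (p - q) = u \<cdot>\<^sub>Q p - (u \<cdot>\<^sub>Q q :: 'h::quat_hilbert)"
  using scaleQ_add_right [of u p "- q"] by (simp add: scaleQ_minus_right)

lemma scaleQ_of_real: "u \<cdot>\<^sub>Q of_real r = r *\<^sub>R (u :: 'h::quat_hilbert)"
  by (simp add: scaleR_scaleQ)

lemma scaleQ_scaleR_left: "(r *\<^sub>R u) \<cdot>\<^sub>Q q = r *\<^sub>R (u \<cdot>\<^sub>Q q :: 'h::quat_hilbert)"
proof -
  have "of_real r * q = q * of_real r"
    by (simp add: of_real_def)
  then show ?thesis
    by (metis scaleQ_mult scaleQ_of_real)
qed

lemma scaleQ_scaleR_right: "u \<cdot>\<^sub>Q (r *\<^sub>R q) = r *\<^sub>R (u \<cdot>\<^sub>Q q :: 'h::quat_hilbert)"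
proof -
  have "r *\<^sub>R q = q * of_real r"
    by (simp add: of_real_def)
  then show ?thesis
    by (metis scaleQ_mult scaleQ_of_real)
qed

lemma qinner_add_right: "qinner u (v + w) = qinner u v + qinner (u :: 'h::quat_hilbert) w"
  using qinner_linear_right [of u v 1 w 1] by (simp add: scaleQ_one)

lemma qinner_zero_right [simp]: "qinner u 0 = (0::quat)" for u :: "'h::quat_hilbert"
  using qinner_add_right [of u 0 0] by simp

lemma qinner_scaleQ_right: "qinner u (v \<cdot>\<^sub>Q p) = qinner (u :: 'h::quat_hilbert) v * p"
  using qinner_linear_right [of u v p 0 0] by simp

lemma qinner_add_left: "qinner (v + w) u = qinner v u + qinner w (u :: 'h::quat_hilbert)"
  by (metis qcnj_add qinner_qcnj qinner_add_right)

lemma qinner_scaleQ_left: "qinner (v \<cdot>\<^sub>Q p) u = qcnj p * qinner v (u :: 'h::quat_hilbert)"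
  by (metis qcnj_mult qinner_qcnj qinner_scaleQ_right)

lemma qinner_zero_left [simp]: "qinner 0 u = (0::quat)" for u :: "'h::quat_hilbert"
  using qinner_add_left [of 0 0 u] by simp

lemma qinner_minus_right: "qinner u (- v) = - qinner u (v :: 'h::quat_hilbert)"
  using qinner_add_right [of u v "- v"] by (simp add: minus_unique)

lemma qinner_minus_left: "qinner (- u) v = - qinner u (v :: 'h::quat_hilbert)"
  using qinner_add_left [of u "- u" v] by (simp add: minus_unique)

lemma qinner_diff_right: "qinner u (v - w) = qinner u v - qinner (u :: 'h::quat_hilbert) w"
  using qinner_add_right [of u v "- w"] by (simp add: qinner_minus_right)

lemma qinner_diff_left: "qinner (v - w) u = qinner v u - qinner w (u :: 'h::quat_hilbert)"
  using qinner_add_left [of v "- w" u] by (simp add: qinner_minus_left)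

lemma qinner_scaleR_right: "qinner u (r *\<^sub>R v) = r *\<^sub>R qinner u (v :: 'h::quat_hilbert)"
  by (metis qinner_scaleQ_right scaleQ_of_real mult_scaleR_right mult.right_neutral of_real_def)

lemma qinner_scaleR_left: "qinner (r *\<^sub>R u) v = r *\<^sub>R qinner u (v :: 'h::quat_hilbert)"
  by (metis qinner_qcnj qinner_scaleR_right bounded_linear.linear bounded_linear_qcnj linear_scale)

definition hinner :: "'h::quat_hilbert \<Rightarrow> 'h \<Rightarrow> real"  (\<open>\<langle>_,_\<rangle>\<close>)
  where "\<langle>u,v\<rangle> = qRe (qinner u v)"

lemma hinner_commute: "\<langle>u,v\<rangle> = \<langle>v,u\<rangle>"
  unfolding hinner_def by (subst qinner_qcnj) simp

lemma hinner_simps: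
  "\<langle>u + v,w\<rangle> = \<langle>u,w\<rangle> + \<langle>v,w\<rangle>" "\<langle>w,u + v\<rangle> = \<langle>w,u\<rangle> + \<langle>w,v\<rangle>"
  "\<langle>u - v,w\<rangle> = \<langle>u,w\<rangle> - \<langle>v,w\<rangle>" "\<langle>w,u - v\<rangle> = \<langle>w,u\<rangle> - \<langle>w,v\<rangle>"
  "\<langle>- u,w\<rangle> = - \<langle>u,w\<rangle>" "\<langle>w,- u\<rangle> = - \<langle>w,u\<rangle>"
  "\<langle>r *\<^sub>R u,w\<rangle> = r * \<langle>u,w\<rangle>" "\<langle>w,r *\<^sub>R u\<rangle> = r * \<langle>w,u\<rangle>"
  by (simp_all add: hinner_def qinner_add_left qinner_add_right qinner_diff_left qinner_diff_right
      qinner_minus_left qinner_minus_right qinner_scaleR_left qinner_scaleR_right)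

lemma hinner_zero [simp]: "\<langle>0,u\<rangle> = 0" "\<langle>u,0\<rangle> = 0"
  by (simp_all add: hinner_def)

lemma hinner_self: "\<langle>u,u\<rangle> = (norm u)\<^sup>2"
proof -
  have "0 \<le> qRe (qinner u u)"
    using qinner_nonneg [of u] by auto
  then show ?thesis
    by (simp add: hinner_def norm_qinner)
qed

lemma qinner_self: "qinner u u = of_real ((norm u)\<^sup>2)"
  using qinner_nonneg [of u] hinner_self [of u] unfolding hinner_def
  by (metis imageE quat_sel_of_real(1))

lemma hinner_scaleQ_left: "\<langle>u \<cdot>\<^sub>Q q,v\<rangle> = \<langle>u,v \<cdot>\<^sub>Q qcnj q\<rangle>"
  by (simp add: hinner_def qinner_scaleQ_left qinner_scaleQ_right algebra_simps)

lemma hinner_scaleQ_right: "\<langle>u,v \<cdot>\<^sub>Q q\<rangle> = qRe (qinner u v * q)"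
  by (simp add: hinner_def qinner_scaleQ_right)

text \<open>The quaternionic product is recovered from the real one by letting the second argument
  run through its right multiples. For right-linear operators a real adjointness relation therefore
  becomes a quaternionic one.\<close>

lemma qinner_eqI:
  assumes "\<And>q. \<langle>u,v \<cdot>\<^sub>Q q\<rangle> = \<langle>u',v' \<cdot>\<^sub>Q q\<rangle>"
  shows "qinner u v = qinner u' v'"
  using assms by (intro quat_eqI_qRe_mult) (simp only: hinner_scaleQ_right)

lemma hinner_eqI:
  assumes "\<And>v. \<langle>u,v\<rangle> = \<langle>u',v\<rangle>"
  shows "u = u'"
proof -
  have "\<langle>u - u',u - u'\<rangle> = 0"
    using assms [of "u - u'"] by (simp only: hinner_simps(3))
  then show ?thesis
    by (simp add: hinner_self)
qed

lemma norm_add_sq: "(norm (u + v))\<^sup>2 = (norm u)\<^sup>2 + 2 * \<langle>u,v\<rangle> + (norm v)\<^sup>2" for u :: "'h::quat_hilbert"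
  by (simp add: hinner_self [symmetric] hinner_simps hinner_commute)

lemma norm_diff_sq: "(norm (u - v))\<^sup>2 = (norm u)\<^sup>2 - 2 * \<langle>u,v\<rangle> + (norm v)\<^sup>2" for u :: "'h::quat_hilbert"
  by (simp add: hinner_self [symmetric] hinner_simps hinner_commute)

lemma norm_scaleQ: "norm (u \<cdot>\<^sub>Q q) = norm u * norm q" for u :: "'h::quat_hilbert"
proof -
  have "(norm (u \<cdot>\<^sub>Q q))\<^sup>2 = (norm u * norm q)\<^sup>2"
    unfolding hinner_self [symmetric] hinner_scaleQ_left scaleQ_mult [symmetric] qcnj_mult_self(2)
      scaleQ_of_real hinner_simps
    by (simp add: hinner_self power_mult_distrib)
  then show ?thesis
    by (simp add: power2_eq_iff_nonneg)
qed

text \<open>The minimum of the quadratic is attained at \<open>- b / c\<close>; for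
  \<open>c = 0\<close> an affine function that is bounded below is constant. This yields
  Cauchy-Schwarz and, for \<open>a = 0\<close>, the vanishing of a first variation.\<close>

lemma quadratic_form_discriminant:
  fixes a b c :: real
  assumes "\<And>t. 0 \<le> a + 2 * b * t + c * t\<^sup>2" "0 \<le> c" "0 \<le> a"
  shows "b\<^sup>2 \<le> a * c"
proof (cases "c = 0")
  case True
  have "b = 0"
  proof (rule ccontr)
    assume "b \<noteq> 0"
    then show False
      \<comment> \<open>At this point the affine function takes the value
        \<open>- a - 2\<close>.\<close>
      using assms(1) [of "- (a + 1) / b"] assms(3) True by simp
  qed
  then show ?thesis using assms True by simp
next
  case False
  then have "c > 0" using assms by simp
  then show ?thesis
    using assms(1) [of "- b / c"] by (simp add: power2_eq_square field_simps)
qed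

lemma hinner_bound: "\<bar>\<langle>u,v\<rangle>\<bar> \<le> norm u * norm v"
proof -
  have "0 \<le> (norm u)\<^sup>2 + 2 * \<langle>u,v\<rangle> * t + (norm v)\<^sup>2 * t\<^sup>2" for t
    using norm_add_sq [of u "t *\<^sub>R v"] zero_le_power2 [of "norm (u + t *\<^sub>R v)"]
    by (simp add: hinner_simps power_mult_distrib algebra_simps)
  then have "\<langle>u,v\<rangle>\<^sup>2 \<le> (norm u)\<^sup>2 * (norm v)\<^sup>2"
    by (rule quadratic_form_discriminant) auto
  then show ?thesis
    by (metis abs_ge_zero abs_of_nonneg mult_nonneg_nonneg norm_ge_zero power2_abs
        power2_le_imp_le power_mult_distrib)
qed

lemma bounded_bilinear_hinner: "bounded_bilinear hinner"
  by (rule bounded_bilinear.intro)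
    (auto simp: hinner_simps intro!: exI [of _ 1] hinner_bound)

lemmas hinner_tendsto [tendsto_intros] = bounded_bilinear.tendsto [OF bounded_bilinear_hinner]

lemma bounded_linear_scaleQ: "bounded_linear (\<lambda>u :: 'h::quat_hilbert. u \<cdot>\<^sub>Q q)"
  by (rule bounded_linear_intro [of _ "norm q"])
    (simp_all add: scaleQ_add_left scaleQ_scaleR_left norm_scaleQ)

definition right_mult :: "quat \<Rightarrow> 'h::quat_hilbert \<Rightarrow>\<^sub>L 'h"
  where "right_mult q = Blinfun (\<lambda>u. u \<cdot>\<^sub>Q q)"

lemma right_mult_apply [simp]: "right_mult q u = u \<cdot>\<^sub>Q q"
  by (simp add: right_mult_def bounded_linear_Blinfun_apply bounded_linear_scaleQ)

text \<open>Each of the four components is, up to sign, a real product of \<open>u\<close> with a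
  unit multiple of \<open>v\<close>; summing them gives the factor 4, which is crude but sufficient
  for continuity.\<close>

lemma qinner_norm_bound: "norm (qinner u v) \<le> 4 * norm u * norm v" for u :: "'h::quat_hilbert"
proof -
  have *: "\<bar>\<langle>u,v \<cdot>\<^sub>Q q\<rangle>\<bar> \<le> norm u * norm v" if "norm q = 1" for q
    using hinner_bound [of u "v \<cdot>\<^sub>Q q"] that by (simp add: norm_scaleQ)
  have n: "norm (Quat 0 1 0 0) = 1" "norm (Quat 0 0 1 0) = 1" "norm (Quat 0 0 0 1) = 1"
    by (simp_all add: norm_quat_def inner_quat_def)
  have b: "b \<in> Basis \<Longrightarrow> \<bar>qinner u v \<bullet> b\<bar> \<le> norm u * norm v" for b
    using * [of 1] * [OF n(1)] * [OF n(2)] * [OF n(3)]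
    by (auto simp: Basis_quat_def inner_quat_def hinner_scaleQ_right)
  have c: "card (Basis :: quat set) \<le> 4"
    unfolding Basis_quat_def by (simp add: card_insert_if)
  have "norm (qinner u v) \<le> (\<Sum>b\<in>Basis. \<bar>qinner u v \<bullet> b\<bar>)"
    by (rule norm_le_l1)
  also have "\<dots> \<le> of_nat (card (Basis :: quat set)) * (norm u * norm v)"
    by (rule sum_bounded_above) (rule b)
  also have "\<dots> \<le> 4 * (norm u * norm v)"
    using c by (intro mult_right_mono) auto
  finally show ?thesis by simp
qed

lemma bounded_bilinear_qinner: "bounded_bilinear (qinner :: 'h::quat_hilbert \<Rightarrow> 'h \<Rightarrow> quat)"
proof (rule bounded_bilinear.intro)
  show "\<exists>K. \<forall>a b :: 'h. norm (qinner a b) \<le> norm a * norm b * K"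
    by (intro exI [of _ 4] allI order_trans [OF qinner_norm_bound]) simp
qed (simp_all add: qinner_add_left qinner_add_right qinner_scaleR_right qinner_scaleR_left)

section \<open>Closed subspaces, orthogonal projection and Riesz representation\<close>

lemma subspace_closure:
  assumes "subspace (S :: 'a::real_normed_vector set)"
  shows "subspace (closure S)"
proof (rule subspaceI)
  show "0 \<in> closure S"
    using assms closure_subset by (auto simp: subspace_def)
next
  fix x y assume "x \<in> closure S" "y \<in> closure S"
  then obtain f g where "\<And>n. f n \<in> S" "f \<longlonglongrightarrow> x" "\<And>n. g n \<in> S" "g \<longlonglongrightarrow> y"
    unfolding closure_sequential by blast
  then show "x + y \<in> closure S"
    unfolding closure_sequential using assms
    by (intro exI [of _ "\<lambda>n. f n + g n"]) (auto intro: tendsto_add subspace_add)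
next
  fix c x assume "x \<in> closure S"
  then obtain f where "\<And>n. f n \<in> S" "f \<longlonglongrightarrow> x"
    unfolding closure_sequential by blast
  then show "c *\<^sub>R x \<in> closure S"
    unfolding closure_sequential using assms
    by (intro exI [of _ "\<lambda>n. c *\<^sub>R f n"]) (auto intro: tendsto_scaleR subspace_scale)
qed

text \<open>With \<open>closure_span_minimal\<close> this is the recurring density argument: two
  bounded linear maps that agree on a set agree on its closed span.\<close>

lemma closed_subspace_equalizer:
  fixes f g :: "'a::real_normed_vector \<Rightarrow> 'b::real_normed_vector"
  assumes "bounded_linear f" "bounded_linear g"
  shows "closed {x. f x = g x}" "subspace {x. f x = g x}"
  using assms
  by (auto intro!: closed_Collect_eq linear_continuous_on
      simp: subspace_def bounded_linear_def linear_add linear_scale linear_0)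

lemma closure_span_minimal:
  assumes "M \<subseteq> K" "closed K" "subspace K"
  shows "closure (span M) \<subseteq> K"
  using assms by (intro closure_minimal span_minimal)

text \<open>A minimizing sequence is Cauchy by the parallelogram law.\<close>

theorem orthogonal_projection_exists:
  fixes M :: "'h::quat_hilbert set"
  assumes M: "subspace M" "closed M"
  obtains m where "m \<in> M" "\<And>v. v \<in> M \<Longrightarrow> \<langle>u - m,v\<rangle> = 0"
proof -
  define d where "d = Inf ((\<lambda>m. (norm (u - m))\<^sup>2) ` M)"
  have bdd: "bdd_below ((\<lambda>m. (norm (u - m))\<^sup>2) ` M)"
    by (rule bdd_belowI [of _ 0]) auto
  have "0 \<in> M" using M by (simp add: subspace_0)
  have dle: "d \<le> (norm (u - m))\<^sup>2" if "m \<in> M" for m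
    unfolding d_def using that by (intro cINF_lower [OF bdd])
  have "\<exists>m\<in>M. (norm (u - m))\<^sup>2 < d + 1 / real (Suc n)" for n
  proof -
    have "Inf ((\<lambda>m. (norm (u - m))\<^sup>2) ` M) < d + 1 / real (Suc n)"
      by (simp add: d_def)
    then show ?thesis
      using \<open>0 \<in> M\<close> bdd by (subst (asm) cINF_less_iff) auto
  qed
  then obtain f where f: "\<And>n. f n \<in> M" "\<And>n. (norm (u - f n))\<^sup>2 < d + 1 / real (Suc n)"
    by metis
  have par: "(norm (f m - f n))\<^sup>2 \<le> 2 / real (Suc m) + 2 / real (Suc n)" for m n
  proof -
    have "(1/2) *\<^sub>R (f m + f n) \<in> M"
      using f M by (auto intro: subspace_add subspace_scale)
    from dle [OF this] have
      "4 * d \<le> (norm (2 *\<^sub>R (u - (1/2) *\<^sub>R (f m + f n))))\<^sup>2"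
      by (simp add: power_mult_distrib)
    also have "2 *\<^sub>R (u - (1/2) *\<^sub>R (f m + f n)) = (u - f m) + (u - f n)"
      by (simp add: algebra_simps scaleR_2)
    finally have 1: "4 * d \<le> (norm ((u - f m) + (u - f n)))\<^sup>2" .
    have "(norm (f m - f n))\<^sup>2 = (norm ((u - f n) - (u - f m)))\<^sup>2"
      by simp
    also have "\<dots> = 2 * (norm (u - f m))\<^sup>2 + 2 * (norm (u - f n))\<^sup>2 - (norm ((u - f m) + (u - f n)))\<^sup>2"
      unfolding norm_add_sq norm_diff_sq [of "u - f n"] by (simp add: hinner_commute)
    finally show ?thesis
      using 1 f(2) [of m] f(2) [of n] by argo
  qed
  have "Cauchy f"
  proof (rule metric_CauchyI)
    fix e :: real assume "e > 0"
    then obtain N where N: "4 / e\<^sup>2 < real N"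
      using reals_Archimedean2 by blast
    have "dist (f m) (f n) < e" if "m \<ge> N" "n \<ge> N" for m n
    proof -
      have N0: "real N > 0" using N \<open>e > 0\<close>
        by (smt (verit) divide_nonneg_nonneg zero_le_power2)
      have "2 / real (Suc m) \<le> 2 / real N" "2 / real (Suc n) \<le> 2 / real N"
        using that N0 by (auto intro!: divide_left_mono)
      then have "(norm (f m - f n))\<^sup>2 \<le> 4 / real N"
        using par [of m n] by simp
      also have "\<dots> < e\<^sup>2"
        using N N0 \<open>e > 0\<close> by (simp add: field_simps)
      finally show ?thesis
        using \<open>e > 0\<close> by (simp add: dist_norm power2_less_imp_less)
    qed
    then show "\<exists>N. \<forall>m\<ge>N. \<forall>n\<ge>N. dist (f m) (f n) < e" by blast
  qed
  then obtain m where lim: "f \<longlonglongrightarrow> m"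
    using Cauchy_convergent_iff convergent_def by blast
  have mM: "m \<in> M"
    using closed_sequentially [OF M(2)] f(1) lim by blast
  have "(\<lambda>n. (norm (u - f n))\<^sup>2) \<longlonglongrightarrow> (norm (u - m))\<^sup>2"
    by (intro tendsto_intros lim)
  moreover have "(\<lambda>n. d + 1 / real (Suc n)) \<longlonglongrightarrow> d + 0"
    by (intro tendsto_add tendsto_const LIMSEQ_Suc [OF lim_1_over_n])
  ultimately have md: "(norm (u - m))\<^sup>2 \<le> d"
    using f(2) by (intro LIMSEQ_le [of _ _ "\<lambda>n. d + 1 / real (Suc n)"]) (auto intro: less_imp_le)
  have "\<langle>u - m,v\<rangle> = 0" if v: "v \<in> M" for v
  proof -
    \<comment> \<open>Minimality of \<open>m\<close> along the line
      \<open>m - t *\<^sub>R v\<close>. The leading 0 is the constant term, so the discriminant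
      forces the linear coefficient to vanish.\<close>
    have "0 \<le> 0 + 2 * \<langle>u - m,v\<rangle> * t + (norm v)\<^sup>2 * t\<^sup>2" for t
    proof -
      have "m - t *\<^sub>R v \<in> M"
        using mM v M by (auto intro: subspace_diff subspace_scale)
      from dle [OF this] have "d \<le> (norm ((u - m) + t *\<^sub>R v))\<^sup>2"
        by (simp add: algebra_simps)
      with md have "(norm (u - m))\<^sup>2 \<le> (norm ((u - m) + t *\<^sub>R v))\<^sup>2"
        by linarith
      then show ?thesis
        unfolding norm_add_sq by (simp add: hinner_simps power_mult_distrib algebra_simps)
    qed
    then have "\<langle>u - m,v\<rangle>\<^sup>2 \<le> 0 * (norm v)\<^sup>2"
      by (rule quadratic_form_discriminant) auto
    then show ?thesis by simp
  qed
  with mM that show ?thesis by blast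
qed

lemma closed_subspace_dense:
  fixes K :: "'h::quat_hilbert set"
  assumes "subspace K" "closed K" "\<And>u. (\<And>v. v \<in> K \<Longrightarrow> \<langle>u,v\<rangle> = 0) \<Longrightarrow> u = 0"
  shows "K = UNIV"
proof -
  have "u \<in> K" for u
  proof -
    obtain m where "m \<in> K" "\<And>v. v \<in> K \<Longrightarrow> \<langle>u - m,v\<rangle> = 0"
      using orthogonal_projection_exists assms by blast
    then show ?thesis using assms(3) [of "u - m"] by simp
  qed
  then show ?thesis by blast
qed

theorem riesz_representation:
  fixes f :: "'h::quat_hilbert \<Rightarrow> real"
  assumes f: "bounded_linear f"
  obtains w where "\<And>v. f v = \<langle>w,v\<rangle>"
proof (cases "\<forall>v. f v = 0")
  case True
  then show ?thesis using that [of 0] by simp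
next
  case False
  then obtain u where u: "f u \<noteq> 0" by blast
  have K: "subspace {v. f v = 0}" "closed {v. f v = 0}"
    using closed_subspace_equalizer [OF f bounded_linear_zero] by auto
  obtain m where m: "f m = 0" "\<And>v. f v = 0 \<Longrightarrow> \<langle>u - m,v\<rangle> = 0"
    using orthogonal_projection_exists [OF K, of u] by auto
  define z where "z = u - m"
  interpret f: bounded_linear f by (rule f)
  have fz: "f z \<noteq> 0" using u m by (simp add: z_def f.diff)
  then have "z \<noteq> 0" using f.zero by auto
  show ?thesis
  proof (rule that [of "(f z / (norm z)\<^sup>2) *\<^sub>R z"])
    fix v
    \<comment> \<open>\<open>z\<close> is orthogonal to the kernel of \<open>f\<close>, and
      subtracting this multiple of \<open>z\<close> moves \<open>v\<close> into the kernel.\<close>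
    have "f (v - (f v / f z) *\<^sub>R z) = 0"
      using fz by (simp add: f.diff f.scaleR)
    then have "\<langle>z,v - (f v / f z) *\<^sub>R z\<rangle> = 0"
      using m(2) by (simp add: z_def)
    then have "\<langle>z,v\<rangle> = f v / f z * (norm z)\<^sup>2"
      by (simp add: hinner_simps hinner_self)
    then show "f v = \<langle>(f z / (norm z)\<^sup>2) *\<^sub>R z,v\<rangle>"
      using fz \<open>z \<noteq> 0\<close> by (simp add: hinner_simps)
  qed
qed

section \<open>Adjoints\<close>

theorem real_adjoint_exists:
  fixes T :: "'h::quat_hilbert \<Rightarrow>\<^sub>L 'h"
  obtains S :: "'h \<Rightarrow>\<^sub>L 'h" where "\<And>u v. \<langle>S u,v\<rangle> = \<langle>u,T v\<rangle>"
proof -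
  have "\<exists>w. \<forall>v. \<langle>u,T v\<rangle> = \<langle>w,v\<rangle>" for u
  proof -
    have "bounded_linear (\<lambda>v. \<langle>u,T v\<rangle>)"
      using bounded_linear_compose [OF bounded_bilinear.bounded_linear_right
          [OF bounded_bilinear_hinner] blinfun.bounded_linear_right] .
    then show ?thesis
      using riesz_representation by metis
  qed
  then obtain g where g: "\<And>u v. \<langle>u,T v\<rangle> = \<langle>g u,v\<rangle>"
    by metis
  have "bounded_linear g"
  proof (rule bounded_linear_intro [of _ "norm T"])
    show "g (x + y) = g x + g y" for x y
      by (rule hinner_eqI) (simp add: hinner_simps g [symmetric])
    show "g (r *\<^sub>R x) = r *\<^sub>R g x" for r x
      by (rule hinner_eqI) (simp add: hinner_simps g [symmetric])
    show "norm (g x) \<le> norm x * norm T" for x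
    proof -
      have "(norm (g x))\<^sup>2 = \<langle>x,T (g x)\<rangle>"
        by (simp add: g hinner_self)
      also have "\<dots> \<le> norm x * norm (T (g x))"
        using hinner_bound abs_le_iff by blast
      also have "\<dots> \<le> norm x * (norm T * norm (g x))"
        by (intro mult_left_mono norm_blinfun) auto
      finally have "norm (g x) * norm (g x) \<le> (norm x * norm T) * norm (g x)"
        by (simp add: power2_eq_square mult.assoc)
      then show ?thesis
        by (cases "norm (g x) = 0") (auto simp: mult_le_cancel_right)
    qed
  qed
  then show ?thesis
    using that [of "Blinfun g"] g by (simp add: bounded_linear_Blinfun_apply)
qed

text \<open>The adjoint for the real product exists for all bounded real-linear operators, so it is
  available for elements of a commutant that are not right linear; on right-linear operators it is
  \<open>qadj\<close> (\<open>qadj_eq_radj\<close>).\<close>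

definition radj :: "('h::quat_hilbert \<Rightarrow>\<^sub>L 'h) \<Rightarrow> 'h \<Rightarrow>\<^sub>L 'h"
  where "radj T = (SOME S. \<forall>u v. \<langle>blinfun_apply S u,v\<rangle> = \<langle>u,T v\<rangle>)"

lemma radj: "\<langle>radj T u,v\<rangle> = \<langle>u,T v\<rangle>"
proof -
  have "\<exists>S. \<forall>u v. \<langle>blinfun_apply S u,v\<rangle> = \<langle>u,T v\<rangle>"
    using real_adjoint_exists by metis
  from someI_ex [OF this] show ?thesis
    unfolding radj_def by blast
qed

lemma radj': "\<langle>u,radj T v\<rangle> = \<langle>T u,v\<rangle>"
  using radj [of T v u] by (simp add: hinner_commute)

lemma radj_unique:
  assumes "\<And>u v. \<langle>blinfun_apply S u,v\<rangle> = \<langle>u,blinfun_apply T v\<rangle>"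
  shows "radj T = S"
  by (intro blinfun_eqI hinner_eqI) (simp add: radj assms)

lemma radj_radj [simp]: "radj (radj T) = T"
  by (rule radj_unique) (simp add: radj')

lemma radj_id [simp]: "radj id_blinfun = id_blinfun"
  by (rule radj_unique) simp

lemma radj_add: "radj (S + T) = radj S + radj T"
  and radj_diff: "radj (S - T) = radj S - radj T"
  and radj_scaleR: "radj (r *\<^sub>R T) = r *\<^sub>R radj T"
  and radj_compose: "radj (S o\<^sub>L T) = radj T o\<^sub>L radj S"
  by (rule radj_unique, simp add: blinfun.bilinear_simps hinner_simps radj)+

lemma qbounded_opsD: "T \<in> qbounded_ops \<Longrightarrow> T (u \<cdot>\<^sub>Q q) = T u \<cdot>\<^sub>Q q"
  by (simp add: qbounded_ops_def)

lemma qbounded_ops_simps: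
  assumes "S \<in> qbounded_ops" "T \<in> qbounded_ops"
  shows "S + T \<in> qbounded_ops" "S - T \<in> qbounded_ops" "r *\<^sub>R S \<in> qbounded_ops"
    "S o\<^sub>L T \<in> qbounded_ops" "- S \<in> qbounded_ops" "id_blinfun \<in> qbounded_ops"
  using assms by (auto simp: qbounded_ops_def blinfun.bilinear_simps scaleQ_add_left scaleQ_diff_left
      scaleQ_scaleR_left scaleQ_minus_left)

lemma radj_qbounded:
  assumes "T \<in> qbounded_ops"
  shows "radj T \<in> qbounded_ops"
proof -
  have "radj T (u \<cdot>\<^sub>Q q) = radj T u \<cdot>\<^sub>Q q" for u q
    using qbounded_opsD [OF assms]
    by (intro hinner_eqI) (simp add: radj hinner_scaleQ_left)
  then show ?thesis by (simp add: qbounded_ops_def)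
qed

lemma radj_qinner:
  assumes "T \<in> qbounded_ops"
  shows "qinner (radj T u) v = qinner u (T v)"
  by (rule qinner_eqI) (simp add: radj qbounded_opsD [OF assms])

lemma qadj_eq_radj:
  assumes "T \<in> qbounded_ops"
  shows "qadj T = radj T"
  unfolding qadj_def
proof (rule the_equality)
  show "radj T \<in> qbounded_ops \<and> (\<forall>u v. qinner (radj T u) v = qinner u (T v))"
    using assms by (simp add: radj_qbounded radj_qinner)
  show "S = radj T" if "S \<in> qbounded_ops \<and> (\<forall>u v. qinner (S u) v = qinner u (T v))" for S
    using that by (intro radj_unique [symmetric]) (simp add: hinner_def)
qed

section \<open>Square roots and spectral projections\<close>

definition selfadj :: "('h::quat_hilbert \<Rightarrow>\<^sub>L 'h) \<Rightarrow> bool"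
  where "selfadj T \<longleftrightarrow> (\<forall>u v. \<langle>T u,v\<rangle> = \<langle>u,T v\<rangle>)"

definition pos_op :: "('h::quat_hilbert \<Rightarrow>\<^sub>L 'h) \<Rightarrow> bool"
  where "pos_op T \<longleftrightarrow> selfadj T \<and> (\<forall>u. 0 \<le> \<langle>u,T u\<rangle>)"

definition proj_op :: "('h::quat_hilbert \<Rightarrow>\<^sub>L 'h) \<Rightarrow> bool"
  where "proj_op E \<longleftrightarrow> selfadj E \<and> (\<forall>u. E (E u) = E u)"

definition commutes :: "('h::quat_hilbert \<Rightarrow>\<^sub>L 'h) \<Rightarrow> ('h \<Rightarrow>\<^sub>L 'h) \<Rightarrow> bool"
  where "commutes S T \<longleftrightarrow> (\<forall>u. S (T u) = T (S u))"

definition bicomm :: "('h::quat_hilbert \<Rightarrow>\<^sub>L 'h) \<Rightarrow> ('h \<Rightarrow>\<^sub>L 'h) \<Rightarrow> bool"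
  where "bicomm S R \<longleftrightarrow> (\<forall>X. commutes X S \<longrightarrow> commutes X R)"

lemma commutesD: "commutes S T \<Longrightarrow> S (T u) = T (S u)"
  by (simp add: commutes_def)

lemma commutes_sym: "commutes S T \<Longrightarrow> commutes T S"
  by (simp add: commutes_def)

lemma commutes_self [simp]: "commutes S S"
  by (simp add: commutes_def)

lemma commutes_simps:
  "commutes X S \<Longrightarrow> commutes X T \<Longrightarrow> commutes X (S + T)"
  "commutes X S \<Longrightarrow> commutes X T \<Longrightarrow> commutes X (S - T)"
  "commutes X S \<Longrightarrow> commutes X T \<Longrightarrow> commutes X (S o\<^sub>L T)"
  "commutes X S \<Longrightarrow> commutes X (r *\<^sub>R S)"
  "commutes X S \<Longrightarrow> commutes X (- S)"
  "commutes X id_blinfun" "commutes X 0"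
  by (simp_all add: commutes_def blinfun.bilinear_simps)

lemma commutes_sum:
  "(\<And>i. i \<in> I \<Longrightarrow> commutes X (f i)) \<Longrightarrow> commutes X (\<Sum>i\<in>I. f i)"
  by (induction I rule: infinite_finite_induct) (auto intro: commutes_simps)

lemma blinfun_apply_tendsto: "S \<longlonglongrightarrow> T \<Longrightarrow> (\<lambda>n. blinfun_apply (S n) u) \<longlonglongrightarrow> T u"
  by (intro tendsto_intros)

lemma commutes_lim:
  assumes "S \<longlonglongrightarrow> T" "\<And>n. commutes X (S n)"
  shows "commutes X T"
  unfolding commutes_def
proof
  fix u
  have "(\<lambda>n. X (S n u)) \<longlonglongrightarrow> X (T u)"
    using assms(1) by (intro tendsto_intros)
  moreover have "(\<lambda>n. X (S n u)) \<longlonglongrightarrow> T (X u)"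
    using blinfun_apply_tendsto [OF assms(1)] assms(2) by (simp add: commutes_def)
  ultimately show "X (T u) = T (X u)"
    using LIMSEQ_unique by blast
qed

lemma commutes_radj: "commutes X S \<Longrightarrow> commutes (radj X) (radj S)"
  unfolding commutes_def by (intro allI hinner_eqI) (simp add: radj)

lemma selfadj_radj: "selfadj S \<longleftrightarrow> radj S = S"
  unfolding selfadj_def by (metis radj radj_unique)

lemma selfadjD: "selfadj S \<Longrightarrow> \<langle>S u,v\<rangle> = \<langle>u,S v\<rangle>"
  by (simp add: selfadj_def)

lemma selfadj_simps:
  "selfadj S \<Longrightarrow> selfadj T \<Longrightarrow> selfadj (S + T)"
  "selfadj S \<Longrightarrow> selfadj T \<Longrightarrow> selfadj (S - T)"
  "selfadj S \<Longrightarrow> selfadj (r *\<^sub>R S)"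
  "selfadj id_blinfun" "selfadj (0 :: 'h::quat_hilbert \<Rightarrow>\<^sub>L 'h)"
  "selfadj S \<Longrightarrow> selfadj T \<Longrightarrow> commutes S T \<Longrightarrow> selfadj (S o\<^sub>L T)"
  by (simp_all add: selfadj_def commutes_def blinfun.bilinear_simps hinner_simps)

lemma selfadj_sum:
  "(\<And>i. i \<in> I \<Longrightarrow> selfadj (f i)) \<Longrightarrow> selfadj (\<Sum>i\<in>I. f i)"
  by (induction I rule: infinite_finite_induct) (auto intro: selfadj_simps)

lemma selfadj_lim:
  assumes "S \<longlonglongrightarrow> T" "\<And>n. selfadj (S n)"
  shows "selfadj T"
  unfolding selfadj_def
proof (intro allI)
  fix u v
  have "(\<lambda>n. \<langle>S n u,v\<rangle>) \<longlonglongrightarrow> \<langle>T u,v\<rangle>" "(\<lambda>n. \<langle>u,S n v\<rangle>) \<longlonglongrightarrow> \<langle>u,T v\<rangle>"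
    using assms(1) by (intro tendsto_intros; simp)+
  then show "\<langle>T u,v\<rangle> = \<langle>u,T v\<rangle>"
    using assms(2) LIMSEQ_unique by (auto simp: selfadj_def)
qed

text \<open>Polarization. It lets operators be identified by their quadratic forms, that is, by what
  the scalar spectral measures see.\<close>

lemma selfadj_eqI:
  assumes "selfadj S" "selfadj T" "\<And>u. \<langle>u,S u\<rangle> = \<langle>u,T u\<rangle>"
  shows "S = T"
proof (intro blinfun_eqI hinner_eqI)
  fix u v
  have "\<langle>u,S v\<rangle> = \<langle>v,S u\<rangle>" "\<langle>u,T v\<rangle> = \<langle>v,T u\<rangle>"
    using assms(1,2) by (metis hinner_commute selfadjD)+
  then have "2 * \<langle>v,S u\<rangle> = \<langle>u + v,S (u + v)\<rangle> - \<langle>u,S u\<rangle> - \<langle>v,S v\<rangle>"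
    and "2 * \<langle>v,T u\<rangle> = \<langle>u + v,T (u + v)\<rangle> - \<langle>u,T u\<rangle> - \<langle>v,T v\<rangle>"
    by (simp_all add: blinfun.bilinear_simps hinner_simps)
  then have "\<langle>v,S u\<rangle> = \<langle>v,T u\<rangle>"
    by (simp add: assms(3))
  then show "\<langle>S u,v\<rangle> = \<langle>T u,v\<rangle>"
    by (simp add: hinner_commute)
qed

lemma pos_op_simps:
  "pos_op S \<Longrightarrow> pos_op T \<Longrightarrow> pos_op (S + T)"
  "0 \<le> r \<Longrightarrow> pos_op S \<Longrightarrow> pos_op (r *\<^sub>R S)"
  "pos_op id_blinfun"
  by (simp_all add: pos_op_def selfadj_simps blinfun.bilinear_simps hinner_simps hinner_self)

lemma pos_op_radj_compose: "pos_op (radj S o\<^sub>L S)"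
  by (simp add: pos_op_def selfadj_def radj radj' hinner_self)

lemma pos_op_cauchy_schwarz:
  assumes "pos_op S"
  shows "\<langle>u,S v\<rangle>\<^sup>2 \<le> \<langle>u,S u\<rangle> * \<langle>v,S v\<rangle>"
proof (rule quadratic_form_discriminant)
  have "\<langle>v,S u\<rangle> = \<langle>u,S v\<rangle>"
    using assms by (metis hinner_commute pos_op_def selfadj_def)
  then show "0 \<le> \<langle>u,S u\<rangle> + 2 * \<langle>u,S v\<rangle> * t + \<langle>v,S v\<rangle> * t\<^sup>2" for t
    using assms [unfolded pos_op_def, THEN conjunct2, rule_format, of "u + t *\<^sub>R v"]
    by (simp add: blinfun.bilinear_simps hinner_simps power2_eq_square algebra_simps)
qed (use assms in \<open>auto simp: pos_op_def\<close>)

lemma pos_op_eq_0: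
  assumes "pos_op S" "\<langle>u,S u\<rangle> = 0"
  shows "S u = 0"
  using pos_op_cauchy_schwarz [OF assms(1), of "S u" u] assms(2) by (simp add: hinner_self)

text \<open>Cauchy-Schwarz for the form of \<open>S\<close> at \<open>S u\<close> and
  \<open>u\<close>; the factor \<open>\<langle>S u,S (S u)\<rangle>\<close> is at most
  \<open>norm S * (norm (S u))\<^sup>2\<close>, and one square cancels.\<close>

lemma pos_op_norm_sq_le:
  assumes S: "pos_op S"
  shows "(norm (S u))\<^sup>2 \<le> norm S * \<langle>u,S u\<rangle>"
proof (cases "S u = 0")
  case True
  then show ?thesis by simp
next
  case False
  have "((norm (S u))\<^sup>2)\<^sup>2 \<le> \<langle>S u,S (S u)\<rangle> * \<langle>u,S u\<rangle>"
    using pos_op_cauchy_schwarz [OF S, of "S u" u] by (simp add: hinner_self)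
  also have "\<langle>S u,S (S u)\<rangle> \<le> norm (S u) * (norm S * norm (S u))"
    using hinner_bound [of "S u" "S (S u)"] norm_blinfun [of S "S u"]
    by (meson abs_le_iff mult_left_mono norm_ge_zero order_trans)
  then have "\<langle>S u,S (S u)\<rangle> * \<langle>u,S u\<rangle> \<le> norm (S u) * (norm S * norm (S u)) * \<langle>u,S u\<rangle>"
    using S by (intro mult_right_mono) (auto simp: pos_op_def)
  also have "\<dots> = (norm (S u))\<^sup>2 * (norm S * \<langle>u,S u\<rangle>)"
    by (simp add: power2_eq_square)
  finally have "(norm (S u))\<^sup>2 * (norm (S u))\<^sup>2 \<le> (norm (S u))\<^sup>2 * (norm S * \<langle>u,S u\<rangle>)"
    by (simp add: power2_eq_square)
  then show ?thesis
    by (rule mult_left_le_imp_le) (use False in simp)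
qed

text \<open>\<open>pos_op_norm_sq_le\<close> gives
  \<open>(norm S)\<^sup>2 \<le> norm S\<close>.\<close>

lemma pos_op_norm_le_1:
  assumes S: "pos_op S" "\<And>u. \<langle>u,S u\<rangle> \<le> (norm u)\<^sup>2"
  shows "norm S \<le> 1"
proof -
  have "norm (S u) \<le> sqrt (norm S) * norm u" for u
  proof -
    have "(norm (S u))\<^sup>2 \<le> norm S * (norm u)\<^sup>2"
      using pos_op_norm_sq_le [OF S(1), of u] S(2) [of u]
      by (meson mult_left_mono norm_ge_zero order_trans)
    also have "\<dots> = (sqrt (norm S) * norm u)\<^sup>2"
      by (simp add: power_mult_distrib)
    finally show ?thesis
      by (rule power2_le_imp_le) auto
  qed
  then have "norm S \<le> sqrt (norm S)"
    by (intro norm_blinfun_bound) auto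
  then have "(norm S)\<^sup>2 \<le> norm S"
    by (metis norm_ge_zero power2_eq_square power_mono real_sqrt_pow2)
  then show ?thesis
    by (cases "norm S = 0") (auto simp: power2_eq_square mult_le_cancel_right2)
qed

section \<open>Square roots of positive operators by iteration\<close>

primrec op_iter :: "('h::quat_hilbert \<Rightarrow>\<^sub>L 'h) \<Rightarrow> nat \<Rightarrow> 'h \<Rightarrow>\<^sub>L 'h" where
  "op_iter X 0 = 0"
| "op_iter X (Suc n) = (1/2) *\<^sub>R (X + (op_iter X n o\<^sub>L op_iter X n))"

primrec real_iter :: "nat \<Rightarrow> real" where
  "real_iter 0 = 0"
| "real_iter (Suc n) = (1 + real_iter n * real_iter n) / 2"

lemma real_iter_bounds: "0 \<le> real_iter n" "real_iter n \<le> 1"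
proof -
  have "0 \<le> real_iter n \<and> real_iter n \<le> 1"
    by (induction n) (auto intro: mult_le_one)
  then show "0 \<le> real_iter n" "real_iter n \<le> 1" by auto
qed

lemma op_iter_norm:
  assumes "norm X \<le> 1"
  shows "norm (op_iter X n) \<le> real_iter n"
proof (induction n)
  case (Suc n)
  have "norm (op_iter X n o\<^sub>L op_iter X n) \<le> real_iter n * real_iter n"
    by (rule order_trans [OF norm_blinfun_compose]) (intro mult_mono Suc real_iter_bounds norm_ge_zero)
  then show ?case
    using assms norm_triangle_ineq [of X "op_iter X n o\<^sub>L op_iter X n"] by simp
qed simp

text \<open>The splitting \<open>a\<^sup>2 - b\<^sup>2 = a (a - b) + (a - b) b\<close> carries the
  norm bounds of one step to the next, and the scalar iterates satisfy the same recursion with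
  equality.\<close>

lemma op_iter_diff:
  assumes "norm X \<le> 1"
  shows "norm (op_iter X (Suc n) - op_iter X n) \<le> real_iter (Suc n) - real_iter n"
proof (induction n)
  case 0
  then show ?case using assms by simp
next
  case (Suc n)
  define a b where "a = op_iter X (Suc n)" and "b = op_iter X n"
  define r s where "r = real_iter (Suc n)" and "s = real_iter n"
  have "op_iter X (Suc (Suc n)) - a = (1/2) *\<^sub>R ((a o\<^sub>L (a - b)) + ((a - b) o\<^sub>L b))"
  proof -
    have *: "(1/2) *\<^sub>R (X + (p o\<^sub>L p)) - (1/2) *\<^sub>R (X + (q o\<^sub>L q))
        = (1/2) *\<^sub>R ((p o\<^sub>L (p - q)) + ((p - q) o\<^sub>L q))" for p q
      by (intro blinfun_eqI) (simp add: blinfun.bilinear_simps algebra_simps)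
    have "op_iter X (Suc (Suc n)) = (1/2) *\<^sub>R (X + (a o\<^sub>L a))" "a = (1/2) *\<^sub>R (X + (b o\<^sub>L b))"
      by (simp_all only: a_def b_def op_iter.simps)
    then show ?thesis
      using * [of a b] by argo
  qed
  also have "norm \<dots> \<le> (1/2) * (norm (a o\<^sub>L (a - b)) + norm ((a - b) o\<^sub>L b))"
    by (simp add: norm_triangle_ineq)
  also have "\<dots> \<le> (1/2) * (r * (r - s) + (r - s) * s)"
  proof -
    have "norm a \<le> r" "norm b \<le> s" "norm (a - b) \<le> r - s" "0 \<le> r" "0 \<le> s"
      unfolding a_def b_def r_def s_def
      by (fact op_iter_norm [OF assms] Suc real_iter_bounds)+
    moreover from \<open>norm (a - b) \<le> r - s\<close> have "0 \<le> r - s"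
      using norm_ge_zero order_trans by blast
    ultimately have "norm (a o\<^sub>L (a - b)) \<le> r * (r - s)" "norm ((a - b) o\<^sub>L b) \<le> (r - s) * s"
      by (auto intro!: order_trans [OF norm_blinfun_compose] mult_mono)
    then show ?thesis by simp
  qed
  also have "\<dots> = real_iter (Suc (Suc n)) - r"
    unfolding r_def s_def by (simp add: algebra_simps)
  finally show ?case
    by (simp add: a_def r_def)
qed

text \<open>Telescoping \<open>op_iter_diff\<close> bounds the distance of two iterates by the
  increment of \<open>real_iter\<close>, which is increasing and bounded by 1, hence Cauchy.\<close>

lemma op_iter_convergent:
  assumes "norm X \<le> 1"
  shows "convergent (op_iter X)"
proof -
  have d: "norm (op_iter X (m + k) - op_iter X m) \<le> real_iter (m + k) - real_iter m" for m k
  proof (induction k)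
    case (Suc k)
    have "norm (op_iter X (m + Suc k) - op_iter X m)
        \<le> norm (op_iter X (Suc (m + k)) - op_iter X (m + k)) + norm (op_iter X (m + k) - op_iter X m)"
      using norm_triangle_ineq [of "op_iter X (Suc (m + k)) - op_iter X (m + k)"
          "op_iter X (m + k) - op_iter X m"] by (simp del: op_iter.simps)
    then show ?case
      using op_iter_diff [OF assms, of "m + k"] Suc by simp
  qed simp
  have "0 \<le> real_iter (Suc n) - real_iter n" for n
    using op_iter_diff [OF assms, of n] norm_ge_zero order_trans by blast
  then have "incseq real_iter"
    by (intro incseq_SucI) (simp only: diff_ge_0_iff_ge)
  then have "Cauchy real_iter"
    using incseq_convergent [of real_iter 1] real_iter_bounds
    by (metis Cauchy_convergent_iff convergentI)
  have "Cauchy (op_iter X)"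
  proof (rule metric_CauchyI)
    fix e :: real assume "e > 0"
    then obtain N where N: "\<And>m n. m \<ge> N \<Longrightarrow> n \<ge> N \<Longrightarrow> dist (real_iter m) (real_iter n) < e"
      using \<open>Cauchy real_iter\<close> unfolding Cauchy_def by blast
    have *: "dist (op_iter X m) (op_iter X n) < e" if mn: "m \<ge> N" "n \<ge> m" for m n
    proof -
      have "norm (op_iter X n - op_iter X m) \<le> real_iter n - real_iter m"
        using d [of m "n - m"] mn by simp
      also have "\<dots> \<le> dist (real_iter n) (real_iter m)"
        by (simp add: dist_real_def)
      also have "\<dots> < e"
        using N mn by simp
      finally show ?thesis
        by (simp add: dist_norm norm_minus_commute)
    qed
    then show "\<exists>N. \<forall>m\<ge>N. \<forall>n\<ge>N. dist (op_iter X m) (op_iter X n) < e"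
      by (metis dist_commute nle_le)
  qed
  then show ?thesis
    by (simp add: Cauchy_convergent_iff)
qed

text \<open>
  If \<open>Y = (X + Y\<^sup>2) / 2\<close> then \<open>(1 - Y)\<^sup>2 = 1 - X\<close>; the iteration starting from \<open>0\<close> converges in norm
  because it is dominated by the scalar iteration for \<open>X = 1\<close>.
\<close>

lemma pos_op_sqrt_contraction:
  assumes S: "pos_op S" "\<And>u. \<langle>u,S u\<rangle> \<le> (norm u)\<^sup>2"
  shows "\<exists>R. pos_op R \<and> R o\<^sub>L R = S \<and> bicomm S R"
proof -
  define X where "X = id_blinfun - S"
  have "pos_op X"
    using S by (simp add: X_def pos_op_def selfadj_simps blinfun.bilinear_simps hinner_simps hinner_self)
  moreover have "\<langle>u,X u\<rangle> \<le> (norm u)\<^sup>2" for u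
    using S by (simp add: X_def pos_op_def blinfun.bilinear_simps hinner_simps hinner_self)
  ultimately have X1: "norm X \<le> 1"
    by (rule pos_op_norm_le_1)
  obtain Y where Y: "op_iter X \<longlonglongrightarrow> Y"
    using op_iter_convergent [OF X1] convergent_def by blast
  have "commutes Z (op_iter X n)" if "commutes Z S" for Z n
    using that by (induction n) (auto simp: X_def intro!: commutes_simps)
  then have cY: "commutes Z Y" if "commutes Z S" for Z
    using commutes_lim [OF Y] that by blast
  have "selfadj (op_iter X n)" for n
    using \<open>pos_op X\<close> by (induction n) (auto simp: pos_op_def intro!: selfadj_simps)
  then have sY: "selfadj Y"
    using selfadj_lim [OF Y] by blast
  have "(\<lambda>n. op_iter X (Suc n)) \<longlonglongrightarrow> (1/2) *\<^sub>R (X + (Y o\<^sub>L Y))"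
    unfolding op_iter.simps by (intro tendsto_intros Y bounded_bilinear.tendsto [OF bounded_bilinear_blinfun_compose])
  then have eq: "Y = (1/2) *\<^sub>R (X + (Y o\<^sub>L Y))"
    using LIMSEQ_unique LIMSEQ_Suc [OF Y] by blast
  have "norm Y \<le> 1"
    using Y by (rule LIMSEQ_le_const2 [OF tendsto_norm])
      (meson op_iter_norm [OF X1] real_iter_bounds(2) order_trans)
  define R where "R = id_blinfun - Y"
  have "0 \<le> \<langle>u,R u\<rangle>" for u
  proof -
    have "\<langle>u,Y u\<rangle> \<le> norm u * norm (Y u)"
      using hinner_bound abs_le_iff by blast
    also have "\<dots> \<le> norm u * (1 * norm u)"
      using norm_blinfun [of Y u] \<open>norm Y \<le> 1\<close>
      by (meson mult_left_mono mult_right_mono norm_ge_zero order_trans)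
    finally show ?thesis
      by (simp add: R_def blinfun.bilinear_simps hinner_simps hinner_self power2_eq_square)
  qed
  then have "pos_op R"
    using sY by (simp add: pos_op_def R_def selfadj_simps)
  moreover have "R o\<^sub>L R = S"
  proof (rule blinfun_eqI)
    fix u
    have "2 *\<^sub>R Y u = X u + Y (Y u)"
      by (subst (1) eq) (simp add: blinfun.bilinear_simps)
    then show "(R o\<^sub>L R) u = S u"
      by (simp add: R_def X_def blinfun.bilinear_simps scaleR_2 algebra_simps)
  qed
  moreover have "bicomm S R"
    using cY by (auto simp: bicomm_def R_def intro!: commutes_simps)
  ultimately show ?thesis by blast
qed

theorem pos_op_sqrt_exists:
  assumes S: "pos_op S"
  shows "\<exists>R. pos_op R \<and> R o\<^sub>L R = S \<and> bicomm S R"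
proof -
  \<comment> \<open>The summand 1 keeps the scaling factor positive for
    \<open>S = 0\<close>.\<close>
  define c where "c = norm S + 1"
  have c: "c > 0" "c \<ge> norm S" by (simp_all add: c_def add_nonneg_pos)
  define S' where "S' = (1 / c) *\<^sub>R S"
  have "pos_op S'"
    using S c by (simp add: S'_def pos_op_simps)
  moreover have "\<langle>u,S' u\<rangle> \<le> (norm u)\<^sup>2" for u
  proof -
    have "\<langle>u,S u\<rangle> \<le> norm u * (norm S * norm u)"
      using hinner_bound [of u "S u"] norm_blinfun [of S u]
      by (meson abs_le_iff mult_left_mono norm_ge_zero order_trans)
    also have "\<dots> \<le> norm u * (c * norm u)"
      using c by (intro mult_left_mono mult_right_mono) auto
    finally show ?thesis
      using c by (simp add: S'_def blinfun.bilinear_simps hinner_simps power2_eq_square field_simps)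
  qed
  ultimately obtain R where R: "pos_op R" "R o\<^sub>L R = S'" "bicomm S' R"
    using pos_op_sqrt_contraction by blast
  have "commutes X S \<Longrightarrow> commutes X S'" for X
    unfolding S'_def by (rule commutes_simps)
  then have "bicomm S (sqrt c *\<^sub>R R)"
    using R(3) by (auto simp: bicomm_def intro!: commutes_simps)
  moreover have "(sqrt c *\<^sub>R R) o\<^sub>L (sqrt c *\<^sub>R R) = S"
  proof (rule blinfun_eqI)
    fix u
    have "R (R u) = (1 / c) *\<^sub>R S u"
      using arg_cong [OF R(2), of "\<lambda>B. blinfun_apply B u"] by (simp add: S'_def blinfun.bilinear_simps)
    then show "((sqrt c *\<^sub>R R) o\<^sub>L (sqrt c *\<^sub>R R)) u = S u"
      using c by (simp add: blinfun.bilinear_simps)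
  qed
  moreover have "pos_op (sqrt c *\<^sub>R R)"
    using R c by (simp add: pos_op_simps)
  ultimately show ?thesis by blast
qed

text \<open>The root from \<open>pos_op_sqrt_exists\<close> lies in the bicommutant of the square,
  so it commutes with every other root, and each root is compared with it. For commuting roots
  \<open>A\<close> and \<open>R\<close> the vector \<open>v = A u - R u\<close> satisfies
  \<open>A v + R v = 0\<close>; by positivity \<open>A v\<close> and \<open>R v\<close> both vanish,
  and so does \<open>(norm v)\<^sup>2 = \<langle>u,A v - R v\<rangle>\<close>.\<close>

theorem pos_op_sqrt_unique:
  assumes A: "pos_op A" and R: "pos_op R" and eq: "A o\<^sub>L A = R o\<^sub>L R"
  shows "A = R"
proof -
  have *: "A = R" if A: "pos_op A" and R: "pos_op R" "bicomm (A o\<^sub>L A) R"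
    and eq: "R o\<^sub>L R = A o\<^sub>L A" for A R :: "'a \<Rightarrow>\<^sub>L 'a"
  proof (rule blinfun_eqI)
    fix u
    have AR: "A (R x) = R (A x)" for x
      using R(2) by (simp add: bicomm_def commutes_def)
    have RR: "R (R x) = A (A x)" for x
      using arg_cong [OF eq, of "\<lambda>B. blinfun_apply B x"] by simp
    define v where "v = A u - R u"
    have "A v + R v = 0"
      by (simp add: v_def blinfun.bilinear_simps AR RR)
    then have "\<langle>v,A v\<rangle> + \<langle>v,R v\<rangle> = 0"
      by (simp add: hinner_simps [symmetric])
    moreover have "0 \<le> \<langle>v,A v\<rangle>" "0 \<le> \<langle>v,R v\<rangle>"
      using A R by (auto simp: pos_op_def)
    ultimately have "\<langle>v,A v\<rangle> = 0" "\<langle>v,R v\<rangle> = 0" by linarith+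
    then have "A v = 0" "R v = 0"
      using pos_op_eq_0 A R by auto
    have "(norm v)\<^sup>2 = \<langle>A u - R u,v\<rangle>"
      by (simp add: hinner_self [symmetric] v_def)
    also have "\<dots> = \<langle>u,A v - R v\<rangle>"
      using A R by (simp add: hinner_simps pos_op_def selfadj_def)
    also have "\<dots> = 0"
      by (simp add: \<open>A v = 0\<close> \<open>R v = 0\<close>)
    finally show "A u = R u"
      by (simp add: v_def)
  qed
  obtain B where B: "pos_op B" "B o\<^sub>L B = A o\<^sub>L A" "bicomm (A o\<^sub>L A) B"
    using pos_op_sqrt_exists [of "A o\<^sub>L A"] pos_op_radj_compose [of A] A
    by (metis pos_op_def selfadj_radj)
  have "A = B" using * [OF A B(1) B(3)] B(2) by simp
  moreover have "R = B"
    using * [OF R B(1)] B eq by simp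
  ultimately show ?thesis by simp
qed

section \<open>Projections onto kernels and spectral projections\<close>

lemma proj_op_hinner: "proj_op E \<Longrightarrow> \<langle>u,E u\<rangle> = (norm (E u))\<^sup>2"
  by (metis hinner_self proj_op_def selfadj_def)

lemma proj_op_norm_le: "proj_op E \<Longrightarrow> norm (E u) \<le> norm u"
proof -
  assume E: "proj_op E"
  have "norm (E u) * norm (E u) \<le> norm u * norm (E u)"
    using proj_op_hinner [OF E, of u] hinner_bound [of u "E u"] by (simp add: power2_eq_square)
  then show ?thesis
    by (cases "norm (E u) = 0") (auto simp: mult_le_cancel_right)
qed

lemma proj_op_compl:
  "proj_op E \<Longrightarrow> proj_op (id_blinfun - E)"
  by (simp add: proj_op_def selfadj_simps blinfun.bilinear_simps)

text \<open>As \<open>Z\<close> is self-adjoint, the adjoint of an operator \<open>X\<close>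
  commuting with \<open>Z\<close> commutes with it too. Both preserve the kernel, so
  \<open>X\<close> preserves the kernel and its complement and commutes with
  \<open>E\<close>.\<close>

lemma projection_onto_kernel:
  fixes Z :: "'h::quat_hilbert \<Rightarrow>\<^sub>L 'h"
  assumes Z: "selfadj Z"
  obtains E where "proj_op E" "\<And>u. Z (E u) = 0" "\<And>u. Z u = 0 \<Longrightarrow> E u = u" "bicomm Z E"
proof -
  have K: "subspace {u. Z u = 0}" "closed {u. Z u = 0}"
    using closed_subspace_equalizer [OF blinfun.bounded_linear_right bounded_linear_zero] by auto
  have "\<exists>m. Z m = 0 \<and> (\<forall>v. Z v = 0 \<longrightarrow> \<langle>u - m,v\<rangle> = 0)" for u
    using orthogonal_projection_exists [OF K, of u] by auto
  then obtain p where p: "\<And>u. Z (p u) = 0" "\<And>u v. Z v = 0 \<Longrightarrow> \<langle>u - p u,v\<rangle> = 0"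
    by metis
  have uniq: "p u = m" if "Z m = 0" "\<And>v. Z v = 0 \<Longrightarrow> \<langle>u - m,v\<rangle> = 0" for u m
  proof -
    have "Z (p u - m) = 0" by (simp add: blinfun.bilinear_simps p that)
    then have "\<langle>u - m,p u - m\<rangle> - \<langle>u - p u,p u - m\<rangle> = 0"
      using p(2) that(2) by simp
    then have "\<langle>p u - m,p u - m\<rangle> = 0"
      by (simp add: hinner_simps)
    then show ?thesis by (simp add: hinner_self)
  qed
  have "bounded_linear p"
  proof (rule bounded_linear_intro [of _ 1])
    show "p (x + y) = p x + p y" for x y
    proof (rule uniq)
      fix v assume "Z v = 0"
      then show "\<langle>x + y - (p x + p y),v\<rangle> = 0"
        using p(2) [of v x] p(2) [of v y] by (simp add: hinner_simps)
    qed (simp add: blinfun.bilinear_simps p)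
    show "p (r *\<^sub>R x) = r *\<^sub>R p x" for r x
    proof (rule uniq)
      fix v assume "Z v = 0"
      then have "r * \<langle>x - p x,v\<rangle> = 0"
        using p(2) [of v x] by simp
      then show "\<langle>r *\<^sub>R x - r *\<^sub>R p x,v\<rangle> = 0"
        by (simp add: hinner_simps algebra_simps)
    qed (simp add: blinfun.bilinear_simps p)
    show "norm (p x) \<le> norm x * 1" for x
    proof -
      have "(norm x)\<^sup>2 = (norm (x - p x))\<^sup>2 + (norm (p x))\<^sup>2"
        using norm_add_sq [of "x - p x" "p x"] p by simp
      then have "(norm (p x))\<^sup>2 \<le> (norm x)\<^sup>2" by simp
      then have "norm (p x) \<le> norm x"
        by (rule power2_le_imp_le) simp
      then show ?thesis by simp
    qed
  qed
  define E where "E = Blinfun p"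
  have E: "blinfun_apply E u = p u" for u
    using \<open>bounded_linear p\<close> by (simp add: E_def bounded_linear_Blinfun_apply)
  have "\<langle>p u,v\<rangle> = \<langle>p u,p v\<rangle>" for u v
    using p(2) [OF p(1) [of u], of v] by (simp add: hinner_simps hinner_commute)
  then have "\<langle>p u,v\<rangle> = \<langle>u,p v\<rangle>" for u v
    using hinner_commute [of u "p v"] hinner_commute [of "p u" "p v"] by simp
  moreover have pu: "Z u = 0 \<Longrightarrow> p u = u" for u
    by (rule uniq) auto
  ultimately have "proj_op E"
    using p by (simp add: proj_op_def selfadj_def E)
  moreover have "bicomm Z E"
    unfolding bicomm_def
  proof (intro allI impI)
    fix X assume X: "commutes X Z"
    then have X': "commutes (radj X) Z"
      using commutes_radj [OF X] Z by (simp add: selfadj_radj)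
    have "p (X u) = X (p u)" for u
    proof (rule uniq)
      show "Z (X (p u)) = 0"
        using commutesD [OF X, of "p u"] p by simp
      fix v assume "Z v = 0"
      then have "Z (radj X v) = 0"
        using commutesD [OF X', of v] by simp
      then show "\<langle>X u - X (p u),v\<rangle> = 0"
        using p(2) [of "radj X v" u] by (simp add: radj' blinfun.bilinear_simps)
    qed
    then show "commutes X E"
      by (simp add: commutes_def E)
  qed
  ultimately show ?thesis
    using that [of E] p pu by (simp add: E)
qed

text \<open>The projection onto the kernel of \<open>S - |S|\<close>.\<close>

theorem spectral_projection_exists:
  fixes S :: "'h::quat_hilbert \<Rightarrow>\<^sub>L 'h"
  assumes S: "selfadj S"
  shows "\<exists>E. proj_op E \<and> bicomm S E \<and> (\<forall>u. 0 \<le> \<langle>E u,S (E u)\<rangle>) \<and>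
    (\<forall>u. \<langle>u - E u,S (u - E u)\<rangle> \<le> 0)"
proof -
  obtain R where R: "pos_op R" "R o\<^sub>L R = S o\<^sub>L S" "bicomm (S o\<^sub>L S) R"
    using pos_op_sqrt_exists pos_op_radj_compose [of S] S by (metis selfadj_radj)
  have "bicomm S R"
    using R(3) by (auto simp: bicomm_def intro: commutes_simps)
  then have SR: "S (R u) = R (S u)" for u
    by (simp add: bicomm_def commutes_def)
  have RR: "R (R u) = S (S u)" for u
    using arg_cong [OF R(2), of "\<lambda>B. blinfun_apply B u"] by simp
  define Z where "Z = S - R"
  have "selfadj Z"
    using S R by (simp add: Z_def selfadj_simps pos_op_def)
  then obtain E where E: "proj_op E" "\<And>u. Z (E u) = 0" "\<And>u. Z u = 0 \<Longrightarrow> E u = u" "bicomm Z E"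
    using projection_onto_kernel by blast
  have "commutes X S \<Longrightarrow> commutes X E" for X
    using E(4) \<open>bicomm S R\<close> by (auto simp: bicomm_def Z_def intro: commutes_simps)
  then have "bicomm S E"
    by (simp add: bicomm_def)
  moreover have "0 \<le> \<langle>E u,S (E u)\<rangle>" for u
  proof -
    have "S (E u) = R (E u)"
      using E(2) [of u] by (simp add: Z_def blinfun.bilinear_simps)
    then show ?thesis using R(1) by (simp add: pos_op_def)
  qed
  moreover have "\<langle>u - E u,S (u - E u)\<rangle> \<le> 0" for u
  proof -
    define v where "v = u - E u"
    \<comment> \<open>\<open>(S - R) (S + R) = S\<^sup>2 - R\<^sup>2 = 0\<close> puts
      \<open>S v + R v\<close> into the kernel of \<open>Z\<close>, where \<open>E\<close> is the
      identity; but \<open>E v = 0\<close>, and \<open>E\<close> commutes with \<open>S\<close> and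
      \<open>R\<close>.\<close>
    have "Z (S v + R v) = 0"
      by (simp add: Z_def blinfun.bilinear_simps SR RR)
    then have "E (S v + R v) = S v + R v"
      by (rule E(3))
    moreover have "E v = 0"
      using E(1) by (simp add: v_def blinfun.bilinear_simps proj_op_def)
    moreover have "commutes S E" "commutes R E"
      using \<open>bicomm S E\<close> SR by (simp_all add: bicomm_def commutes_def)
    ultimately have "S v + R v = 0"
      by (metis add.right_neutral blinfun.add_right blinfun.zero_right commutesD)
    then have "S v = - R v"
      by (simp add: eq_neg_iff_add_eq_0)
    then show ?thesis
      using R(1) by (simp add: pos_op_def hinner_simps flip: v_def)
  qed
  ultimately show ?thesis
    using E(1) by blast
qed

section \<open>Binary digits of a positive contraction\<close>

definition spec_proj :: "('h::quat_hilbert \<Rightarrow>\<^sub>L 'h) \<Rightarrow> 'h \<Rightarrow>\<^sub>L 'h"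
  where "spec_proj S = (SOME E. proj_op E \<and> bicomm S E \<and>
    (\<forall>u. 0 \<le> \<langle>blinfun_apply E u,S (E u)\<rangle>) \<and> (\<forall>u. \<langle>u - E u,S (u - E u)\<rangle> \<le> 0))"

lemma spec_proj:
  assumes "selfadj S"
  shows "proj_op (spec_proj S)" "bicomm S (spec_proj S)"
    "0 \<le> \<langle>spec_proj S u,S (spec_proj S u)\<rangle>"
    "\<langle>u - spec_proj S u,S (u - spec_proj S u)\<rangle> \<le> 0"
  using someI_ex [OF spectral_projection_exists [OF assms]] unfolding spec_proj_def by blast+

text \<open>The operator version of the map that sends a number in [0,1] with first binary digit d
  from x to 2x - d. The spectral projection separating values above 1/2 from those below plays the
  part of d.\<close>

primrec digit_rest :: "('h::quat_hilbert \<Rightarrow>\<^sub>L 'h) \<Rightarrow> nat \<Rightarrow> 'h \<Rightarrow>\<^sub>L 'h" where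
  "digit_rest A 0 = A"
| "digit_rest A (Suc n) =
    2 *\<^sub>R digit_rest A n - spec_proj (digit_rest A n - (1/2) *\<^sub>R id_blinfun)"

definition digit :: "('h::quat_hilbert \<Rightarrow>\<^sub>L 'h) \<Rightarrow> nat \<Rightarrow> 'h \<Rightarrow>\<^sub>L 'h"
  where "digit A n = spec_proj (digit_rest A n - (1/2) *\<^sub>R id_blinfun)"

text \<open>On the range of \<open>E\<close> one has \<open>A \<ge> 1/2\<close> and
  \<open>2 A - E = 2 A - 1\<close>; on its complement \<open>A \<le> 1/2\<close> and
  \<open>2 A - E = 2 A\<close>. As \<open>E\<close> commutes with \<open>A\<close>, the two parts do
  not interact, and the result stays between 0 and 1.\<close>

lemma double_minus_spec_proj:
  assumes A: "pos_op A" "\<And>u. \<langle>u,A u\<rangle> \<le> (norm u)\<^sup>2"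
  defines "E \<equiv> spec_proj (A - (1/2) *\<^sub>R id_blinfun)"
  shows "pos_op (2 *\<^sub>R A - E)" "\<langle>u,(2 *\<^sub>R A - E) u\<rangle> \<le> (norm u)\<^sup>2" "proj_op E" "bicomm A E"
proof -
  define S where "S = A - (1/2) *\<^sub>R id_blinfun"
  have S: "selfadj S" using A by (simp add: S_def pos_op_def selfadj_simps)
  have E: "proj_op E" "bicomm S E" "0 \<le> \<langle>E u,S (E u)\<rangle>" "\<langle>u - E u,S (u - E u)\<rangle> \<le> 0" for u
    unfolding E_def S_def [symmetric] using spec_proj [OF S] by auto
  show "proj_op E" by fact
  show "bicomm A E"
    using E(2) by (auto simp: bicomm_def S_def intro!: commutes_simps)
  then have AE: "A (E u) = E (A u)" for u
    by (simp add: bicomm_def commutes_def)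
  have EE: "E (E u) = E u" and sE: "\<langle>E u,v\<rangle> = \<langle>u,E v\<rangle>" for u v
    using E(1) by (auto simp: proj_op_def selfadj_def)
  have key: "0 \<le> \<langle>u,(2 *\<^sub>R A - E) u\<rangle> \<and> \<langle>u,(2 *\<^sub>R A - E) u\<rangle> \<le> (norm u)\<^sup>2" for u
  proof -
    define v w where "v = E u" and "w = u - E u"
    have vw: "u = v + w" by (simp add: v_def w_def)
    have Ev: "E v = v" and Ew: "E w = 0"
      by (simp_all add: v_def w_def EE blinfun.bilinear_simps)
    have o: "\<langle>v,w\<rangle> = 0"
      by (metis Ev Ew hinner_zero(2) sE)
    have o1: "\<langle>v,A w\<rangle> = 0"
      by (metis AE Ev Ew blinfun.zero_right hinner_zero(2) sE)
    then have o2: "\<langle>w,A v\<rangle> = 0"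
      using A(1) by (metis hinner_commute pos_op_def selfadj_def)
    have n: "(norm u)\<^sup>2 = (norm v)\<^sup>2 + (norm w)\<^sup>2"
      by (simp add: vw norm_add_sq o)
    have q: "\<langle>u,(2 *\<^sub>R A - E) u\<rangle> = 2 * \<langle>v,A v\<rangle> + 2 * \<langle>w,A w\<rangle> - (norm v)\<^sup>2"
      unfolding vw by (simp add: blinfun.bilinear_simps hinner_simps o o1 o2 Ev Ew hinner_self hinner_commute)
    have "0 \<le> \<langle>v,S v\<rangle>" "\<langle>w,S w\<rangle> \<le> 0"
      using E(3) [of u] E(4) [of u] by (simp_all add: v_def w_def)
    then have "(norm v)\<^sup>2 / 2 \<le> \<langle>v,A v\<rangle>" "\<langle>w,A w\<rangle> \<le> (norm w)\<^sup>2 / 2"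
      by (simp_all add: S_def blinfun.bilinear_simps hinner_simps hinner_self)
    moreover have "\<langle>v,A v\<rangle> \<le> (norm v)\<^sup>2" "0 \<le> \<langle>w,A w\<rangle>"
      using A by (auto simp: pos_op_def)
    ultimately show ?thesis
      unfolding q n by linarith
  qed
  then show "pos_op (2 *\<^sub>R A - E)" "\<langle>u,(2 *\<^sub>R A - E) u\<rangle> \<le> (norm u)\<^sup>2"
    using A E(1) by (auto simp: pos_op_def proj_op_def intro!: selfadj_simps)
qed

lemma digit_rest_props:
  assumes "pos_op A" "\<And>u. \<langle>u,A u\<rangle> \<le> (norm u)\<^sup>2"
  shows "pos_op (digit_rest A n)" "\<langle>u,digit_rest A n u\<rangle> \<le> (norm u)\<^sup>2" "bicomm A (digit_rest A n)"
proof -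
  have "pos_op (digit_rest A n) \<and> (\<forall>u. \<langle>u,digit_rest A n u\<rangle> \<le> (norm u)\<^sup>2) \<and> bicomm A (digit_rest A n)"
  proof (induction n)
    case 0
    then show ?case using assms by (simp add: bicomm_def)
  next
    case (Suc n)
    then have *: "pos_op (digit_rest A n)" "\<And>u. \<langle>u,digit_rest A n u\<rangle> \<le> (norm u)\<^sup>2"
      by auto
    show ?case
      using double_minus_spec_proj [OF *] Suc by (auto simp: bicomm_def intro!: commutes_simps)
  qed
  then show "pos_op (digit_rest A n)" "\<langle>u,digit_rest A n u\<rangle> \<le> (norm u)\<^sup>2" "bicomm A (digit_rest A n)"
    by auto
qed

theorem digit_props:
  assumes A: "pos_op A" "\<And>u. \<langle>u,A u\<rangle> \<le> (norm u)\<^sup>2"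
  shows "proj_op (digit A n)" "bicomm A (digit A n)"
    "(\<lambda>n. (1/2) ^ Suc n *\<^sub>R digit A n) sums A"
proof -
  note D = digit_rest_props [OF A]
  show "proj_op (digit A n)" and "bicomm A (digit A n)"
    using double_minus_spec_proj(3,4) [OF D(1,2)] D(3) [of n]
    by (auto simp: digit_def bicomm_def)
  \<comment> \<open>The remainder after \<open>n\<close> digits is a rest, which is a contraction,
    times the n-th power of 1/2.\<close>
  have eq: "(\<Sum>k<n. (1/2) ^ Suc k *\<^sub>R digit A k) = A - (1/2) ^ n *\<^sub>R digit_rest A n" for n
  proof (induction n)
    case (Suc n)
    show ?case
      unfolding sum.lessThan_Suc Suc by (simp add: digit_def algebra_simps)
  qed simp
  have "(\<lambda>n. (1/2) ^ n *\<^sub>R digit_rest A n) \<longlonglongrightarrow> 0"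
  proof (rule Lim_null_comparison)
    show "\<forall>\<^sub>F n in sequentially. norm ((1/2) ^ n *\<^sub>R digit_rest A n) \<le> (1/2::real) ^ n"
      using pos_op_norm_le_1 [OF D(1,2)] by (intro always_eventually) (simp add: mult_left_le)
    show "(\<lambda>n. (1/2::real) ^ n) \<longlonglongrightarrow> 0"
      by (rule LIMSEQ_realpow_zero) auto
  qed
  then have "(\<lambda>n. A - (1/2) ^ n *\<^sub>R digit_rest A n) \<longlonglongrightarrow> A - 0"
    by (intro tendsto_diff tendsto_const)
  then show "(\<lambda>n. (1/2) ^ Suc n *\<^sub>R digit A n) sums A"
    unfolding sums_def eq by simp
qed

section \<open>The projection-valued measure of a sequence of commuting projections\<close>

text \<open>A common notion for the Cantor space, the half-slice and the plane; of the measure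
  \<open>M\<close> only \<open>space M\<close> and \<open>sets M\<close> enter.\<close>

definition pvm :: "'a measure \<Rightarrow> ('a set \<Rightarrow> 'h::quat_hilbert \<Rightarrow>\<^sub>L 'h) \<Rightarrow> bool"
  where "pvm M P \<longleftrightarrow> (\<forall>E\<in>sets M. proj_op (P E)) \<and> P (space M) = id_blinfun \<and>
    (\<forall>E\<in>sets M. \<forall>F\<in>sets M. P E o\<^sub>L P F = P (E \<inter> F)) \<and>
    (\<forall>E :: nat \<Rightarrow> 'a set. range E \<subseteq> sets M \<longrightarrow> disjoint_family E \<longrightarrow>
      (\<forall>u. (\<lambda>n. P (E n) u) sums P (\<Union>n. E n) u))"

lemma proj_op_sum:
  fixes f :: "'i \<Rightarrow> 'h::quat_hilbert \<Rightarrow>\<^sub>L 'h"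
  assumes "finite I" "\<And>i. i \<in> I \<Longrightarrow> proj_op (f i)"
    "\<And>i j u. i \<in> I \<Longrightarrow> j \<in> I \<Longrightarrow> i \<noteq> j \<Longrightarrow> f i (f j u) = 0"
  shows "proj_op (\<Sum>i\<in>I. f i)"
proof -
  have "(\<Sum>i\<in>I. f i) ((\<Sum>i\<in>I. f i) u) = (\<Sum>i\<in>I. f i) u" for u
  proof -
    have "(\<Sum>i\<in>I. f i) ((\<Sum>i\<in>I. f i) u) = (\<Sum>i\<in>I. \<Sum>j\<in>I. f i (f j u))"
      by (subst sum.swap) (simp add: blinfun.sum_left blinfun.sum_right)
    also have "\<dots> = (\<Sum>i\<in>I. \<Sum>j\<in>I. if j = i then f i u else 0)"
      using assms by (intro sum.cong refl) (auto simp: proj_op_def)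
    also have "\<dots> = (\<Sum>i\<in>I. f i) u"
      using assms(1) by (simp add: blinfun.sum_left)
    finally show ?thesis .
  qed
  then show ?thesis
    using assms(2) by (simp add: proj_op_def selfadj_sum)
qed

text \<open>At the vector \<open>R u\<close> the hypothesis reads \<open>(norm (Q (R u)))\<^sup>2 +
  (norm (R u))\<^sup>2 \<le> (norm (R u))\<^sup>2\<close>.\<close>

lemma proj_op_orthogonal:
  assumes "proj_op Q" "proj_op R" "\<And>u. \<langle>u,Q u\<rangle> + \<langle>u,R u\<rangle> \<le> (norm u)\<^sup>2"
  shows "Q (R u) = 0"
proof -
  have "\<langle>R u,R (R u)\<rangle> = (norm (R u))\<^sup>2"
    using assms(2) by (simp add: proj_op_def hinner_self)
  then have "(norm (Q (R u)))\<^sup>2 \<le> 0"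
    using assms(3) [of "R u"] by (simp add: proj_op_hinner [OF assms(1), symmetric])
  then show ?thesis by simp
qed

text \<open>The partial sums are Cauchy because \<open>\<Sum> \<parallel>Q\<^sub>i u\<parallel>\<^sup>2\<close> converges.\<close>

lemma proj_op_series:
  fixes Q :: "nat \<Rightarrow> 'h::quat_hilbert \<Rightarrow>\<^sub>L 'h"
  assumes Q: "\<And>i. proj_op (Q i)" "\<And>i j u. i \<noteq> j \<Longrightarrow> Q i (Q j u) = 0"
  obtains R where "proj_op R" "\<And>u. (\<lambda>i. Q i u) sums R u"
proof -
  have S: "proj_op (\<Sum>i\<in>I. Q i)" if "finite I" for I
    using proj_op_sum [OF that] Q by blast
  have nrm: "(norm (\<Sum>i\<in>I. Q i u))\<^sup>2 = (\<Sum>i\<in>I. \<langle>u,Q i u\<rangle>)" if "finite I" for I u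
    using proj_op_hinner [OF S [OF that], of u]
    by (simp add: blinfun.sum_left bounded_bilinear.sum_right [OF bounded_bilinear_hinner])
  have conv: "convergent (\<lambda>n. \<Sum>i<n. Q i u)" for u
  proof -
    have "summable (\<lambda>i. \<langle>u,Q i u\<rangle>)"
    proof (rule summableI_nonneg_bounded)
      show "0 \<le> \<langle>u,Q n u\<rangle>" for n
        using proj_op_hinner [OF Q(1)] by simp
      show "(\<Sum>i<n. \<langle>u,Q i u\<rangle>) \<le> (norm u)\<^sup>2" for n
        using nrm [of "{..<n}" u] power_mono [OF proj_op_norm_le [OF S, of "{..<n}" u], of 2]
        by (simp add: blinfun.sum_left)
    qed
    then have C: "Cauchy (\<lambda>n. \<Sum>i<n. \<langle>u,Q i u\<rangle>)"
      by (simp add: summable_iff_convergent Cauchy_convergent_iff)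
    have "Cauchy (\<lambda>n. \<Sum>i<n. Q i u)"
    proof (rule metric_CauchyI)
      fix e :: real assume "e > 0"
      then have "e\<^sup>2 > 0" by simp
      then obtain N where N: "\<And>m n. m \<ge> N \<Longrightarrow> n \<ge> N \<Longrightarrow>
          dist (\<Sum>i<m. \<langle>u,Q i u\<rangle>) (\<Sum>i<n. \<langle>u,Q i u\<rangle>) < e\<^sup>2"
        using C unfolding Cauchy_def by blast
      have *: "dist (\<Sum>i<m. Q i u) (\<Sum>i<n. Q i u) < e" if "m \<ge> N" "n \<ge> m" for m n
      proof -
        have d: "(\<Sum>i<n. f i) - (\<Sum>i<m. f i) = (\<Sum>i\<in>{m..<n}. f i)" for f :: "nat \<Rightarrow> 'b::ab_group_add"
          using that by (simp add: lessThan_atLeast0 sum_diff_nat_ivl)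
        have "(norm (\<Sum>i\<in>{m..<n}. Q i u))\<^sup>2 = (\<Sum>i<n. \<langle>u,Q i u\<rangle>) - (\<Sum>i<m. \<langle>u,Q i u\<rangle>)"
          unfolding d by (rule nrm) simp
        also have "\<dots> < e\<^sup>2"
          using N [of n m] that by (simp add: dist_real_def abs_less_iff)
        finally have "norm (\<Sum>i\<in>{m..<n}. Q i u) < e"
          using \<open>e > 0\<close> by (simp add: power2_less_imp_less)
        then show ?thesis
          by (subst dist_commute) (simp add: dist_norm d)
      qed
      then show "\<exists>M. \<forall>m\<ge>M. \<forall>n\<ge>M. dist (\<Sum>i<m. Q i u) (\<Sum>i<n. Q i u) < e"
        by (metis dist_commute nle_le)
    qed
    then show ?thesis by (simp add: Cauchy_convergent_iff)
  qed
  define r where "r u = (\<Sum>i. Q i u)" for u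
  have r: "(\<lambda>i. Q i u) sums r u" for u
    using conv [of u] by (simp add: r_def summable_iff_convergent [symmetric] summable_sums)
  then have rl: "(\<lambda>n. \<Sum>i<n. Q i u) \<longlonglongrightarrow> r u" for u
    by (simp add: sums_def)
  have "bounded_linear r"
  proof (rule bounded_linear_intro [of _ 1])
    show "r (x + y) = r x + r y" for x y
    proof (rule sums_unique2)
      show "(\<lambda>i. Q i (x + y)) sums (r x + r y)"
        using sums_add [OF r r, of x y] by (simp add: blinfun.bilinear_simps)
    qed (rule r)
    show "r (c *\<^sub>R x) = c *\<^sub>R r x" for c x
    proof (rule sums_unique2)
      show "(\<lambda>i. Q i (c *\<^sub>R x)) sums (c *\<^sub>R r x)"
        using sums_scaleR_right [OF r, of c x] by (simp add: blinfun.bilinear_simps)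
    qed (rule r)
    show "norm (r x) \<le> norm x * 1" for x
    proof (rule LIMSEQ_le_const2 [OF tendsto_norm [OF rl]])
      have "norm (\<Sum>i<n. Q i x) \<le> norm x * 1" for n
        using proj_op_norm_le [OF S, of "{..<n}" x] by (simp add: blinfun.sum_left)
      then show "\<exists>N. \<forall>n\<ge>N. norm (\<Sum>i<n. Q i x) \<le> norm x * 1" by blast
    qed
  qed
  define R where "R = Blinfun r"
  have R: "blinfun_apply R u = r u" for u
    using \<open>bounded_linear r\<close> by (simp add: R_def bounded_linear_Blinfun_apply)
  have "\<langle>r u,v\<rangle> = \<langle>u,r v\<rangle>" for u v
  proof -
    have "(\<lambda>n. \<langle>\<Sum>i<n. Q i u,v\<rangle>) \<longlonglongrightarrow> \<langle>r u,v\<rangle>" "(\<lambda>n. \<langle>u,\<Sum>i<n. Q i v\<rangle>) \<longlonglongrightarrow> \<langle>u,r v\<rangle>"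
      by (intro tendsto_intros rl)+
    moreover have "\<langle>\<Sum>i<n. Q i u,v\<rangle> = \<langle>u,\<Sum>i<n. Q i v\<rangle>" for n
      using S [of "{..<n}"] by (simp add: proj_op_def selfadj_def blinfun.sum_left)
    ultimately show ?thesis
      using LIMSEQ_unique by auto
  qed
  moreover have "r (r u) = r u" for u
  proof -
    have "Q i (r u) = Q i u" for i
    proof -
      have "(\<lambda>j. Q i (Q j u)) sums Q i (r u)"
        using bounded_linear.sums [OF blinfun.bounded_linear_right r] .
      moreover have "(\<lambda>j. Q i (Q j u)) = (\<lambda>j. if j = i then Q i u else 0)"
        using Q by (auto simp: proj_op_def)
      ultimately show ?thesis
        using sums_single [of i "\<lambda>_. Q i u"] by (metis (no_types, lifting) sums_unique2)
    qed
    then show ?thesis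
      using r [of "r u"] r [of u] sums_unique2 by auto
  qed
  ultimately have "proj_op R"
    by (simp add: proj_op_def selfadj_def R)
  then show ?thesis
    using that r by (simp add: R)
qed

section \<open>Clopen cylinder sets of the Cantor space\<close>

definition depends_below :: "nat \<Rightarrow> (nat \<Rightarrow> bool) set \<Rightarrow> bool"
  where "depends_below n X \<longleftrightarrow> (\<forall>x y. (\<forall>i<n. x i = y i) \<longrightarrow> (x \<in> X \<longleftrightarrow> y \<in> X))"

definition cylinders :: "(nat \<Rightarrow> bool) set set"
  where "cylinders = {X. \<exists>n. depends_below n X}"

lemma depends_below_mono: "depends_below n X \<Longrightarrow> n \<le> m \<Longrightarrow> depends_below m X"
proof -
  assume X: "depends_below n X" "n \<le> m"
  show "depends_below m X"
    unfolding depends_below_def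
  proof (intro allI impI)
    fix x y :: "nat \<Rightarrow> bool" assume "\<forall>i<m. x i = y i"
    then have "\<forall>i<n. x i = y i" using X(2) by simp
    then show "x \<in> X \<longleftrightarrow> y \<in> X" using X(1) unfolding depends_below_def by blast
  qed
qed

lemma depends_below_ops:
  "depends_below n X \<Longrightarrow> depends_below n Y \<Longrightarrow> depends_below n (X \<union> Y)"
  "depends_below n X \<Longrightarrow> depends_below n Y \<Longrightarrow> depends_below n (X \<inter> Y)"
  "depends_below n X \<Longrightarrow> depends_below n Y \<Longrightarrow> depends_below n (X - Y)"
  "depends_below n {}" "depends_below n UNIV"
  unfolding depends_below_def by blast+

lemma cylinders_common:
  assumes "X \<in> cylinders" "Y \<in> cylinders"
  obtains n where "depends_below n X" "depends_below n Y"
proof -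
  obtain m n where "depends_below m X" "depends_below n Y"
    using assms by (auto simp: cylinders_def)
  then have "depends_below (max m n) X" "depends_below (max m n) Y"
    by (auto intro: depends_below_mono)
  then show ?thesis using that by blast
qed

lemma cylinders_closed:
  "X \<in> cylinders \<Longrightarrow> Y \<in> cylinders \<Longrightarrow> X \<union> Y \<in> cylinders"
  "X \<in> cylinders \<Longrightarrow> Y \<in> cylinders \<Longrightarrow> X \<inter> Y \<in> cylinders"
  "X \<in> cylinders \<Longrightarrow> Y \<in> cylinders \<Longrightarrow> X - Y \<in> cylinders"
  "{} \<in> cylinders" "UNIV \<in> cylinders"
  using depends_below_ops
  by (metis (mono_tags, lifting) cylinders_common cylinders_def mem_Collect_eq)+

lemma ring_of_sets_cylinders: "ring_of_sets UNIV cylinders"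
  by (rule ring_of_setsI) (auto intro: cylinders_closed)

lemma Int_stable_cylinders: "Int_stable cylinders"
  by (simp add: Int_stable_def cylinders_closed)

lemma subset_Pow_UNIV: "A \<subseteq> Pow UNIV"
  by simp

lemma open_cylinder:
  assumes "X \<in> cylinders"
  shows "open X"
proof -
  obtain n where n: "depends_below n X"
    using assms by (auto simp: cylinders_def)
  have "X = (\<Union>x\<in>X. \<Inter>i\<in>{..<n}. {y. y i = x i})"
  proof (intro equalityI subsetI)
    fix y assume "y \<in> (\<Union>x\<in>X. \<Inter>i\<in>{..<n}. {y. y i = x i})"
    then obtain x where "x \<in> X" "\<forall>i<n. y i = x i" by auto
    then show "y \<in> X" using n unfolding depends_below_def by blast
  qed auto
  moreover have "open {y :: nat \<Rightarrow> bool. y i = b}" for i b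
  proof -
    have "open ((\<lambda>y :: nat \<Rightarrow> bool. y i) -` {b})"
      by (intro open_vimage open_discrete) (auto intro: continuous_on_product_coordinates)
    then show ?thesis by (simp add: vimage_def)
  qed
  then have "open (\<Union>x\<in>X. \<Inter>i\<in>{..<n}. {y. y i = x i})"
    by (intro open_UN ballI open_INT) auto
  ultimately show ?thesis by simp
qed

lemma closed_cylinder: "X \<in> cylinders \<Longrightarrow> closed X"
  unfolding closed_def using open_cylinder cylinders_closed by (metis Compl_eq_Diff_UNIV)

lemma compact_cantor: "compact (UNIV :: (nat \<Rightarrow> bool) set)"
proof -
  have "compact_space (product_topology (\<lambda>i :: nat. euclidean :: bool topology) UNIV)"
    unfolding compact_space_product_topology
    using finite_imp_compact [of "UNIV :: bool set"] by (simp add: compact_space_def)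
  then show ?thesis
    by (simp add: euclidean_product_topology compact_space_def)
qed

text \<open>Decreasing nonempty closed sets in a compact space have a common point. This is the
  continuity at the empty set on which the extension of the measure rests.\<close>

lemma cylinders_decseq_empty:
  assumes A: "range A \<subseteq> cylinders" "decseq A" "(\<Inter>i. A i) = {}"
  shows "\<exists>n. A n = {}"
proof (rule ccontr)
  assume *: "\<nexists>n. A n = {}"
  have "UNIV \<inter> (\<Inter>i\<in>UNIV. A i) \<noteq> {}"
  proof (rule compact_imp_fip_image [OF compact_cantor])
    show "closed (A i)" for i
      using A by (intro closed_cylinder) auto
    fix I :: "nat set" assume I: "finite I"
    \<comment> \<open>The index 0 is inserted because \<open>I\<close> may be empty.\<close>
    have "A (Max (insert 0 I)) \<subseteq> A i" if i: "i \<in> I" for i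
    proof (rule decseqD [OF A(2)])
      show "i \<le> Max (insert 0 I)"
        using I i by (intro Max_ge) auto
    qed
    then have "A (Max (insert 0 I)) \<subseteq> (\<Inter>i\<in>I. A i)" by blast
    then show "UNIV \<inter> (\<Inter>i\<in>I. A i) \<noteq> {}"
      using * by blast
  qed
  then show False using A(3) by simp
qed

text \<open>A word of length \<open>n\<close> is encoded by the set \<open>w\<close> of the
  positions of its ones; the product projects onto the vectors whose first \<open>n\<close> digits
  spell that word.\<close>

primrec word_proj :: "(nat \<Rightarrow> 'h::quat_hilbert \<Rightarrow>\<^sub>L 'h) \<Rightarrow> nat \<Rightarrow> nat set \<Rightarrow> 'h \<Rightarrow>\<^sub>L 'h" where
  "word_proj E 0 w = id_blinfun"
| "word_proj E (Suc n) w = (if n \<in> w then E n else id_blinfun - E n) o\<^sub>L word_proj E n w"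

text \<open>Each word is tested through its extension by \<open>False\<close> from position
  \<open>n\<close> on. This is faithful when \<open>depends_below n X\<close>, and then the value
  does not change with larger \<open>n\<close> (\<open>cyl_op_mono\<close>).\<close>

definition cyl_op ::
    "(nat \<Rightarrow> 'h::quat_hilbert \<Rightarrow>\<^sub>L 'h) \<Rightarrow> nat \<Rightarrow> (nat \<Rightarrow> bool) set \<Rightarrow> 'h \<Rightarrow>\<^sub>L 'h"
  where "cyl_op E n X = (\<Sum>w\<in>{w \<in> Pow {..<n}. (\<lambda>i. i \<in> w) \<in> X}. word_proj E n w)"

section \<open>From finite words to a countably additive extension\<close>

locale commuting_projections =
  fixes E :: "nat \<Rightarrow> 'h::quat_hilbert \<Rightarrow>\<^sub>L 'h"
  assumes proj: "\<And>n. proj_op (E n)"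
    and comm: "\<And>m n. commutes (E m) (E n)"
begin

lemma word_proj_commutes:
  assumes "\<And>n. commutes Z (E n)"
  shows "commutes Z (word_proj E n w)"
  by (induction n) (auto intro!: commutes_simps assms)

lemma word_proj_proj_op: "proj_op (word_proj E n w)"
proof (induction n)
  case 0
  then show ?case by (simp add: proj_op_def selfadj_simps)
next
  case (Suc n)
  define F where "F = (if n \<in> w then E n else id_blinfun - E n)"
  have F: "proj_op F"
    using proj proj_op_compl by (auto simp: F_def)
  have "commutes (word_proj E n w) (E n)"
    by (rule commutes_sym, rule word_proj_commutes, rule comm)
  then have c: "commutes F (word_proj E n w)"
    by (intro commutes_sym [of _ F]) (auto simp: F_def intro!: commutes_simps)
  have "selfadj (F o\<^sub>L word_proj E n w)"
    using F Suc c by (auto simp: proj_op_def intro: selfadj_simps)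
  moreover have "F (word_proj E n w (F (word_proj E n w u))) = F (word_proj E n w u)" for u
    using F Suc by (simp add: commutesD [OF c, symmetric] proj_op_def)
  ultimately show ?case
    by (simp add: proj_op_def F_def [symmetric])
qed

lemma word_proj_cong:
  assumes "\<And>i. i < n \<Longrightarrow> i \<in> w \<longleftrightarrow> i \<in> w'"
  shows "word_proj E n w = word_proj E n w'"
  using assms by (induction n) auto

text \<open>The factors commute, so those at a position where the words differ can be brought
  together; there \<open>E i\<close> meets its complement.\<close>

lemma word_proj_orthogonal:
  assumes "i < n" "(i \<in> w) \<noteq> (i \<in> w')"
  shows "word_proj E n w (word_proj E n w' u) = 0"
  using assms(1)
proof (induction n arbitrary: u)
  case (Suc n)
  define F G where "F = (if n \<in> w then E n else id_blinfun - E n)"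
    and "G = (if n \<in> w' then E n else id_blinfun - E n)"
  have "commutes (word_proj E n w) (E n)"
    by (rule commutes_sym, rule word_proj_commutes, rule comm)
  then have c: "commutes (word_proj E n w) F" "commutes (word_proj E n w) G"
    by (auto simp: F_def G_def intro!: commutes_simps)
  have eq: "word_proj E (Suc n) w (word_proj E (Suc n) w' u)
      = F (G (word_proj E n w (word_proj E n w' u)))"
    by (simp add: F_def [symmetric] G_def [symmetric] commutesD [OF c(2)])
  show ?case
  proof (cases "i = n")
    case True
    then have "F (G v) = 0" for v
      using assms(2) proj [of n] by (auto simp: F_def G_def blinfun.bilinear_simps proj_op_def)
    then show ?thesis by (subst eq) simp
  next
    case False
    then show ?thesis using Suc by (subst eq) simp
  qed
qed simp

text \<open>A word of length \<open>n\<close> has two extensions, and the projections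
  \<open>E n\<close> and \<open>id_blinfun - E n\<close> in front of them add up to the identity. As
  \<open>X\<close> does not look at coordinate \<open>n\<close>, it contains both extensions or
  neither.\<close>

lemma cyl_op_Suc:
  assumes "depends_below n X"
  shows "cyl_op E (Suc n) X = cyl_op E n X"
proof -
  let ?S = "\<lambda>n. {w \<in> Pow {..<n}. (\<lambda>i. i \<in> w) \<in> X}"
  have mem: "(\<lambda>i. i \<in> insert n w) \<in> X \<longleftrightarrow> (\<lambda>i. i \<in> w) \<in> X" for w
    using assms [unfolded depends_below_def, rule_format, of "\<lambda>i. i \<in> insert n w" "\<lambda>i. i \<in> w"] by auto
  have S: "?S (Suc n) = ?S n \<union> insert n ` ?S n"
  proof (intro equalityI subsetI)
    fix w assume w: "w \<in> ?S (Suc n)"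
    show "w \<in> ?S n \<union> insert n ` ?S n"
    proof (cases "n \<in> w")
      case True
      then have "w = insert n (w - {n})" by blast
      moreover from this have "w - {n} \<in> ?S n"
        using w mem [of "w - {n}"] by (auto simp: lessThan_Suc)
      ultimately show ?thesis by blast
    next
      case False
      then show ?thesis using w by (auto simp: lessThan_Suc)
    qed
  qed (use mem in \<open>auto simp: lessThan_Suc\<close>)
  have inj: "inj_on (insert n) (?S n)"
  proof (rule inj_onI)
    fix v w assume "v \<in> ?S n" "w \<in> ?S n" "insert n v = insert n w"
    then show "v = w" by (metis (no_types, lifting) Diff_insert_absorb PowD lessThan_iff mem_Collect_eq
        nat_less_le subset_iff)
  qed
  have fin: "finite (?S n)" by (rule finite_subset [of _ "Pow {..<n}"]) auto
  have "cyl_op E (Suc n) X = (\<Sum>w\<in>?S n. word_proj E (Suc n) w) + (\<Sum>w\<in>insert n ` ?S n. word_proj E (Suc n) w)"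
    unfolding cyl_op_def S by (rule sum.union_disjoint) (use fin in auto)
  also have "(\<Sum>w\<in>insert n ` ?S n. word_proj E (Suc n) w) = (\<Sum>w\<in>?S n. word_proj E (Suc n) (insert n w))"
    by (simp only: sum.reindex [OF inj] o_def)
  also have "(\<Sum>w\<in>?S n. word_proj E (Suc n) w) + \<dots> =
      (\<Sum>w\<in>?S n. word_proj E (Suc n) w + word_proj E (Suc n) (insert n w))"
    by (simp add: sum.distrib)
  also have "\<dots> = (\<Sum>w\<in>?S n. word_proj E n w)"
  proof (rule sum.cong [OF refl])
    fix w assume "w \<in> ?S n"
    then have "n \<notin> w" by auto
    moreover have "word_proj E n (insert n w) = word_proj E n w"
      by (rule word_proj_cong) auto
    ultimately show "word_proj E (Suc n) w + word_proj E (Suc n) (insert n w) = word_proj E n w"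
      by (intro blinfun_eqI) (simp add: blinfun.bilinear_simps)
  qed
  finally show ?thesis by (simp add: cyl_op_def)
qed

lemma cyl_op_mono:
  assumes "depends_below n X" "n \<le> m"
  shows "cyl_op E m X = cyl_op E n X"
  using assms(2)
proof (induction m rule: dec_induct)
  case (step m)
  then show ?case
    using cyl_op_Suc depends_below_mono [OF assms(1)] by simp
qed simp

lemma cyl_op_UNIV: "cyl_op E n UNIV = id_blinfun"
proof -
  have "cyl_op E n UNIV = cyl_op E 0 UNIV"
    by (rule cyl_op_mono) (auto simp: depends_below_def)
  also have "\<dots> = id_blinfun"
    by (simp add: cyl_op_def)
  finally show ?thesis .
qed

lemma cyl_op_union:
  assumes "X \<inter> Y = {}"
  shows "cyl_op E n (X \<union> Y) = cyl_op E n X + cyl_op E n Y"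
proof -
  have "{w \<in> Pow {..<n}. (\<lambda>i. i \<in> w) \<in> X \<union> Y} =
      {w \<in> Pow {..<n}. (\<lambda>i. i \<in> w) \<in> X} \<union> {w \<in> Pow {..<n}. (\<lambda>i. i \<in> w) \<in> Y}"
    by auto
  moreover have "finite {w \<in> Pow {..<n}. (\<lambda>i. i \<in> w) \<in> Z}" for Z
    by (rule finite_subset [of _ "Pow {..<n}"]) auto
  ultimately show ?thesis
    unfolding cyl_op_def using assms by (simp only:) (rule sum.union_disjoint; auto)
qed

lemma cyl_op_proj_op: "proj_op (cyl_op E n X)"
  unfolding cyl_op_def
proof (rule proj_op_sum)
  show "finite {w \<in> Pow {..<n}. (\<lambda>i. i \<in> w) \<in> X}"
    by (rule finite_subset [of _ "Pow {..<n}"]) auto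
  show "proj_op (word_proj E n w)" for w
    by (rule word_proj_proj_op)
  fix v w u assume "v \<in> {w \<in> Pow {..<n}. (\<lambda>i. i \<in> w) \<in> X}" "w \<in> {w \<in> Pow {..<n}. (\<lambda>i. i \<in> w) \<in> X}" "v \<noteq> w"
  then have "v \<subseteq> {..<n}" "w \<subseteq> {..<n}" "v \<noteq> w" by auto
  then obtain i where "i < n" "(i \<in> v) \<noteq> (i \<in> w)" by blast
  then show "word_proj E n v (word_proj E n w u) = 0"
    by (rule word_proj_orthogonal)
qed

lemma cyl_op_commutes: "(\<And>n. commutes Z (E n)) \<Longrightarrow> commutes Z (cyl_op E n X)"
  unfolding cyl_op_def by (intro commutes_sum word_proj_commutes)

lemma cyl_op_digit: "cyl_op E (Suc n) {x. x n} = E n"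
proof -
  have "{w \<in> Pow {..<Suc n}. (\<lambda>i. i \<in> w) \<in> {x. x n}} = insert n ` Pow {..<n}"
  proof (intro equalityI subsetI)
    fix w assume "w \<in> {w \<in> Pow {..<Suc n}. (\<lambda>i. i \<in> w) \<in> {x. x n}}"
    then have "w = insert n (w - {n})" "w - {n} \<in> Pow {..<n}"
      by (auto simp: lessThan_Suc)
    then show "w \<in> insert n ` Pow {..<n}" by blast
  qed (auto simp: lessThan_Suc)
  moreover have inj: "inj_on (insert n) (Pow {..<n})"
  proof (rule inj_onI)
    fix v w assume "v \<in> Pow {..<n}" "w \<in> Pow {..<n}" "insert n v = insert n w"
    then show "v = w" by (metis Diff_insert_absorb PowD lessThan_iff nat_less_le subset_iff)
  qed
  ultimately have "cyl_op E (Suc n) {x. x n} = (\<Sum>w\<in>Pow {..<n}. word_proj E (Suc n) (insert n w))"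
    by (simp only: cyl_op_def sum.reindex [OF inj] o_def)
  also have "\<dots> = (\<Sum>w\<in>Pow {..<n}. E n o\<^sub>L word_proj E n w)"
  proof (rule sum.cong [OF refl])
    fix w
    have "word_proj E n (insert n w) = word_proj E n w"
      by (rule word_proj_cong) auto
    then show "word_proj E (Suc n) (insert n w) = E n o\<^sub>L word_proj E n w" by simp
  qed
  also have "\<dots> = E n o\<^sub>L (\<Sum>w\<in>Pow {..<n}. word_proj E n w)"
    by (simp add: bounded_bilinear.sum_right [OF bounded_bilinear_blinfun_compose])
  also have "(\<Sum>w\<in>Pow {..<n}. word_proj E n w) = id_blinfun"
  proof -
    have "{w \<in> Pow {..<n}. (\<lambda>i. i \<in> w) \<in> UNIV} = Pow {..<n}" by blast
    then show ?thesis
      using cyl_op_UNIV [of n] unfolding cyl_op_def by (simp only:)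
  qed
  finally show ?thesis
    by (intro blinfun_eqI) simp
qed

text \<open>Caratheodory's theorem in the form for finite additive functions that are continuous at
  the empty set. By compactness a decreasing sequence of cylinders with empty intersection is even
  empty from some index on.\<close>

lemma cylinder_measure:
  "\<exists>N. space N = UNIV \<and> sets N = sigma_sets UNIV cylinders \<and>
    (\<forall>n X. depends_below n X \<longrightarrow> emeasure N X = ennreal \<langle>u,cyl_op E n X u\<rangle>)"
proof -
  interpret ring_of_sets UNIV cylinders by (rule ring_of_sets_cylinders)
  \<comment> \<open>Every length below which \<open>X\<close> depends gives the same value by
    \<open>cyl_op_mono\<close>; the least one merely fixes a choice.\<close>
  define f where "f X = ennreal \<langle>u,cyl_op E (LEAST n. depends_below n X) X u\<rangle>" for X
  have f: "f X = ennreal \<langle>u,cyl_op E n X u\<rangle>" if "depends_below n X" for n X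
    unfolding f_def using cyl_op_mono [OF LeastI [of "\<lambda>n. depends_below n X", OF that] Least_le [of "\<lambda>n. depends_below n X", OF that]] by simp
  have nn: "0 \<le> \<langle>u,cyl_op E n X u\<rangle>" for n X
    using proj_op_hinner [OF cyl_op_proj_op] by simp
  have f0: "f {} = 0"
    using f [of 0 "{}"] by (simp add: depends_below_ops cyl_op_def)
  have "\<exists>\<mu>. (\<forall>X\<in>cylinders. \<mu> X = f X) \<and> measure_space UNIV (sigma_sets UNIV cylinders) \<mu>"
  proof (rule caratheodory_empty_continuous)
    show "positive cylinders f"
      by (simp add: positive_def f0)
    show "additive cylinders f"
      unfolding additive_def
    proof (intro ballI impI)
      fix X Y assume XY: "X \<in> cylinders" "Y \<in> cylinders" "X \<inter> Y = {}"
      then obtain n where n: "depends_below n X" "depends_below n Y"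
        using cylinders_common by blast
      show "f (X \<union> Y) = f X + f Y"
        unfolding f [OF n(1)] f [OF n(2)] f [OF depends_below_ops(1) [OF n]]
        using XY(3) nn
        by (simp add: cyl_op_union blinfun.bilinear_simps hinner_simps ennreal_plus)
    qed
    show "f X \<noteq> \<infinity>" for X
      by (simp add: f_def)
    fix A :: "nat \<Rightarrow> (nat \<Rightarrow> bool) set"
    assume A: "range A \<subseteq> cylinders" "decseq A" "(\<Inter>i. A i) = {}"
    then obtain n where n: "A n = {}"
      using cylinders_decseq_empty by blast
    have "f (A m) = 0" if "m \<ge> n" for m
      using decseqD [OF A(2) that] n f0 by simp
    then show "(\<lambda>i. f (A i)) \<longlonglongrightarrow> 0"
      by (intro tendsto_eventually) (auto simp: eventually_sequentially)
  qed
  then obtain \<mu> where \<mu>: "\<And>X. X \<in> cylinders \<Longrightarrow> \<mu> X = f X"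
    "measure_space UNIV (sigma_sets UNIV cylinders) \<mu>" by blast
  define N where "N = measure_of UNIV (sigma_sets UNIV cylinders) \<mu>"
  have sa: "sigma_algebra UNIV (sigma_sets UNIV cylinders)"
    by (rule sigma_algebra_sigma_sets) simp
  have "space N = UNIV" by (simp add: N_def)
  moreover have sN: "sets N = sigma_sets UNIV cylinders"
    unfolding N_def using sigma_algebra.sigma_sets_eq [OF sa] by (subst sets_measure_of) auto
  moreover have *: "emeasure N X = \<mu> X" if "X \<in> sigma_sets UNIV cylinders" for X
    using that \<mu>(2) sN unfolding measure_space_def
    by (intro emeasure_measure_of [OF N_def]) auto
  then have "emeasure N X = ennreal \<langle>u,cyl_op E n X u\<rangle>" if "depends_below n X" for n X
  proof -
    have "X \<in> cylinders" using that by (auto simp: cylinders_def)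
    then show ?thesis using \<mu>(1) [of X] f [OF that] * [of X] by (simp add: sigma_sets.Basic)
  qed
  ultimately show ?thesis by blast
qed

text \<open>The scalar measures \<open>N u\<close> are constructed separately for each
  \<open>u\<close>. That their values on a set are the quadratic form of one projection is known for
  cylinders and propagates by Dynkin induction; the limit in the case of disjoint unions is supplied
  by \<open>proj_op_series\<close>.\<close>

theorem pvm_exists:
  obtains Q where "pvm (sigma UNIV cylinders) Q" "\<And>n. Q {x. x n} = E n"
    "\<And>X Z. X \<in> sigma_sets UNIV cylinders \<Longrightarrow> (\<And>n. commutes Z (E n)) \<Longrightarrow> commutes Z (Q X)"
proof -
  define N where "N u = (SOME N. space N = UNIV \<and> sets N = sigma_sets UNIV cylinders \<and>
    (\<forall>n X. depends_below n X \<longrightarrow> emeasure N X = ennreal \<langle>u,cyl_op E n X u\<rangle>))" for u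
  from someI_ex [OF cylinder_measure] have "space (N u) = UNIV \<and> sets (N u) = sigma_sets UNIV cylinders \<and>
    (\<forall>n X. depends_below n X \<longrightarrow> emeasure (N u) X = ennreal \<langle>u,cyl_op E n X u\<rangle>)" for u
    unfolding N_def .
  then have N: "space (N u) = UNIV" "sets (N u) = sigma_sets UNIV cylinders"
    "\<And>n X. depends_below n X \<Longrightarrow> emeasure (N u) X = ennreal \<langle>u,cyl_op E n X u\<rangle>" for u
    by auto
  have Ncyl: "measure (N u) X = \<langle>u,cyl_op E n X u\<rangle>" if "depends_below n X" for u n X
    using N(3) [OF that] proj_op_hinner [OF cyl_op_proj_op] by (simp add: measure_def)
  have NU: "measure (N u) UNIV = (norm u)\<^sup>2" for u
    using Ncyl [of 0 UNIV u] by (simp add: depends_below_ops cyl_op_UNIV hinner_self)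
  have fin: "finite_measure (N u)" for u
    using N(3) [of 0 UNIV u] by (intro finite_measureI) (simp add: N depends_below_ops)
  interpret N: finite_measure "N u" for u by (rule fin)
  \<comment> \<open>The commutation clause is carried through the induction because it survives
    complements and series.\<close>
  define good where "good X Q \<longleftrightarrow> proj_op Q \<and> (\<forall>u. \<langle>u,Q u\<rangle> = measure (N u) X) \<and>
    (\<forall>Z. (\<forall>n. commutes Z (E n)) \<longrightarrow> commutes Z Q)" for X Q
  let ?\<Sigma> = "sigma_sets UNIV cylinders"
  have unique: "Q = R" if "good X Q" "good X R" for X Q R
    using that by (intro selfadj_eqI) (auto simp: good_def proj_op_def)
  \<comment> \<open>The two forms add up to at most the total mass \<open>(norm u)\<^sup>2\<close>
    of \<open>N u\<close>, so \<open>proj_op_orthogonal\<close> applies.\<close>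
  have orth: "Q (R u) = 0" if "good X Q" "good Y R" "X \<in> ?\<Sigma>" "Y \<in> ?\<Sigma>" "X \<inter> Y = {}" for X Y Q R u
  proof (rule proj_op_orthogonal)
    show "proj_op Q" "proj_op R" using that by (auto simp: good_def)
    fix u
    have "measure (N u) X + measure (N u) Y = measure (N u) (X \<union> Y)"
      using that by (intro N.finite_measure_Union [symmetric]) (auto simp: N)
    also have "\<dots> \<le> measure (N u) UNIV"
      using N.bounded_measure [of u "X \<union> Y"] by (simp add: N)
    finally show "\<langle>u,Q u\<rangle> + \<langle>u,R u\<rangle> \<le> (norm u)\<^sup>2"
      using that by (simp add: good_def NU)
  qed
  have union: "\<exists>R. good (\<Union>i. A i) R \<and> (\<forall>u. (\<lambda>i. Q i u) sums R u)"
    if A: "disjoint_family A" "range A \<subseteq> ?\<Sigma>" and Q: "\<And>i. good (A i) (Q i)"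
    for A :: "nat \<Rightarrow> _" and Q
  proof -
    have o: "Q i (Q j u) = 0" if "i \<noteq> j" for i j u
      using that A by (intro orth [OF Q Q]) (auto simp: disjoint_family_on_def)
    have p: "proj_op (Q i)" for i
      using Q [of i] by (simp add: good_def)
    obtain R where R: "proj_op R" "\<And>u. (\<lambda>i. Q i u) sums R u"
      using proj_op_series [of Q, OF p o] by blast
    have "\<langle>u,R u\<rangle> = measure (N u) (\<Union>i. A i)" for u
    proof -
      have "(\<lambda>i. \<langle>u,Q i u\<rangle>) sums \<langle>u,R u\<rangle>"
        by (rule bounded_linear.sums [OF bounded_bilinear.bounded_linear_right
              [OF bounded_bilinear_hinner] R(2)])
      moreover have "(\<lambda>i. measure (N u) (A i)) sums measure (N u) (\<Union>i. A i)"
        using A by (intro N.finite_measure_UNION) (auto simp: N)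
      ultimately show ?thesis
        using Q sums_unique2 by (auto simp: good_def)
    qed
    moreover have "commutes Z R" if Z: "\<forall>n. commutes Z (E n)" for Z
      unfolding commutes_def
    proof
      fix u
      have "(\<lambda>i. Z (Q i u)) sums Z (R u)"
        using bounded_linear.sums [OF blinfun.bounded_linear_right R(2)] .
      moreover have "Z (Q i u) = Q i (Z u)" for i
        using Q [of i] Z by (auto simp: good_def commutes_def)
      ultimately show "Z (R u) = R (Z u)"
        using R(2) [of "Z u"] sums_unique2 by auto
    qed
    ultimately show ?thesis using R by (auto simp: good_def)
  qed
  have ex: "\<exists>Q. good X Q" if "X \<in> ?\<Sigma>" for X
    using Int_stable_cylinders subset_Pow_UNIV that
  proof (induction rule: sigma_sets_induct_disjoint)
    show "\<exists>Q. good X Q" if X: "X \<in> cylinders" for X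
    proof -
      obtain n where "depends_below n X" using X by (auto simp: cylinders_def)
      then have "good X (cyl_op E n X)"
        using cyl_op_proj_op cyl_op_commutes Ncyl by (auto simp: good_def)
      then show ?thesis by blast
    qed
    then show "\<exists>Q. good {} Q" using cylinders_closed by blast
    show "\<exists>Q. good (UNIV - X) Q" if X: "X \<in> ?\<Sigma>" "\<exists>Q. good X Q" for X
    proof -
      obtain Q where Q: "good X Q" using X by blast
      have "measure (N u) (UNIV - X) = (norm u)\<^sup>2 - measure (N u) X" for u
        using N.finite_measure_compl [of X u] X by (simp add: N NU)
      then have "good (UNIV - X) (id_blinfun - Q)"
        using Q proj_op_compl
        by (auto simp: good_def blinfun.bilinear_simps hinner_simps hinner_self intro!: commutes_simps)
      then show ?thesis by blast
    qed
    show "\<exists>Q. good (\<Union>i. A i) Q"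
      if "disjoint_family A" "range A \<subseteq> ?\<Sigma>" "\<And>i. \<exists>Q. good (A i) Q" for A :: "nat \<Rightarrow> _"
      using union [OF that(1,2)] that(3) by metis
  qed
  define Q where "Q X = (SOME Q. good X Q)" for X
  have Q: "good X (Q X)" if "X \<in> ?\<Sigma>" for X
    unfolding Q_def using someI_ex [OF ex [OF that]] .
  have sa: "sigma_algebra UNIV ?\<Sigma>"
    by (rule sigma_algebra_sigma_sets) simp
  interpret sigma_algebra UNIV ?\<Sigma> by (rule sa)
  have add: "Q (X \<union> Y) = Q X + Q Y" if "X \<in> ?\<Sigma>" "Y \<in> ?\<Sigma>" "X \<inter> Y = {}" for X Y
  proof (rule selfadj_eqI)
    have XY: "X \<union> Y \<in> ?\<Sigma>" using that by blast
    show "selfadj (Q (X \<union> Y))" "selfadj (Q X + Q Y)"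
      using Q that XY by (auto simp: good_def proj_op_def intro!: selfadj_simps)
    show "\<langle>u,Q (X \<union> Y) u\<rangle> = \<langle>u,(Q X + Q Y) u\<rangle>" for u
      using Q that XY N.finite_measure_Union [of X u Y]
      by (simp add: good_def blinfun.bilinear_simps hinner_simps N)
  qed
  \<comment> \<open>Both sets are split along \<open>X \<inter> Y\<close>; the pieces are disjoint,
    so only the product of the common parts survives.\<close>
  have mult: "Q X o\<^sub>L Q Y = Q (X \<inter> Y)" if XY: "X \<in> ?\<Sigma>" "Y \<in> ?\<Sigma>" for X Y
  proof (rule blinfun_eqI)
    fix u
    have s: "X \<inter> Y \<in> ?\<Sigma>" "X - Y \<in> ?\<Sigma>" "Y - X \<in> ?\<Sigma>" using XY by auto
    have "(X \<inter> Y) \<union> (X - Y) = X" "(X \<inter> Y) \<union> (Y - X) = Y" by blast+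
    then have "Q X = Q (X \<inter> Y) + Q (X - Y)" "Q Y = Q (X \<inter> Y) + Q (Y - X)"
      using add [of "X \<inter> Y" "X - Y"] add [of "X \<inter> Y" "Y - X"] s by auto
    moreover have "Q (X \<inter> Y) (Q (Y - X) u) = 0" "Q (X - Y) (Q (X \<inter> Y) u) = 0"
      "Q (X - Y) (Q (Y - X) u) = 0"
      using s by (intro orth [OF Q Q]; auto)+
    moreover have "Q (X \<inter> Y) (Q (X \<inter> Y) u) = Q (X \<inter> Y) u"
      using Q [OF s(1)] by (simp add: good_def proj_op_def)
    ultimately show "(Q X o\<^sub>L Q Y) u = Q (X \<inter> Y) u"
      by (simp add: blinfun.bilinear_simps)
  qed
  have cyl: "Q X = cyl_op E n X" if "depends_below n X" for n X
  proof (rule unique)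
    show "good X (Q X)" using that by (intro Q sigma_sets.Basic) (auto simp: cylinders_def)
    show "good X (cyl_op E n X)"
      using cyl_op_proj_op cyl_op_commutes Ncyl [OF that] by (auto simp: good_def)
  qed
  have "pvm (sigma UNIV cylinders) Q"
    unfolding pvm_def
  proof (intro conjI ballI allI impI)
    show "proj_op (Q X)" if "X \<in> sets (sigma UNIV cylinders)" for X
      using Q that by (simp add: good_def)
    show "Q (space (sigma UNIV cylinders)) = id_blinfun"
      using cyl [of 0 UNIV] by (simp add: depends_below_ops cyl_op_UNIV)
    show "Q X o\<^sub>L Q Y = Q (X \<inter> Y)"
      if "X \<in> sets (sigma UNIV cylinders)" "Y \<in> sets (sigma UNIV cylinders)" for X Y
      using mult that by simp
    fix A :: "nat \<Rightarrow> (nat \<Rightarrow> bool) set" and u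
    assume A: "range A \<subseteq> sets (sigma UNIV cylinders)" "disjoint_family A"
    then have A': "range A \<subseteq> ?\<Sigma>" by simp
    have g: "good (A i) (Q (A i))" for i
      using A' by (intro Q) blast
    obtain R where R: "good (\<Union>i. A i) R" "\<And>u. (\<lambda>i. Q (A i) u) sums R u"
      using union [OF A(2) A', of "\<lambda>i. Q (A i)", OF g] by blast
    have "(\<Union>i. A i) \<in> ?\<Sigma>" using A' by blast
    then have "R = Q (\<Union>i. A i)" using unique [OF R(1) Q] by blast
    then show "(\<lambda>i. Q (A i) u) sums Q (\<Union>i. A i) u" using R(2) by simp
  qed
  moreover have "Q {x. x n} = E n" for n
    using cyl [of "Suc n" "{x. x n}"] cyl_op_digit by (simp add: depends_below_def)
  moreover have "commutes Z (Q X)" if "X \<in> ?\<Sigma>" "\<And>n. commutes Z (E n)" for X Z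
    using Q [OF that(1)] that(2) by (simp add: good_def)
  ultimately show ?thesis using that by blast
qed

end

section \<open>Scalar measures of a projection-valued measure\<close>

definition pvm_measure ::
    "'a measure \<Rightarrow> ('a set \<Rightarrow> 'h::quat_hilbert \<Rightarrow>\<^sub>L 'h) \<Rightarrow> 'h \<Rightarrow> 'a measure"
  where "pvm_measure M P u = measure_of (space M) (sets M) (\<lambda>E. ennreal \<langle>u,P E u\<rangle>)"

lemma space_pvm_measure [simp]: "space (pvm_measure M P u) = space M"
  by (simp add: pvm_measure_def sets.space_closed space_measure_of)

lemma sets_pvm_measure [simp, measurable_cong]: "sets (pvm_measure M P u) = sets M"
  by (simp add: pvm_measure_def)

lemma pvmD:
  assumes "pvm M P"
  shows "E \<in> sets M \<Longrightarrow> proj_op (P E)" "P (space M) = id_blinfun"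
    "E \<in> sets M \<Longrightarrow> F \<in> sets M \<Longrightarrow> P E (P F u) = P (E \<inter> F) u"
    "range A \<subseteq> sets M \<Longrightarrow> disjoint_family A \<Longrightarrow> (\<lambda>n. P (A n) u) sums P (\<Union>n. A n) u"
proof -
  show "E \<in> sets M \<Longrightarrow> F \<in> sets M \<Longrightarrow> P E (P F u) = P (E \<inter> F) u"
    using assms by (auto simp: pvm_def simp flip: blinfun_apply_blinfun_compose)
qed (use assms in \<open>auto simp: pvm_def\<close>)

text \<open>Countable additivity for the constantly empty family makes a constant series converge,
  so its term is 0.\<close>

lemma pvm_empty:
  assumes "pvm M P"
  shows "P {} = 0"
proof (rule blinfun_eqI)
  fix u
  have "(\<lambda>n :: nat. P {} u) sums P (\<Union>n :: nat. {}) u"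
    by (rule pvmD(4) [OF assms]) (auto simp: disjoint_family_on_def)
  then have "(\<lambda>n :: nat. P {} u) \<longlonglongrightarrow> 0"
    by (simp add: summable_LIMSEQ_zero sums_summable)
  then show "P {} u = blinfun_apply 0 u"
    by (simp add: LIMSEQ_const_iff)
qed

lemma pvm_hinner:
  assumes "pvm M P" "E \<in> sets M"
  shows "\<langle>u,P E u\<rangle> = (norm (P E u))\<^sup>2" "\<langle>P E u,v\<rangle> = \<langle>u,P E v\<rangle>" "P E (P E u) = P E u"
  using pvmD(1) [OF assms] proj_op_hinner by (auto simp: proj_op_def selfadj_def)

lemma emeasure_pvm_measure:
  assumes P: "pvm M P" and E: "E \<in> sets M"
  shows "emeasure (pvm_measure M P u) E = ennreal \<langle>u,P E u\<rangle>"
proof (rule emeasure_measure_of [OF pvm_measure_def])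
  have nn: "0 \<le> \<langle>u,P F u\<rangle>" if "F \<in> sets M" for F
    using pvm_hinner [OF P that] by simp
  show "positive (sets (pvm_measure M P u)) (\<lambda>E. ennreal \<langle>u,P E u\<rangle>)"
    by (simp add: positive_def pvm_empty [OF P])
  show "countably_additive (sets (pvm_measure M P u)) (\<lambda>E. ennreal \<langle>u,P E u\<rangle>)"
  proof (rule countably_additiveI)
    fix A :: "nat \<Rightarrow> 'a set"
    assume A: "range A \<subseteq> sets (pvm_measure M P u)" "disjoint_family A"
      "(\<Union>i. A i) \<in> sets (pvm_measure M P u)"
    have "(\<lambda>i. \<langle>u,P (A i) u\<rangle>) sums \<langle>u,P (\<Union>i. A i) u\<rangle>"
      using A by (intro bounded_linear.sums [OF bounded_bilinear.bounded_linear_right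
              [OF bounded_bilinear_hinner]] pvmD(4) [OF P]) auto
    then show "(\<Sum>i. ennreal \<langle>u,P (A i) u\<rangle>) = ennreal \<langle>u,P (\<Union>i. A i) u\<rangle>"
      using A nn by (subst suminf_ennreal2) (auto simp: sums_iff)
  qed
qed (use E sets.space_closed in auto)

lemma measure_pvm_measure:
  assumes "pvm M P" "E \<in> sets M"
  shows "measure (pvm_measure M P u) E = (norm (P E u))\<^sup>2"
  using emeasure_pvm_measure [OF assms, of u] pvm_hinner [OF assms] by (simp add: measure_def)

lemma finite_measure_pvm_measure:
  assumes "pvm M P"
  shows "finite_measure (pvm_measure M P u)"
  using emeasure_pvm_measure [OF assms, of "space M" u] by (intro finite_measureI) simp

lemma measure_pvm_space:
  assumes "pvm M P"
  shows "measure (pvm_measure M P u) (space M) = (norm u)\<^sup>2"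
  using measure_pvm_measure [OF assms, of "space M" u] pvmD(2) [OF assms] by simp

text \<open>The mass of a set is the squared norm of its projection of \<open>u\<close>, so
  almost-everywhere statements become equations for the vector \<open>u\<close>.\<close>

lemma AE_pvm_measure_iff:
  assumes P: "pvm M P" and E: "{x \<in> space M. \<not> Q x} \<in> sets M"
  shows "(AE x in pvm_measure M P u. Q x) \<longleftrightarrow> P {x \<in> space M. \<not> Q x} u = 0"
proof -
  have "(AE x in pvm_measure M P u. Q x) \<longleftrightarrow>
      emeasure (pvm_measure M P u) {x \<in> space M. \<not> Q x} = 0"
    using E by (subst AE_iff_measurable [OF _ refl]) auto
  also have "\<dots> \<longleftrightarrow> P {x \<in> space M. \<not> Q x} u = 0"
    using pvm_hinner(1) [OF P E, of u] by (simp add: emeasure_pvm_measure [OF P E])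
  finally show ?thesis .
qed

lemma pvm_union:
  assumes P: "pvm M P" and EF: "E \<in> sets M" "F \<in> sets M" "E \<inter> F = {}"
  shows "P (E \<union> F) = P E + P F"
proof (rule selfadj_eqI)
  show "selfadj (P (E \<union> F))" "selfadj (P E + P F)"
    using EF pvmD(1) [OF P] by (auto simp: proj_op_def intro!: selfadj_simps)
  interpret finite_measure "pvm_measure M P u" for u
    by (rule finite_measure_pvm_measure [OF P])
  show "\<langle>u,P (E \<union> F) u\<rangle> = \<langle>u,(P E + P F) u\<rangle>" for u
    using finite_measure_Union [of E u F] EF
    by (simp add: measure_pvm_measure [OF P] pvm_hinner(1) [OF P] blinfun.bilinear_simps hinner_simps)
qed

lemma pvm_compl:
  assumes P: "pvm M P" and E: "E \<in> sets M"
  shows "P (space M - E) = id_blinfun - P E"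
proof -
  have "P (E \<union> (space M - E)) = P E + P (space M - E)"
    using E by (intro pvm_union [OF P]) auto
  moreover have "E \<union> (space M - E) = space M"
    using sets.sets_into_space [OF E] by blast
  ultimately have "id_blinfun = P E + P (space M - E)"
    using pvmD(2) [OF P] by simp
  then show ?thesis
    by (metis add_diff_cancel_left')
qed

lemma pvm_finite_union:
  assumes P: "pvm M P" and I: "finite I" "\<And>i. i \<in> I \<Longrightarrow> E i \<in> sets M"
    "\<And>i j. i \<in> I \<Longrightarrow> j \<in> I \<Longrightarrow> i \<noteq> j \<Longrightarrow> E i \<inter> E j = {}"
  shows "P (\<Union>i\<in>I. E i) = (\<Sum>i\<in>I. P (E i))"
  using I
proof (induction I)
  case empty
  then show ?case by (simp add: pvm_empty [OF P])
next
  case (insert i I)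
  have "P (E i \<union> (\<Union>i\<in>I. E i)) = P (E i) + P (\<Union>i\<in>I. E i)"
    using insert by (intro pvm_union [OF P]) auto
  then show ?case using insert by simp
qed

lemma pvm_mono_eq_0:
  assumes P: "pvm M P" and "E \<in> sets M" "F \<in> sets M" "E \<subseteq> F" "P F u = 0"
  shows "P E u = 0"
  using pvmD(3) [OF P, of E F u] assms by (simp add: Int_absorb2)

lemma pvm_measure_restrict:
  assumes P: "pvm M P" and E: "E \<in> sets M"
  shows "AE x in pvm_measure M P (P E u). x \<in> E"
proof -
  have "{x \<in> space M. x \<notin> E} = space M - E" by blast
  moreover have "P (space M - E) (P E u) = 0"
    using pvm_compl [OF P E] pvm_hinner(3) [OF P E] by (simp add: blinfun.bilinear_simps)
  ultimately show ?thesis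
    using E by (subst AE_pvm_measure_iff [OF P]) auto
qed

text \<open>Carries the measure from the Cantor space to the half-slice and, for uniqueness, from
  the half-slice to the plane, where quadrants are available.\<close>

lemma pvm_distr:
  assumes P: "pvm M P" and g: "g \<in> M \<rightarrow>\<^sub>M N"
  defines "P' \<equiv> \<lambda>F. P (g -` F \<inter> space M)"
  shows "pvm N P'" "pvm_measure N P' u = distr (pvm_measure M P u) N g"
proof -
  note pre = measurable_sets [OF g]
  have "g -` space N \<inter> space M = space M"
    using measurable_space [OF g] by blast
  moreover have "g -` (E \<inter> F) \<inter> space M = (g -` E \<inter> space M) \<inter> (g -` F \<inter> space M)" for E F
    by blast
  moreover have "(\<lambda>n. P (g -` A n \<inter> space M) u) sums P (g -` (\<Union>n. A n) \<inter> space M) u"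
    if "range A \<subseteq> sets N" "disjoint_family A" for A :: "nat \<Rightarrow> _" and u
  proof -
    have "(\<lambda>n. P (g -` A n \<inter> space M) u) sums P (\<Union>n. g -` A n \<inter> space M) u"
    proof (rule pvmD(4) [OF P])
      show "range (\<lambda>n. g -` A n \<inter> space M) \<subseteq> sets M"
        using that(1) pre by blast
      show "disjoint_family (\<lambda>n. g -` A n \<inter> space M)"
        using that(2) unfolding disjoint_family_on_def by blast
    qed
    then show ?thesis by (simp add: vimage_UN)
  qed
  ultimately show N: "pvm N P'"
    using P pre unfolding pvm_def P'_def by auto
  show "pvm_measure N P' u = distr (pvm_measure M P u) N g"
  proof (rule measure_eqI)
    fix F assume "F \<in> sets (pvm_measure N P' u)"
    then have F: "F \<in> sets N" by simp
    have "g \<in> pvm_measure M P u \<rightarrow>\<^sub>M N" using g by simp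
    then show "emeasure (pvm_measure N P' u) F = emeasure (distr (pvm_measure M P u) N g) F"
      using F pre [OF F] unfolding emeasure_pvm_measure [OF N F]
      by (simp add: emeasure_distr emeasure_pvm_measure [OF P] P'_def)
  qed simp
qed

section \<open>The joint spectral measure of two commuting self-adjoint operators\<close>

text \<open>The parameter \<open>s\<close> selects the coordinates that serve as digits, so that one
  sequence can carry two numbers.\<close>

definition binary_value :: "(nat \<Rightarrow> nat) \<Rightarrow> (nat \<Rightarrow> bool) \<Rightarrow> real"
  where "binary_value s x = (\<Sum>k. (1/2) ^ Suc k * of_bool (x (s k)))"

lemma binary_value_summable: "summable (\<lambda>k. (1/2) ^ Suc k * of_bool (x (s k)) :: real)"
  by (rule summable_comparison_test' [OF sums_summable [OF power_half_series]]) auto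

lemma binary_value_bounds: "0 \<le> binary_value s x" "binary_value s x \<le> 1"
proof -
  show "0 \<le> binary_value s x"
    unfolding binary_value_def by (intro suminf_nonneg binary_value_summable) auto
  have "binary_value s x \<le> (\<Sum>k. (1/2) ^ Suc k)"
    unfolding binary_value_def
    by (intro suminf_le binary_value_summable sums_summable [OF power_half_series]) auto
  then show "binary_value s x \<le> 1"
    using sums_unique [OF power_half_series] by simp
qed

abbreviation cantor_sets :: "(nat \<Rightarrow> bool) measure"
  where "cantor_sets \<equiv> sigma UNIV cylinders"

lemma digit_set: "{x. x n} \<in> sets cantor_sets"
  by (auto simp: cylinders_def depends_below_def intro!: sigma_sets.Basic exI [of _ "Suc n"])

lemma digit_measurable: "(\<lambda>x. of_bool (x n) :: real) \<in> borel_measurable cantor_sets"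
proof -
  have "(\<lambda>x. of_bool (x n) :: real) = indicator {x. x n}"
    by (auto simp: indicator_def)
  then show ?thesis
    using digit_set by (simp only: borel_measurable_indicator)
qed

lemma binary_value_measurable [measurable]: "binary_value s \<in> borel_measurable cantor_sets"
  unfolding binary_value_def [abs_def]
  by (intro borel_measurable_suminf borel_measurable_times digit_measurable borel_measurable_const)

text \<open>Term by term integration: the k-th digit integrates to
  \<open>\<langle>u,Q {x. x (s k)} u\<rangle>\<close>, and the weighted series of these projections
  is \<open>S\<close>.\<close>

lemma integral_binary_value:
  fixes Q :: "(nat \<Rightarrow> bool) set \<Rightarrow> 'h::quat_hilbert \<Rightarrow>\<^sub>L 'h"
  assumes Q: "pvm cantor_sets Q"
    and S: "(\<lambda>k. (1/2) ^ Suc k *\<^sub>R Q {x. x (s k)}) sums S"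
  shows "(\<integral>x. binary_value s x \<partial>pvm_measure cantor_sets Q u) = \<langle>u,S u\<rangle>"
proof -
  let ?\<mu> = "pvm_measure cantor_sets Q u"
  let ?f = "\<lambda>k x. (1/2) ^ Suc k * of_bool (x (s k)) :: real"
  interpret finite_measure ?\<mu> by (rule finite_measure_pvm_measure [OF Q])
  have meas: "?f k \<in> borel_measurable ?\<mu>" for k
    using digit_measurable by simp
  have int: "integrable ?\<mu> (?f k)" for k
  proof (rule integrable_const_bound [of _ 1, OF _ meas])
    have "\<bar>(1/2) ^ Suc k * of_bool (x (s k)) :: real\<bar> \<le> 1" for x
      using power_le_one [of "1/2 :: real" "Suc k"] by (cases "x (s k)") auto
    then show "AE x in ?\<mu>. norm (?f k x) \<le> 1" by simp
  qed
  have val: "(\<integral>x. ?f k x \<partial>?\<mu>) = (1/2) ^ Suc k * \<langle>u,Q {x. x (s k)} u\<rangle>" for k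
  proof -
    have "(\<lambda>x. of_bool (x (s k)) :: real) = indicator {x. x (s k)}"
      by (auto simp: indicator_def)
    then have "(\<integral>x. of_bool (x (s k)) \<partial>?\<mu>) = measure ?\<mu> {x. x (s k)}"
      using digit_set by (simp only: integral_indicator) (simp add: space_measure_of_conv)
    then show ?thesis
      by (simp add: measure_pvm_measure [OF Q digit_set] pvm_hinner(1) [OF Q digit_set])
  qed
  have "(\<integral>x. binary_value s x \<partial>?\<mu>) = (\<Sum>k. \<integral>x. ?f k x \<partial>?\<mu>)"
    unfolding binary_value_def
  proof (rule integral_suminf [OF int])
    show "AE x in ?\<mu>. summable (\<lambda>k. norm (?f k x))"
      by (intro AE_I2) (use binary_value_summable in simp)
    have "(\<integral>x. norm (?f k x) \<partial>?\<mu>) \<le> (1/2) ^ Suc k * (norm u)\<^sup>2" for k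
    proof -
      have "(\<integral>x. norm (?f k x) \<partial>?\<mu>) = (\<integral>x. ?f k x \<partial>?\<mu>)"
        by (intro Bochner_Integration.integral_cong) auto
      also have "\<dots> = (1/2) ^ Suc k * (norm (Q {x. x (s k)} u))\<^sup>2"
        unfolding val pvm_hinner(1) [OF Q digit_set] ..
      also have "\<dots> \<le> (1/2) ^ Suc k * (norm u)\<^sup>2"
        using proj_op_norm_le [OF pvmD(1) [OF Q digit_set]]
        by (intro mult_left_mono power_mono) auto
      finally show ?thesis .
    qed
    then show "summable (\<lambda>k. \<integral>x. norm (?f k x) \<partial>?\<mu>)"
      by (intro summable_comparison_test' [OF summable_mult2 [OF sums_summable [OF power_half_series]]])
        auto
  qed
  also have "\<dots> = \<langle>u,S u\<rangle>"
  proof -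
    have "bounded_linear (\<lambda>X. \<langle>u,blinfun_apply X u\<rangle>)"
      by (intro bounded_linear_compose [OF bounded_bilinear.bounded_linear_right
            [OF bounded_bilinear_hinner]] blinfun.bounded_linear_left)
    from bounded_linear.sums [OF this S]
    have "(\<lambda>k. \<integral>x. ?f k x \<partial>?\<mu>) sums \<langle>u,S u\<rangle>"
      unfolding val by (simp add: blinfun.bilinear_simps hinner_simps)
    then show ?thesis by (simp add: sums_iff)
  qed
  finally show ?thesis .
qed

theorem joint_spectral_measure:
  fixes A B :: "'h::quat_hilbert \<Rightarrow>\<^sub>L 'h"
  assumes \<iota>: "\<iota> \<in> imag_units" and A: "selfadj A" and B: "pos_op B" and AB: "commutes A B"
  shows "\<exists>c P. pvm (borel_half_slice \<iota>) P \<and>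
    P (half_slice \<iota> \<inter> cball 0 c) = id_blinfun \<and>
    (\<forall>u. (\<integral>x. qRe x \<partial>pvm_measure (borel_half_slice \<iota>) P u) = \<langle>u,A u\<rangle>) \<and>
    (\<forall>u. (\<integral>x. \<iota> \<bullet> x \<partial>pvm_measure (borel_half_slice \<iota>) P u) = \<langle>u,B u\<rangle>) \<and>
    (\<forall>E\<in>sets (borel_half_slice \<iota>). \<forall>Z. commutes Z A \<longrightarrow> commutes Z B \<longrightarrow> commutes Z (P E))"
proof -
  \<comment> \<open>One constant dominates both operators; the summand 1 keeps it positive.\<close>
  define c where "c = norm A + norm B + 1"
  have c: "c > 0" "norm A \<le> c" "norm B \<le> c"
    by (simp_all add: c_def add_nonneg_pos)
  have bnd: "\<bar>\<langle>u,S u\<rangle>\<bar> \<le> c * (norm u)\<^sup>2" if "norm S \<le> c" for S :: "'h \<Rightarrow>\<^sub>L 'h" and u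
  proof -
    have "\<bar>\<langle>u,S u\<rangle>\<bar> \<le> norm u * (norm S * norm u)"
      using hinner_bound [of u "S u"] norm_blinfun [of S u]
      by (meson mult_left_mono norm_ge_zero order_trans)
    also have "\<dots> \<le> norm u * (c * norm u)"
      using that by (intro mult_left_mono mult_right_mono) auto
    finally show ?thesis by (simp add: power2_eq_square mult.left_commute)
  qed
  \<comment> \<open>The affine change from [-c,c] to [0,1]. The positive \<open>B\<close> needs only
    the division by \<open>c\<close>, and scaling back will keep the imaginary coordinate
    nonnegative.\<close>
  define A0 where "A0 = (1/2) *\<^sub>R (id_blinfun + (1/c) *\<^sub>R A)"
  define B0 where "B0 = (1/c) *\<^sub>R B"
  have A0: "pos_op A0" "\<langle>u,A0 u\<rangle> \<le> (norm u)\<^sup>2" for u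
  proof -
    have q: "\<langle>u,A0 u\<rangle> = (1/2) * ((norm u)\<^sup>2 + \<langle>u,A u\<rangle> / c)" for u
      by (simp add: A0_def blinfun.bilinear_simps hinner_simps hinner_self)
    have b: "\<bar>\<langle>u,A u\<rangle> / c\<bar> \<le> (norm u)\<^sup>2" for u
      using bnd [OF c(2), of u] c(1) by (simp add: field_simps)
    have "0 \<le> \<langle>u,A0 u\<rangle> \<and> \<langle>u,A0 u\<rangle> \<le> (norm u)\<^sup>2" for u
    proof -
      define y where "y = \<langle>u,A u\<rangle> / c"
      show ?thesis
        using b [of u] unfolding q y_def [symmetric] by auto
    qed
    then show "pos_op A0" "\<langle>u,A0 u\<rangle> \<le> (norm u)\<^sup>2"
      using A by (auto simp: pos_op_def A0_def intro!: selfadj_simps)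
  qed
  have B0: "pos_op B0" "\<langle>u,B0 u\<rangle> \<le> (norm u)\<^sup>2" for u
    using B c bnd [OF c(3), of u]
    by (auto simp: B0_def pos_op_simps blinfun.bilinear_simps hinner_simps field_simps abs_le_iff)
  note dA = digit_props [OF A0] and dB = digit_props [OF B0]
  \<comment> \<open>The digits of the two operators are interleaved, so that one point of the Cantor
    space encodes both coordinates of a point of the half-slice.\<close>
  define E where "E n = (if even n then digit A0 (n div 2) else digit B0 (n div 2))" for n
  have cA: "commutes Z (digit A0 n)" if "commutes Z A" for Z n
    using dA(2) that by (auto simp: bicomm_def A0_def intro!: commutes_simps)
  have cB: "commutes Z (digit B0 n)" if "commutes Z B" for Z n
    using dB(2) that by (auto simp: bicomm_def B0_def intro!: commutes_simps)
  have cE: "commutes Z (E n)" if "commutes Z A" "commutes Z B" for Z n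
    using that cA cB by (simp add: E_def)
  have "commutes (E m) A" "commutes (E m) B" for m
    using cE [of A] cE [of B] AB commutes_sym by (metis commutes_self)+
  then have EE: "commutes (E m) (E n)" for m n
    by (rule cE)
  interpret commuting_projections E
    using dA(1) dB(1) EE by unfold_locales (auto simp: E_def)
  obtain Q where Q: "pvm cantor_sets Q" "\<And>n. Q {x. x n} = E n"
    "\<And>X Z. X \<in> sigma_sets UNIV cylinders \<Longrightarrow> (\<And>n. commutes Z (E n)) \<Longrightarrow> commutes Z (Q X)"
    using pvm_exists by blast
  \<comment> \<open>\<open>a\<close> and \<open>b\<close> undo the affine changes that led to
    \<open>A0\<close> and \<open>B0\<close>.\<close>
  define a where "a x = - c + 2 * c * binary_value (\<lambda>k. 2 * k) x" for x
  define b where "b x = c * binary_value (\<lambda>k. Suc (2 * k)) x" for x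
  define g where "g x = of_real (a x) + \<iota> * of_real (b x)" for x
  let ?M = "borel_half_slice \<iota>"
  have b0: "0 \<le> b x" for x using c binary_value_bounds by (simp add: b_def)
  have gmem: "g x \<in> half_slice \<iota>" for x
    unfolding g_def by (intro half_sliceI \<iota> b0)
  have g1: "qRe (g x) = a x" "\<iota> \<bullet> g x = b x" for x
    unfolding g_def using slice_coords [OF \<iota>] by auto
  have am [measurable]: "a \<in> borel_measurable cantor_sets" "b \<in> borel_measurable cantor_sets"
    unfolding a_def [abs_def] b_def [abs_def] by measurable
  have "g \<in> borel_measurable cantor_sets"
    unfolding g_def [abs_def] of_real_def by measurable
  then have g: "g \<in> cantor_sets \<rightarrow>\<^sub>M ?M"
    using gmem by (intro measurable_restrict_space2) auto
  define P where "P F = Q (g -` F \<inter> space cantor_sets)" for F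
  have P: "pvm ?M P" and d: "pvm_measure ?M P u = distr (pvm_measure cantor_sets Q u) ?M g" for u
    unfolding P_def [abs_def] by (rule pvm_distr [OF Q(1) g])+
  have "norm (g x) \<le> 2 * c" for x
  proof -
    have "\<bar>a x\<bar> \<le> c" "\<bar>b x\<bar> \<le> c"
      using c binary_value_bounds [of "\<lambda>k. 2 * k" x] binary_value_bounds [of "\<lambda>k. Suc (2 * k)" x]
        mult_left_le [of "binary_value (\<lambda>k. 2 * k) x" c] mult_left_le [of "binary_value (\<lambda>k. Suc (2 * k)) x" c]
        mult_nonneg_nonneg [of c "binary_value (\<lambda>k. 2 * k) x"] mult_nonneg_nonneg [of c "binary_value (\<lambda>k. Suc (2 * k)) x"]
      by (auto simp: a_def b_def abs_le_iff)
    moreover have "norm (g x) \<le> \<bar>a x\<bar> + \<bar>b x\<bar>"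
      unfolding g_def by (rule norm_triangle_le) (simp add: norm_mult imag_unit_simps [OF \<iota>])
    ultimately show ?thesis by simp
  qed
  then have "g -` (half_slice \<iota> \<inter> cball 0 (2 * c)) \<inter> space cantor_sets = space cantor_sets"
    using gmem by auto
  then have "P (half_slice \<iota> \<inter> cball 0 (2 * c)) = id_blinfun"
    using pvmD(2) [OF Q(1)] by (simp add: P_def)
  moreover have "(\<integral>x. qRe x \<partial>pvm_measure ?M P u) = \<langle>u,A u\<rangle>" for u
  proof -
    interpret finite_measure "pvm_measure cantor_sets Q u"
      by (rule finite_measure_pvm_measure [OF Q(1)])
    have "(\<lambda>x. qRe x) \<in> borel_measurable ?M"
      by (intro measurable_restrict_space1 borel_measurable_continuous_onI
          linear_continuous_on bounded_linear_qRe)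
    then have "(\<integral>x. qRe x \<partial>pvm_measure ?M P u) = (\<integral>x. a x \<partial>pvm_measure cantor_sets Q u)"
      unfolding d using g by (subst integral_distr) (auto simp: g1)
    also have "\<dots> = - c * (norm u)\<^sup>2 + 2 * c * (\<integral>x. binary_value (\<lambda>k. 2 * k) x \<partial>pvm_measure cantor_sets Q u)"
    proof -
      have "integrable (pvm_measure cantor_sets Q u) (binary_value (\<lambda>k. 2 * k))"
        using binary_value_bounds by (intro integrable_const_bound [of _ 1]) auto
      then show ?thesis
        using measure_pvm_space [OF Q(1), of u] by (simp add: a_def)
    qed
    also have "(\<integral>x. binary_value (\<lambda>k. 2 * k) x \<partial>pvm_measure cantor_sets Q u) = \<langle>u,A0 u\<rangle>"
      using dA(3) by (intro integral_binary_value [OF Q(1)]) (simp add: Q(2) E_def)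
    finally show ?thesis
      using c by (simp add: A0_def blinfun.bilinear_simps hinner_simps hinner_self field_simps)
  qed
  moreover have "(\<integral>x. \<iota> \<bullet> x \<partial>pvm_measure ?M P u) = \<langle>u,B u\<rangle>" for u
  proof -
    have "(\<lambda>x. \<iota> \<bullet> x) \<in> borel_measurable ?M"
      by (intro measurable_restrict_space1) measurable
    then have "(\<integral>x. \<iota> \<bullet> x \<partial>pvm_measure ?M P u) = (\<integral>x. b x \<partial>pvm_measure cantor_sets Q u)"
      unfolding d using g by (subst integral_distr) (auto simp: g1)
    also have "\<dots> = c * (\<integral>x. binary_value (\<lambda>k. Suc (2 * k)) x \<partial>pvm_measure cantor_sets Q u)"
      by (simp add: b_def)
    also have "(\<integral>x. binary_value (\<lambda>k. Suc (2 * k)) x \<partial>pvm_measure cantor_sets Q u) = \<langle>u,B0 u\<rangle>"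
      using dB(3) by (intro integral_binary_value [OF Q(1)]) (simp add: Q(2) E_def)
    finally show ?thesis
      using c by (simp add: B0_def blinfun.bilinear_simps hinner_simps)
  qed
  moreover have "commutes Z (P F)" if "F \<in> sets ?M" "commutes Z A" "commutes Z B" for F Z
    unfolding P_def using measurable_sets [OF g that(1)] cE [OF that(2,3)]
    by (intro Q(3)) simp_all
  ultimately show ?thesis
    using P by (intro exI [of _ "2 * c"] exI [of _ P]) simp
qed

section \<open>Left scalar multiplications\<close>

lemma qbounded_ops_eqI:
  assumes N: "hilbert_basis N" and ST: "S \<in> qbounded_ops" "T \<in> qbounded_ops"
    and eq: "\<And>z. z \<in> N \<Longrightarrow> S z = T z"
  shows "S = T"
proof -
  let ?K = "{u. S u = T u}"
  have K: "closed ?K" "subspace ?K"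
    using closed_subspace_equalizer [OF blinfun.bounded_linear_right blinfun.bounded_linear_right] .
  have "qspan N \<subseteq> ?K"
    using eq qbounded_opsD [OF ST(1)] qbounded_opsD [OF ST(2)]
    by (force simp: qspan_def blinfun.bilinear_simps intro!: sum.cong)
  then have "closure (qspan N) \<subseteq> ?K"
    using K(1) by (rule closure_minimal)
  then show ?thesis
    using N by (intro blinfun_eqI) (auto simp: hilbert_basis_def)
qed

lemma has_sum_hilbert_basis:
  assumes N: "hilbert_basis N" and w: "w \<in> N"
  shows "((\<lambda>z. z \<cdot>\<^sub>Q q \<cdot>\<^sub>Q qinner z w) has_sum (w \<cdot>\<^sub>Q q)) N"
proof -
  have "((\<lambda>z. z \<cdot>\<^sub>Q q \<cdot>\<^sub>Q qinner z w) has_sum (w \<cdot>\<^sub>Q q)) {w}"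
    using N w by (intro has_sum_finiteI) (auto simp: hilbert_basis_def scaleQ_one)
  then show ?thesis
    using N w by (subst (asm) has_sum_cong_neutral [of N]) (auto simp: hilbert_basis_def)
qed

text \<open>In the series at a basis vector only its own term survives. Since right-linear operators
  that agree on a Hilbert basis are equal, the algebraic identities for \<open>L\<close> reduce to
  those of right multiplication there.\<close>

lemma left_mult_basis:
  assumes "left_mult L"
  shows "\<exists>N. hilbert_basis N \<and> (\<forall>z\<in>N. \<forall>q. L q z = z \<cdot>\<^sub>Q q)"
proof -
  obtain N where N: "hilbert_basis N"
    "\<And>q u. ((\<lambda>z. z \<cdot>\<^sub>Q q \<cdot>\<^sub>Q qinner z u) has_sum L q u) N"
    using assms by (auto simp: left_mult_def)
  have "L q w = w \<cdot>\<^sub>Q q" if "w \<in> N" for w q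
    using has_sum_unique [OF N(2) has_sum_hilbert_basis [OF N(1) that]] .
  with N(1) show ?thesis by blast
qed

lemma left_mult_qbounded: "left_mult L \<Longrightarrow> L q \<in> qbounded_ops"
  by (simp add: left_mult_def)

lemma left_mult_add:
  assumes "left_mult L"
  shows "L (p + q) = L p + L q"
proof -
  obtain N where N: "hilbert_basis N" "\<And>z q. z \<in> N \<Longrightarrow> L q z = z \<cdot>\<^sub>Q q"
    using left_mult_basis [OF assms] by blast
  show ?thesis
    using left_mult_qbounded [OF assms]
    by (intro qbounded_ops_eqI [OF N(1)] qbounded_ops_simps)
      (simp_all add: N(2) blinfun.bilinear_simps scaleQ_add_right)
qed

lemma left_mult_mult:
  assumes "left_mult L"
  shows "L (p * q) = L p o\<^sub>L L q"
proof -
  obtain N where N: "hilbert_basis N" "\<And>z q. z \<in> N \<Longrightarrow> L q z = z \<cdot>\<^sub>Q q"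
    using left_mult_basis [OF assms] by blast
  show ?thesis
    using left_mult_qbounded [OF assms]
    by (intro qbounded_ops_eqI [OF N(1)] qbounded_ops_simps)
      (simp_all add: N(2) qbounded_opsD [OF left_mult_qbounded [OF assms]] scaleQ_mult)
qed

lemma left_mult_of_real:
  assumes "left_mult L"
  shows "L (of_real r) = r *\<^sub>R id_blinfun"
proof -
  obtain N where N: "hilbert_basis N" "\<And>z q. z \<in> N \<Longrightarrow> L q z = z \<cdot>\<^sub>Q q"
    using left_mult_basis [OF assms] by blast
  have "id_blinfun \<in> qbounded_ops" by (simp add: qbounded_ops_def)
  then show ?thesis
    using left_mult_qbounded [OF assms]
    by (intro qbounded_ops_eqI [OF N(1)] qbounded_ops_simps)
      (simp_all add: N(2) scaleQ_of_real blinfun.bilinear_simps)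
qed

lemma left_mult_0:
  assumes "left_mult L"
  shows "L 0 = 0"
  using left_mult_of_real [OF assms, of 0] by simp

lemma left_mult_minus:
  assumes "left_mult L"
  shows "L (- q) = - L q"
  using left_mult_add [OF assms, of q "- q"] by (simp add: left_mult_0 [OF assms] minus_unique)

lemma left_mult_1:
  assumes "left_mult L"
  shows "L 1 = id_blinfun"
  using left_mult_of_real [OF assms, of 1] by simp

lemma left_mult_adj:
  assumes "left_mult L"
  shows "radj (L q) = L (qcnj q)"
proof -
  obtain N where N: "hilbert_basis N" "\<And>z q. z \<in> N \<Longrightarrow> L q z = z \<cdot>\<^sub>Q q"
    using left_mult_basis [OF assms] by blast
  note Lq = left_mult_qbounded [OF assms]
  show ?thesis
  proof (rule qbounded_ops_eqI [OF N(1) radj_qbounded [OF Lq] Lq])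
    fix z assume z: "z \<in> N"
    let ?K = "{v. \<langle>radj (L q) z,v\<rangle> = \<langle>L (qcnj q) z,v\<rangle>}"
    have K: "closed ?K"
      by (intro closed_subspace_equalizer bounded_bilinear.bounded_linear_right [OF bounded_bilinear_hinner])
    have w: "\<langle>radj (L q) z,w \<cdot>\<^sub>Q p\<rangle> = \<langle>L (qcnj q) z,w \<cdot>\<^sub>Q p\<rangle>" if "w \<in> N" for w p
    proof -
      \<comment> \<open>Inner products of basis vectors are central, which lets \<open>q\<close>
        pass from one side to the other.\<close>
      have "qinner z w \<in> {0, 1}"
        using N(1) z that by (auto simp: hilbert_basis_def)
      then have "qinner z w * q = q * qinner z w" by auto
      then show ?thesis
        by (simp add: radj_qinner [OF Lq] N z that hinner_scaleQ_right qinner_scaleQ_right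
            qinner_scaleQ_left del: quat_sel_mult)
    qed
    have "qspan N \<subseteq> ?K"
      by (auto simp: qspan_def bounded_bilinear.sum_right [OF bounded_bilinear_hinner] intro!: sum.cong w)
    then have "closure (qspan N) \<subseteq> ?K"
      using K by (rule closure_minimal)
    then show "radj (L q) z = L (qcnj q) z"
      using N(1) by (intro hinner_eqI) (auto simp: hilbert_basis_def)
  qed
qed

text \<open>\<open>L q\<close> and its adjoint \<open>L (qcnj q)\<close> have the same quadratic
  form, and they add up to \<open>2 * qRe q\<close> times the identity.\<close>

lemma left_mult_hinner:
  assumes "left_mult L"
  shows "\<langle>u,L q u\<rangle> = qRe q * (norm u)\<^sup>2"
proof -
  have "q + qcnj q = of_real (2 * qRe q)"
    by (simp add: quat_eq_iff del: of_real_mult)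
  then have "L q + radj (L q) = (2 * qRe q) *\<^sub>R id_blinfun"
    using left_mult_of_real [OF assms] by (metis left_mult_add [OF assms] left_mult_adj [OF assms])
  then have "\<langle>u,(L q + radj (L q)) u\<rangle> = \<langle>u,((2 * qRe q) *\<^sub>R id_blinfun) u\<rangle>"
    by (simp only:)
  then show ?thesis
    using hinner_commute [of u "L q u"]
    by (simp add: blinfun.bilinear_simps hinner_simps radj' hinner_self)
qed

lemma left_mult_norm:
  assumes "left_mult L"
  shows "norm (L q u) = norm q * norm u"
proof -
  have "(norm (L q u))\<^sup>2 = \<langle>u,(L (qcnj q) o\<^sub>L L q) u\<rangle>"
    by (simp add: hinner_self [symmetric] left_mult_adj [OF assms, symmetric] radj')
  also have "\<dots> = (norm q)\<^sup>2 * (norm u)\<^sup>2"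
    by (simp add: left_mult_mult [OF assms, symmetric] qcnj_mult_self left_mult_hinner [OF assms] del: of_real_power)
  finally show ?thesis
    by (simp add: power_mult_distrib [symmetric])
qed

section \<open>Integrals with respect to an intertwining projection-valued measure\<close>

text \<open>The defect \<open>D u v = qinner u (A v) - qinner (A u) v\<close> vanishes for equal
  arguments, so \<open>D u v * p + qcnj p * D v u = 0\<close> for all \<open>p\<close>. With
  \<open>p = 1\<close> this gives \<open>D v u = - D u v\<close>; the three imaginary units then
  force \<open>D u v\<close> to anticommute with each of them, so it is 0.\<close>

lemma qpositive_selfadj:
  assumes Q: "A \<in> qbounded_ops" "qpositive A"
  shows "selfadj A"
proof -
  have real: "qinner u (A u) = qinner (A u) u" for u
    using Q(2) unfolding qpositive_def by (subst (2) qinner_qcnj) (metis imageE qcnj_simps(2))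
  have "\<langle>u,A v\<rangle> = \<langle>A u,v\<rangle>" for u v
  proof -
    define D where "D u v = qinner u (A v) - qinner (A u) v" for u v
    have D0: "D u u = 0" for u using real by (simp add: D_def)
    have "D (u + v \<cdot>\<^sub>Q p) (u + v \<cdot>\<^sub>Q p) = D u u + D u v * p + qcnj p * D v u + qcnj p * D v v * p" for p
      by (simp add: D_def blinfun.bilinear_simps qbounded_opsD [OF Q(1)] qinner_add_left qinner_add_right
          qinner_scaleQ_left qinner_scaleQ_right algebra_simps del: quat_sel_mult)
    then have e: "D u v * p + qcnj p * D v u = 0" for p
      by (simp add: D0)
    have "D v u = - D u v" using e [of 1] by (simp add: eq_neg_iff_add_eq_0 add.commute)
    then have "D u v * p = qcnj p * D u v" for p
      using e [of p] by simp
    from this [of "Quat 0 1 0 0"] this [of "Quat 0 0 1 0"] this [of "Quat 0 0 0 1"]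
    have "D u v = 0" by (simp add: quat_eq_iff)
    then show ?thesis by (simp add: D_def hinner_def)
  qed
  then show ?thesis by (simp add: selfadj_def)
qed

lemma qPVM_pvm:
  assumes "qPVM \<iota> P"
  shows "pvm (borel_half_slice \<iota>) P"
proof -
  have sp: "space (borel_half_slice \<iota>) = half_slice \<iota>"
    by (simp add: space_restrict_space)
  have "proj_op (P E)" if E: "E \<in> sets (borel_half_slice \<iota>)" for E
  proof -
    have Q: "P E \<in> qbounded_ops" "qpositive (P E)" and PP: "P E o\<^sub>L P E = P E"
      using assms E by (auto simp: qPVM_def)
    have "selfadj (P E)"
      using Q by (rule qpositive_selfadj)
    moreover have "P E (P E u) = P E u" for u
      using arg_cong [OF PP, of "\<lambda>B. blinfun_apply B u"] by simp
    ultimately show ?thesis by (simp add: proj_op_def)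
  qed
  then show ?thesis
    using assms unfolding qPVM_def pvm_def sp by blast
qed

lemma pos_op_qpositive:
  assumes A: "A \<in> qbounded_ops" "pos_op A"
  shows "qpositive A"
  unfolding qpositive_def
proof
  fix u
  have "radj A = A"
    using A(2) by (simp add: pos_op_def selfadj_radj)
  then have "qinner u (A u) = qcnj (qinner u (A u))"
    using radj_qinner [OF A(1), of u u] qinner_qcnj [of "A u" u] by simp
  then have "qinner u (A u) = of_real \<langle>u,A u\<rangle>"
    by (simp add: quat_eq_iff hinner_def)
  then show "qinner u (A u) \<in> of_real ` {0..}"
    using A(2) by (auto simp: pos_op_def)
qed

lemma pvm_qPVM:
  assumes P: "pvm (borel_half_slice \<iota>) P"
    and Q: "\<And>E. E \<in> sets (borel_half_slice \<iota>) \<Longrightarrow> P E \<in> qbounded_ops"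
  shows "qPVM \<iota> P"
proof -
  have sp: "space (borel_half_slice \<iota>) = half_slice \<iota>"
    by (simp add: space_restrict_space)
  have "qpositive (P E)" if E: "E \<in> sets (borel_half_slice \<iota>)" for E
    unfolding qpositive_def
  proof
    fix u
    have "radj (P E) = P E"
      using pvmD(1) [OF P E] by (simp add: proj_op_def selfadj_radj)
    then have "qinner u (P E u) = qinner (P E u) (P E u)"
      using radj_qinner [OF Q [OF E], of u "P E u"] pvm_hinner(3) [OF P E] by simp
    then show "qinner u (P E u) \<in> of_real ` {0..}"
      by (simp add: qinner_nonneg)
  qed
  then show ?thesis
    using P Q unfolding qPVM_def pvm_def sp by blast
qed

lemma norm_radj: "norm (radj T u) \<le> norm T * norm u"
proof -
  have "norm (radj T u) * norm (radj T u) = \<langle>u,T (radj T u)\<rangle>"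
    by (simp add: power2_eq_square [symmetric] hinner_self [symmetric] radj)
  also have "\<dots> \<le> norm u * (norm T * norm (radj T u))"
    using hinner_bound [of u "T (radj T u)"] norm_blinfun [of T "radj T u"]
    by (meson abs_le_iff mult_left_mono norm_ge_zero order_trans)
  finally have "norm (radj T u) * norm (radj T u) \<le> (norm T * norm u) * norm (radj T u)"
    by (simp add: mult_ac)
  then show ?thesis
    by (cases "norm (radj T u) = 0") (auto simp: mult_le_cancel_right)
qed

lemma bounded_linear_radj: "bounded_linear radj"
  by (rule bounded_linear_intro [of _ 1])
    (auto simp: radj_add radj_scaleR intro!: norm_blinfun_bound norm_radj)

lemma norm_sq_sum_orthogonal:
  fixes f :: "'i \<Rightarrow> 'h::quat_hilbert"
  assumes "finite I" "\<And>i j. i \<in> I \<Longrightarrow> j \<in> I \<Longrightarrow> i \<noteq> j \<Longrightarrow> \<langle>f i,f j\<rangle> = 0"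
  shows "(norm (\<Sum>i\<in>I. f i))\<^sup>2 = (\<Sum>i\<in>I. (norm (f i))\<^sup>2)"
  using assms
proof (induction I)
  case (insert i I)
  have "\<langle>f i,\<Sum>i\<in>I. f i\<rangle> = 0"
    using insert by (auto simp: bounded_bilinear.sum_right [OF bounded_bilinear_hinner] intro!: sum.neutral)
  then show ?case using insert by (simp add: norm_add_sq)
qed simp

locale iq_measure =
  fixes \<iota> :: quat and P :: "quat set \<Rightarrow> 'h::quat_hilbert \<Rightarrow>\<^sub>L 'h" and L :: "quat \<Rightarrow> 'h \<Rightarrow>\<^sub>L 'h"
  assumes unit: "\<iota> \<in> imag_units" and iqPVM: "iqPVM \<iota> P L"
begin

abbreviation "X \<equiv> half_slice \<iota>"
abbreviation "M \<equiv> borel_half_slice \<iota>"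
abbreviation "\<mu> \<equiv> pvm_measure M P"
abbreviation "I \<equiv> iq_simple_integral \<iota> P L"
abbreviation "has \<equiv> has_iq_integral_bdd \<iota> P L"

lemma L: "left_mult L"
  using iqPVM by (simp add: iqPVM_def)

lemma qPVM: "qPVM \<iota> P"
  using iqPVM by (simp add: iqPVM_def)

lemma pvm: "pvm M P"
  using qPVM by (rule qPVM_pvm)

lemma space_M [simp]: "space M = X"
  by (simp add: space_restrict_space)

lemma PL: "E \<in> sets M \<Longrightarrow> P E (L q u) = L q (P E u)"
  using iqPVM unfolding iqPVM_def by (metis blinfun_apply_blinfun_compose)

lemma P_qbounded: "E \<in> sets M \<Longrightarrow> P E \<in> qbounded_ops"
  using qPVM by (simp add: qPVM_def)

lemma finite_measure_\<mu>: "finite_measure (\<mu> u)"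
  by (rule finite_measure_pvm_measure [OF pvm])

lemma measure_\<mu>: "measure (\<mu> u) X = (norm u)\<^sup>2"
  using measure_pvm_space [OF pvm] by simp

lemma simple_fibre: "simple_function M h \<Longrightarrow> h -` {i} \<inter> X \<in> sets M"
  using simple_functionD(2) [of M h "{i}"] by simp

lemma simple_finite: "simple_function M h \<Longrightarrow> finite (h ` X)"
  using simple_functionD(1) [of M h] by simp

text \<open>The fibres of \<open>h\<close> refine those of the composite, so the canonical
  representation may be replaced by a finer one. With a pair of simple functions as \<open>h\<close>
  this gives additivity.\<close>

lemma simple_integral_comp:
  assumes h: "simple_function M h"
  shows "I (\<lambda>x. g (h x)) = (\<Sum>i\<in>h ` X. L (g i) o\<^sub>L P (h -` {i} \<inter> X))"
proof -
  have fin: "finite (h ` X)" using h by (rule simple_finite)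
  have "P ((\<lambda>x. g (h x)) -` {y} \<inter> X) = (\<Sum>i\<in>{i \<in> h ` X. g i = y}. P (h -` {i} \<inter> X))" for y
  proof -
    have "(\<lambda>x. g (h x)) -` {y} \<inter> X = (\<Union>i\<in>{i \<in> h ` X. g i = y}. h -` {i} \<inter> X)" by auto
    also have "P \<dots> = (\<Sum>i\<in>{i \<in> h ` X. g i = y}. P (h -` {i} \<inter> X))"
      using fin simple_fibre [OF h] by (intro pvm_finite_union [OF pvm]) auto
    finally show ?thesis .
  qed
  then have "I (\<lambda>x. g (h x)) =
      (\<Sum>y\<in>g ` h ` X. \<Sum>i\<in>{i \<in> h ` X. g i = y}. L (g i) o\<^sub>L P (h -` {i} \<inter> X))"
    unfolding iq_simple_integral_def image_image
    by (intro sum.cong refl) (simp add: bounded_bilinear.sum_right [OF bounded_bilinear_blinfun_compose])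
  also have "\<dots> = (\<Sum>i\<in>h ` X. L (g i) o\<^sub>L P (h -` {i} \<inter> X))"
    using sum.image_gen [OF fin, of "\<lambda>i. L (g i) o\<^sub>L P (h -` {i} \<inter> X)" g] by simp
  finally show ?thesis .
qed

lemma simple_integral_add:
  assumes s: "simple_function M s" and t: "simple_function M t"
  shows "I (\<lambda>x. s x + t x) = I s + I t"
proof -
  define h where "h x = (s x, t x)" for x
  have h: "simple_function M h"
    unfolding h_def using s t by (rule simple_function_Pair)
  have "I (\<lambda>x. s x + t x) = I (\<lambda>x. (\<lambda>p. fst p + snd p) (h x))" by (simp add: h_def)
  also have "\<dots> = I (\<lambda>x. fst (h x)) + I (\<lambda>x. snd (h x))"
    unfolding simple_integral_comp [OF h, of "\<lambda>p. fst p + snd p"]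
      simple_integral_comp [OF h, of fst] simple_integral_comp [OF h, of snd]
    by (simp add: left_mult_add [OF L] bounded_bilinear.add_left [OF bounded_bilinear_blinfun_compose] sum.distrib)
  also have "\<dots> = I s + I t" by (simp add: h_def)
  finally show ?thesis .
qed

lemma simple_integral_mult_left:
  assumes "simple_function M s"
  shows "I (\<lambda>x. q * s x) = L q o\<^sub>L I s"
  unfolding simple_integral_comp [OF assms, of "(*) q"] unfolding iq_simple_integral_def
    bounded_bilinear.sum_right [OF bounded_bilinear_blinfun_compose]
  by (intro sum.cong refl blinfun_eqI) (simp add: left_mult_mult [OF L])

lemma simple_integral_mult_right:
  assumes s: "simple_function M s"
  shows "I (\<lambda>x. s x * q) = I s o\<^sub>L L q"
  unfolding simple_integral_comp [OF s, of "\<lambda>y. y * q"] unfolding iq_simple_integral_def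
    bounded_bilinear.sum_left [OF bounded_bilinear_blinfun_compose]
  by (intro sum.cong refl blinfun_eqI) (simp add: left_mult_mult [OF L] PL [OF simple_fibre [OF s]])

lemma simple_integral_cnj:
  assumes s: "simple_function M s"
  shows "I (\<lambda>x. qcnj (s x)) = radj (I s)"
proof -
  have "radj (P (s -` {y} \<inter> X)) = P (s -` {y} \<inter> X)" for y
    using pvmD(1) [OF pvm simple_fibre [OF s]] by (simp add: proj_op_def selfadj_radj)
  then show ?thesis
    unfolding simple_integral_comp [OF s, of qcnj] unfolding iq_simple_integral_def
      linear_sum [OF bounded_linear.linear [OF bounded_linear_radj]]
    by (intro sum.cong refl blinfun_eqI)
      (simp add: radj_compose left_mult_adj [OF L] PL [OF simple_fibre [OF s]])
qed

lemma X_nonempty: "X \<noteq> {}"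
  using half_sliceI [OF unit, of 0] by blast

lemma simple_integral_const: "I (\<lambda>x. q) = L q"
proof -
  have "(\<lambda>x :: quat. q) ` X = {q}" using X_nonempty by auto
  moreover have "P X = id_blinfun" using pvmD(2) [OF pvm] by simp
  ultimately show ?thesis
    by (intro blinfun_eqI) (simp add: iq_simple_integral_def)
qed

lemma simple_integral_real:
  fixes F :: "quat \<Rightarrow> real"
  assumes s: "simple_function M s"
  shows "(\<integral>x. F (s x) \<partial>\<mu> u) = (\<Sum>y\<in>s ` X. F y * (norm (P (s -` {y} \<inter> X) u))\<^sup>2)"
proof -
  interpret finite_measure "\<mu> u" by (rule finite_measure_\<mu>)
  have fin: "finite (s ` X)" using s by (rule simple_finite)
  have "(\<integral>x. F (s x) \<partial>\<mu> u) = (\<integral>x. (\<Sum>y\<in>s ` X. F y * indicator (s -` {y} \<inter> X) x) \<partial>\<mu> u)"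
  proof (rule Bochner_Integration.integral_cong [OF refl])
    fix x assume "x \<in> space (\<mu> u)"
    then have x: "x \<in> X" by simp
    have "(\<Sum>y\<in>s ` X. F y * indicator (s -` {y} \<inter> X) x) = (\<Sum>y\<in>s ` X. if y = s x then F (s x) else 0)"
      using x by (intro sum.cong) (auto simp: indicator_def)
    then show "F (s x) = (\<Sum>y\<in>s ` X. F y * indicator (s -` {y} \<inter> X) x)"
      using fin x by simp
  qed
  also have "\<dots> = (\<Sum>y\<in>s ` X. \<integral>x. F y * indicator (s -` {y} \<inter> X) x \<partial>\<mu> u)"
    using simple_fibre [OF s] by (intro Bochner_Integration.integral_sum)
      (auto intro!: integrable_mult_right integrable_real_indicator simp: emeasure_eq_measure)
  also have "\<dots> = (\<Sum>y\<in>s ` X. F y * (norm (P (s -` {y} \<inter> X) u))\<^sup>2)"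
    using simple_fibre [OF s] by (intro sum.cong refl)
      (simp add: measure_pvm_measure [OF pvm] Int_absorb2)
  finally show ?thesis .
qed

text \<open>Distinct fibres are disjoint, so their projections have orthogonal ranges; each
  \<open>L y\<close> preserves these ranges and multiplies norms by \<open>norm y\<close>.
  Pythagoras gives the isometry.\<close>

lemma simple_integral_norm:
  assumes s: "simple_function M s"
  shows "(norm (I s u))\<^sup>2 = (\<integral>x. (norm (s x))\<^sup>2 \<partial>\<mu> u)"
proof -
  note f = simple_fibre [OF s]
  have "(norm (I s u))\<^sup>2 = (norm (\<Sum>y\<in>s ` X. L y (P (s -` {y} \<inter> X) u)))\<^sup>2"
    by (simp add: iq_simple_integral_def blinfun.sum_left)
  also have "\<dots> = (\<Sum>y\<in>s ` X. (norm (L y (P (s -` {y} \<inter> X) u)))\<^sup>2)"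
  proof (rule norm_sq_sum_orthogonal)
    show "finite (s ` X)" using s by (rule simple_finite)
    fix y z :: quat assume "y \<noteq> z"
    then have "(s -` {y} \<inter> X) \<inter> (s -` {z} \<inter> X) = {}" by auto
    then have "P (s -` {y} \<inter> X) (P (s -` {z} \<inter> X) v) = 0" for v
      using pvmD(3) [OF pvm f f] pvm_empty [OF pvm] by simp
    then show "\<langle>L y (P (s -` {y} \<inter> X) u),L z (P (s -` {z} \<inter> X) u)\<rangle> = 0"
      by (simp add: PL [OF f, symmetric] pvm_hinner(2) [OF pvm f])
  qed
  also have "\<dots> = (\<integral>x. (norm (s x))\<^sup>2 \<partial>\<mu> u)"
    unfolding simple_integral_real [OF s, where F = "\<lambda>y. (norm y)\<^sup>2"]
    by (simp add: left_mult_norm [OF L] power_mult_distrib)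
  finally show ?thesis .
qed

lemma simple_integral_hinner:
  assumes s: "simple_function M s"
  shows "\<langle>u,I s u\<rangle> = (\<integral>x. qRe (s x) \<partial>\<mu> u)"
proof -
  note f = simple_fibre [OF s]
  have "\<langle>u,I s u\<rangle> = (\<Sum>y\<in>s ` X. \<langle>u,L y (P (s -` {y} \<inter> X) u)\<rangle>)"
    by (simp add: iq_simple_integral_def blinfun.sum_left bounded_bilinear.sum_right [OF bounded_bilinear_hinner])
  also have "\<dots> = (\<Sum>y\<in>s ` X. qRe y * (norm (P (s -` {y} \<inter> X) u))\<^sup>2)"
  proof (rule sum.cong [OF refl])
    fix y :: quat
    let ?E = "s -` {y} \<inter> X"
    have "\<langle>u,L y (P ?E u)\<rangle> = \<langle>u,P ?E (L y (P ?E u))\<rangle>"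
      by (simp add: PL [OF f] pvm_hinner(3) [OF pvm f])
    also have "\<dots> = \<langle>P ?E u,L y (P ?E u)\<rangle>"
      by (simp add: pvm_hinner(2) [OF pvm f])
    finally show "\<langle>u,L y (P ?E u)\<rangle> = qRe y * (norm (P ?E u))\<^sup>2"
      by (simp add: left_mult_hinner [OF L])
  qed
  also have "\<dots> = (\<integral>x. qRe (s x) \<partial>\<mu> u)"
    by (rule simple_integral_real [OF s, symmetric])
  finally show ?thesis .
qed

lemma simple_integral_commutes:
  assumes s: "simple_function M s" and E: "E \<in> sets M"
  shows "commutes (P E) (I s)"
proof -
  have "commutes (P E) (L y o\<^sub>L P (s -` {y} \<inter> X))" for y
    using pvmD(3) [OF pvm E simple_fibre [OF s]] pvmD(3) [OF pvm simple_fibre [OF s] E]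
    by (simp add: commutes_def PL [OF E] Int_commute)
  then show ?thesis
    unfolding iq_simple_integral_def by (intro commutes_sum)
qed

lemma simple_integral_right_mult:
  assumes s: "simple_function M s"
  shows "commutes (right_mult q) (I s)"
proof -
  have "commutes (right_mult q) (L y o\<^sub>L P (s -` {y} \<inter> X))" for y
    using qbounded_opsD [OF P_qbounded [OF simple_fibre [OF s]]] qbounded_opsD [OF left_mult_qbounded [OF L]]
    by (simp add: commutes_def)
  then show ?thesis
    unfolding iq_simple_integral_def by (intro commutes_sum)
qed

section \<open>The integral of uniform limits of simple functions\<close>

lemma hasI:
  assumes "\<And>n. simple_function M (s n)" "uniform_limit X s \<phi> sequentially" "(\<lambda>n. I (s n)) \<longlonglongrightarrow> A"
  shows "has \<phi> A"
  using assms unfolding has_iq_integral_bdd_def by blast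

lemma hasE:
  assumes "has \<phi> A"
  obtains s where "\<And>n. simple_function M (s n)" "uniform_limit X s \<phi> sequentially" "(\<lambda>n. I (s n)) \<longlonglongrightarrow> A"
  using assms unfolding has_iq_integral_bdd_def by blast

lemma has_add:
  assumes "has \<phi> A" "has \<psi> B"
  shows "has (\<lambda>x. \<phi> x + \<psi> x) (A + B)"
proof -
  obtain s where s: "\<And>n. simple_function M (s n)" "uniform_limit X s \<phi> sequentially" "(\<lambda>n. I (s n)) \<longlonglongrightarrow> A"
    using hasE [OF assms(1)] by metis
  obtain t where t: "\<And>n. simple_function M (t n)" "uniform_limit X t \<psi> sequentially" "(\<lambda>n. I (t n)) \<longlonglongrightarrow> B"
    using hasE [OF assms(2)] by metis
  show ?thesis
  proof (rule hasI [of "\<lambda>n x. s n x + t n x"])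
    show "simple_function M (\<lambda>x. s n x + t n x)" for n
      using s t by (intro simple_function_add)
    show "uniform_limit X (\<lambda>n x. s n x + t n x) (\<lambda>x. \<phi> x + \<psi> x) sequentially"
      using s t by (intro uniform_limit_add)
    show "(\<lambda>n. I (\<lambda>x. s n x + t n x)) \<longlonglongrightarrow> A + B"
      using s t by (simp add: simple_integral_add tendsto_add)
  qed
qed

lemma has_mult_left:
  assumes "has \<phi> A"
  shows "has (\<lambda>x. q * \<phi> x) (L q o\<^sub>L A)"
proof -
  obtain s where s: "\<And>n. simple_function M (s n)" "uniform_limit X s \<phi> sequentially" "(\<lambda>n. I (s n)) \<longlonglongrightarrow> A"
    using hasE [OF assms] by metis
  show ?thesis
  proof (rule hasI [of "\<lambda>n x. q * s n x"])
    show "simple_function M (\<lambda>x. q * s n x)" for n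
      using simple_function_compose1 [OF s(1), of "(*) q"] .
    show "uniform_limit X (\<lambda>n x. q * s n x) (\<lambda>x. q * \<phi> x) sequentially"
      using bounded_linear.uniform_limit [OF bounded_linear_mult_right s(2)] .
    show "(\<lambda>n. I (\<lambda>x. q * s n x)) \<longlonglongrightarrow> (L q o\<^sub>L A)"
      using s by (simp add: simple_integral_mult_left
          bounded_bilinear.tendsto [OF bounded_bilinear_blinfun_compose])
  qed
qed

lemma has_mult_right:
  assumes "has \<phi> A"
  shows "has (\<lambda>x. \<phi> x * q) (A o\<^sub>L L q)"
proof -
  obtain s where s: "\<And>n. simple_function M (s n)" "uniform_limit X s \<phi> sequentially" "(\<lambda>n. I (s n)) \<longlonglongrightarrow> A"
    using hasE [OF assms] by metis
  show ?thesis
  proof (rule hasI [of "\<lambda>n x. s n x * q"])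
    show "simple_function M (\<lambda>x. s n x * q)" for n
      using simple_function_compose1 [OF s(1), of "\<lambda>y. y * q"] .
    show "uniform_limit X (\<lambda>n x. s n x * q) (\<lambda>x. \<phi> x * q) sequentially"
      using bounded_linear.uniform_limit [OF bounded_linear_mult_left s(2)] .
    show "(\<lambda>n. I (\<lambda>x. s n x * q)) \<longlonglongrightarrow> (A o\<^sub>L L q)"
      using s by (simp add: simple_integral_mult_right
          bounded_bilinear.tendsto [OF bounded_bilinear_blinfun_compose])
  qed
qed

lemma has_cnj:
  assumes "has \<phi> A"
  shows "has (\<lambda>x. qcnj (\<phi> x)) (radj A)"
proof -
  obtain s where s: "\<And>n. simple_function M (s n)" "uniform_limit X s \<phi> sequentially" "(\<lambda>n. I (s n)) \<longlonglongrightarrow> A"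
    using hasE [OF assms] by metis
  show ?thesis
  proof (rule hasI [of "\<lambda>n x. qcnj (s n x)"])
    show "simple_function M (\<lambda>x. qcnj (s n x))" for n
      using simple_function_compose1 [OF s(1), of qcnj] .
    show "uniform_limit X (\<lambda>n x. qcnj (s n x)) (\<lambda>x. qcnj (\<phi> x)) sequentially"
      using bounded_linear.uniform_limit [OF bounded_linear_qcnj s(2)] .
    show "(\<lambda>n. I (\<lambda>x. qcnj (s n x))) \<longlonglongrightarrow> radj A"
      using s by (simp add: simple_integral_cnj bounded_linear.tendsto [OF bounded_linear_radj])
  qed
qed

lemma has_const: "has (\<lambda>x. q) (L q)"
  by (rule hasI [of "\<lambda>n x. q"]) (auto simp: simple_integral_const uniform_limit_const)

lemma has_diff:
  assumes "has \<phi> A" "has \<psi> B"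
  shows "has (\<lambda>x. \<phi> x - \<psi> x) (A - B)"
proof -
  have "L (- 1) o\<^sub>L B = - B"
    by (intro blinfun_eqI) (simp add: left_mult_minus [OF L] left_mult_1 [OF L] blinfun.bilinear_simps)
  then show ?thesis
    using has_add [OF assms(1) has_mult_left [OF assms(2), of "- 1"]] by simp
qed

lemma has_cong:
  assumes "\<And>x. x \<in> X \<Longrightarrow> \<phi> x = \<psi> x" "has \<phi> A"
  shows "has \<psi> A"
  using assms uniform_limit_cong' [of X] unfolding has_iq_integral_bdd_def by metis

lemma has_commutes:
  assumes "has \<phi> A" "E \<in> sets M"
  shows "commutes (P E) A"
  using assms simple_integral_commutes commutes_lim by (metis hasE)

lemma has_qbounded:
  assumes "has \<phi> A"
  shows "A \<in> qbounded_ops"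
proof -
  have "commutes (right_mult q) A" for q
    using assms simple_integral_right_mult commutes_lim by (metis hasE)
  then show ?thesis
    by (simp add: commutes_def qbounded_ops_def)
qed

lemma simple_borel: "simple_function M s \<Longrightarrow> s \<in> borel_measurable M"
  by (rule borel_measurable_simple_function)

text \<open>If \<open>K\<close> bounds some \<open>s N\<close> from which on the sequence is within
  1 of the limit, then \<open>K + 1\<close> bounds the limit and \<open>K + 2\<close> all later
  functions. Dropping the first \<open>N\<close> functions provides the uniform bound for dominated
  convergence.\<close>

lemma has_approx:
  assumes "has \<phi> A"
  shows "\<exists>s K. (\<forall>n. simple_function M (s n)) \<and> (\<forall>n. \<forall>x\<in>X. norm (s n x) \<le> K) \<and>
    (\<forall>x\<in>X. (\<lambda>n. s n x) \<longlonglongrightarrow> \<phi> x) \<and> (\<lambda>n. I (s n)) \<longlonglongrightarrow> A \<and> (\<forall>x\<in>X. norm (\<phi> x) \<le> K)"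
proof -
  obtain s where s: "\<And>n. simple_function M (s n)" "uniform_limit X s \<phi> sequentially" "(\<lambda>n. I (s n)) \<longlonglongrightarrow> A"
    using hasE [OF assms] by metis
  obtain N where N: "\<And>n x. n \<ge> N \<Longrightarrow> x \<in> X \<Longrightarrow> dist (s n x) (\<phi> x) < 1"
    using s(2) unfolding uniform_limit_sequentially_iff by (meson zero_less_one)
  have "bounded (s N ` X)"
    using simple_finite [OF s(1)] by (rule finite_imp_bounded)
  then obtain K where K: "\<And>x. x \<in> X \<Longrightarrow> norm (s N x) \<le> K"
    by (auto simp: bounded_iff)
  have phi: "norm (\<phi> x) \<le> K + 1" if "x \<in> X" for x
    using N [of N x] K [OF that] that norm_triangle_sub [of "\<phi> x" "s N x"]
    by (simp add: dist_norm norm_minus_commute)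
  show ?thesis
  proof (intro exI [of _ "\<lambda>n. s (n + N)"] exI [of _ "K + 2"] conjI allI ballI)
    show "norm (s (n + N) x) \<le> K + 2" if "x \<in> X" for n x
      using N [of "n + N" x] phi [OF that] that norm_triangle_sub [of "s (n + N) x" "\<phi> x"]
      by (simp add: dist_norm)
    show "(\<lambda>n. s (n + N) x) \<longlonglongrightarrow> \<phi> x" if "x \<in> X" for x
      using LIMSEQ_ignore_initial_segment [OF tendsto_uniform_limitI [OF s(2) that]] .
    show "(\<lambda>n. I (s (n + N))) \<longlonglongrightarrow> A"
      using LIMSEQ_ignore_initial_segment [OF s(3)] .
    show "norm (\<phi> x) \<le> K + 2" if "x \<in> X" for x
      using phi [OF that] by simp
  qed (rule s)
qed

lemma has_borel:
  assumes "has \<phi> A"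
  shows "\<phi> \<in> borel_measurable M"
proof -
  obtain s K where s: "\<And>n. simple_function M (s n)" "\<And>x. x \<in> X \<Longrightarrow> (\<lambda>n. s n x) \<longlonglongrightarrow> \<phi> x"
    using has_approx [OF assms] by blast
  show ?thesis
  proof (rule borel_measurable_LIMSEQ_metric)
    show "s n \<in> borel_measurable M" for n
      using s(1) by (rule simple_borel)
    show "(\<lambda>n. s n x) \<longlonglongrightarrow> \<phi> x" if "x \<in> space M" for x
      using s(2) that by simp
  qed
qed

text \<open>Dominated convergence: the continuous \<open>F\<close> is bounded on the closed ball of
  radius \<open>K\<close>, which contains all values of the approximating functions.\<close>

lemma has_integral_limit:
  fixes F :: "quat \<Rightarrow> real"
  assumes "has \<phi> A" and F: "continuous_on UNIV F"
    and s: "\<And>n. simple_function M (s n)" "\<And>n x. x \<in> X \<Longrightarrow> norm (s n x) \<le> K"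
      "\<And>x. x \<in> X \<Longrightarrow> (\<lambda>n. s n x) \<longlonglongrightarrow> \<phi> x"
  shows "(\<lambda>n. \<integral>x. F (s n x) \<partial>\<mu> u) \<longlonglongrightarrow> (\<integral>x. F (\<phi> x) \<partial>\<mu> u)"
proof -
  interpret finite_measure "\<mu> u" by (rule finite_measure_\<mu>)
  have Fb: "F \<in> borel_measurable borel"
    using F by (rule borel_measurable_continuous_onI)
  have "bounded (F ` cball 0 K)"
    by (intro compact_imp_bounded compact_continuous_image continuous_on_subset [OF F]) auto
  then obtain C where "\<And>y. y \<in> cball 0 K \<Longrightarrow> \<bar>F y\<bar> \<le> C"
    by (auto simp: bounded_iff simp del: mem_cball mem_cball_0)
  then have C: "\<bar>F y\<bar> \<le> C" if "norm y \<le> K" for y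
    using that by simp
  show ?thesis
  proof (rule integral_dominated_convergence [where w = "\<lambda>_. C"])
    show "(\<lambda>x. F (\<phi> x)) \<in> borel_measurable (\<mu> u)"
      using measurable_compose [OF has_borel [OF assms(1)] Fb] by simp
    show "(\<lambda>x. F (s n x)) \<in> borel_measurable (\<mu> u)" for n
      using measurable_compose [OF simple_borel [OF s(1)] Fb] by simp
    show "AE x in \<mu> u. (\<lambda>n. F (s n x)) \<longlonglongrightarrow> F (\<phi> x)"
      using F s(3) by (intro AE_I2 isCont_tendsto_compose [of _ F])
        (auto simp: continuous_on_eq_continuous_at)
    show "AE x in \<mu> u. norm (F (s n x)) \<le> C" for n
      using C s(2) by (intro AE_I2) auto
  qed auto
qed

theorem has_norm:
  assumes "has \<phi> A"
  shows "(norm (A u))\<^sup>2 = (\<integral>x. (norm (\<phi> x))\<^sup>2 \<partial>\<mu> u)"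
proof -
  obtain s K where s: "\<And>n. simple_function M (s n)" "\<And>n x. x \<in> X \<Longrightarrow> norm (s n x) \<le> K"
    "\<And>x. x \<in> X \<Longrightarrow> (\<lambda>n. s n x) \<longlonglongrightarrow> \<phi> x" "(\<lambda>n. I (s n)) \<longlonglongrightarrow> A"
    using has_approx [OF assms] by blast
  have "(\<lambda>n. (norm (I (s n) u))\<^sup>2) \<longlonglongrightarrow> (norm (A u))\<^sup>2"
    by (intro tendsto_intros s)
  moreover have "(\<lambda>n. (norm (I (s n) u))\<^sup>2) \<longlonglongrightarrow> (\<integral>x. (norm (\<phi> x))\<^sup>2 \<partial>\<mu> u)"
    unfolding simple_integral_norm [OF s(1)]
    by (rule has_integral_limit [OF assms _ s(1-3)]) (intro continuous_intros)
  ultimately show ?thesis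
    by (rule LIMSEQ_unique)
qed

theorem has_hinner:
  assumes "has \<phi> A"
  shows "\<langle>u,A u\<rangle> = (\<integral>x. qRe (\<phi> x) \<partial>\<mu> u)"
proof -
  obtain s K where s: "\<And>n. simple_function M (s n)" "\<And>n x. x \<in> X \<Longrightarrow> norm (s n x) \<le> K"
    "\<And>x. x \<in> X \<Longrightarrow> (\<lambda>n. s n x) \<longlonglongrightarrow> \<phi> x" "(\<lambda>n. I (s n)) \<longlonglongrightarrow> A"
    using has_approx [OF assms] by blast
  have "(\<lambda>n. \<langle>u,I (s n) u\<rangle>) \<longlonglongrightarrow> \<langle>u,A u\<rangle>"
    by (intro tendsto_intros s)
  moreover have "(\<lambda>n. \<langle>u,I (s n) u\<rangle>) \<longlonglongrightarrow> (\<integral>x. qRe (\<phi> x) \<partial>\<mu> u)"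
    unfolding simple_integral_hinner [OF s(1)]
    by (rule has_integral_limit [OF assms _ s(1-3)])
      (rule linear_continuous_on [OF bounded_linear_qRe])
  ultimately show ?thesis
    by (rule LIMSEQ_unique)
qed

lemma has_integrable:
  fixes F :: "quat \<Rightarrow> real"
  assumes "has \<phi> A" and F: "continuous_on UNIV F"
  shows "integrable (\<mu> u) (\<lambda>x. F (\<phi> x))"
proof -
  interpret finite_measure "\<mu> u" by (rule finite_measure_\<mu>)
  obtain K where K: "\<And>x. x \<in> X \<Longrightarrow> norm (\<phi> x) \<le> K"
    using has_approx [OF assms(1)] by blast
  have "bounded (F ` cball 0 K)"
    by (intro compact_imp_bounded compact_continuous_image continuous_on_subset [OF F]) auto
  then obtain C where "\<And>y. y \<in> cball 0 K \<Longrightarrow> \<bar>F y\<bar> \<le> C"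
    by (auto simp: bounded_iff simp del: mem_cball mem_cball_0)
  then have C: "\<bar>F y\<bar> \<le> C" if "norm y \<le> K" for y
    using that by simp
  have Fb: "F \<in> borel_measurable borel"
    using F by (rule borel_measurable_continuous_onI)
  have "(\<lambda>x. F (\<phi> x)) \<in> borel_measurable (\<mu> u)"
    using measurable_compose [OF has_borel [OF assms(1)] Fb] by simp
  then show ?thesis
    using C K by (intro integrable_const_bound [of _ C] AE_I2) auto
qed

text \<open>The difference has integrand 0 and vanishes by the isometry \<open>has_norm\<close>.
  Pointwise identities of integrands become operator identities in this way.\<close>

lemma has_unique:
  assumes "has \<phi> A" "has \<phi> B"
  shows "A = B"
proof (rule blinfun_eqI)
  fix u
  have "has (\<lambda>x. 0) (A - B)"
    using has_diff [OF assms] by simp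
  from has_norm [OF this, of u] show "A u = B u"
    by (simp add: blinfun.bilinear_simps)
qed

text \<open>The four coordinates of \<open>\<phi>\<close> are rounded down to multiples of
  \<open>1 / real (Suc n)\<close>. As \<open>\<phi>\<close> is bounded, finitely many values remain,
  and the error is at most \<open>4 / real (Suc n)\<close>. By the isometry for simple functions the
  integrals are then Cauchy in operator norm.\<close>

theorem has_exists:
  assumes \<phi>: "\<phi> \<in> borel_measurable M" and K: "\<And>x. x \<in> X \<Longrightarrow> norm (\<phi> x) \<le> K"
  shows "\<exists>A. has \<phi> A"
proof -
  define r where "r n t = real_of_int \<lfloor>real (Suc n) * t\<rfloor> / real (Suc n)" for n t
  have r1: "\<bar>r n t - t\<bar> \<le> 1 / real (Suc n)" for n t
  proof -
    have "\<bar>real_of_int \<lfloor>real (Suc n) * t\<rfloor> - real (Suc n) * t\<bar> \<le> 1" by linarith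
    then have "\<bar>real_of_int \<lfloor>real (Suc n) * t\<rfloor> - real (Suc n) * t\<bar> / real (Suc n) \<le> 1 / real (Suc n)"
      by (intro divide_right_mono) auto
    moreover have "r n t - t = (real_of_int \<lfloor>real (Suc n) * t\<rfloor> - real (Suc n) * t) / real (Suc n)"
      by (simp add: r_def field_simps)
    ultimately show ?thesis by simp
  qed
  have rfin: "finite (r n ` {-K..K})" for n
  proof -
    have "r n ` {-K..K} \<subseteq> (\<lambda>k. real_of_int k / real (Suc n)) ` {\<lfloor>real (Suc n) * - K\<rfloor>..\<lfloor>real (Suc n) * K\<rfloor>}"
    proof
      fix y assume "y \<in> r n ` {-K..K}"
      then obtain t where t: "t \<in> {-K..K}" "y = r n t" by blast
      have "real (Suc n) * - K \<le> real (Suc n) * t" "real (Suc n) * t \<le> real (Suc n) * K"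
        by (rule mult_left_mono; use t(1) in simp)+
      then have "\<lfloor>real (Suc n) * t\<rfloor> \<in> {\<lfloor>real (Suc n) * - K\<rfloor>..\<lfloor>real (Suc n) * K\<rfloor>}"
        by (auto intro: floor_mono simp del: mult_minus_right of_nat_Suc)
      then show "y \<in> (\<lambda>k. real_of_int k / real (Suc n)) ` {\<lfloor>real (Suc n) * - K\<rfloor>..\<lfloor>real (Suc n) * K\<rfloor>}"
        unfolding t(2) r_def by (rule imageI)
    qed
    then show ?thesis by (rule finite_subset) simp
  qed
  define s where "s n x = (\<Sum>b\<in>Basis. r n (\<phi> x \<bullet> b) *\<^sub>R b)" for n and x :: quat
  have sim: "simple_function M (s n)" for n
  proof (rule simple_function_borel_measurable)
    show "s n \<in> borel_measurable M"
      unfolding s_def [abs_def] r_def using \<phi> by measurable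
    have "s n ` X \<subseteq> (\<lambda>g. \<Sum>b\<in>Basis. g b *\<^sub>R b) ` (\<Pi>\<^sub>E b\<in>Basis. r n ` {-K..K})"
    proof
      fix y assume "y \<in> s n ` X"
      then obtain x where x: "x \<in> X" "y = s n x" by blast
      have "\<phi> x \<bullet> b \<in> {-K..K}" if "b \<in> Basis" for b
        using Basis_le_norm [OF that, of "\<phi> x"] K [OF x(1)] by auto
      then have "restrict (\<lambda>b. r n (\<phi> x \<bullet> b)) Basis \<in> (\<Pi>\<^sub>E b\<in>Basis. r n ` {-K..K})" by auto
      moreover have "y = (\<Sum>b\<in>Basis. restrict (\<lambda>b. r n (\<phi> x \<bullet> b)) Basis b *\<^sub>R b)"
        by (simp add: x s_def)
      ultimately show "y \<in> (\<lambda>g. \<Sum>b\<in>Basis. g b *\<^sub>R b) ` (\<Pi>\<^sub>E b\<in>Basis. r n ` {-K..K})" by blast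
    qed
    moreover have "finite ((\<lambda>g. \<Sum>b\<in>(Basis :: quat set). g b *\<^sub>R b) ` (\<Pi>\<^sub>E b\<in>Basis. r n ` {-K..K}))"
      by (intro finite_imageI finite_PiE finite_Basis rfin)
    ultimately show "finite (s n ` space M)"
      unfolding space_M by (rule finite_subset)
  qed
  have s1: "norm (s n x - \<phi> x) \<le> 4 / real (Suc n)" for n x
  proof -
    have "s n x - \<phi> x = (\<Sum>b\<in>Basis. (r n (\<phi> x \<bullet> b) - \<phi> x \<bullet> b) *\<^sub>R b)"
      by (simp add: s_def scaleR_diff_left sum_subtractf euclidean_representation)
    also have "norm \<dots> \<le> (\<Sum>b\<in>(Basis :: quat set). \<bar>r n (\<phi> x \<bullet> b) - \<phi> x \<bullet> b\<bar>)"
      by (rule order_trans [OF norm_sum]) simp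
    also have "\<dots> \<le> of_nat (card (Basis :: quat set)) * (1 / real (Suc n))"
      by (rule sum_bounded_above) (rule r1)
    also have "\<dots> \<le> 4 * (1 / real (Suc n))"
      by (intro mult_right_mono) (auto simp: Basis_quat_def card_insert_if)
    finally show ?thesis by simp
  qed
  have lim0: "(\<lambda>n. 4 / real (Suc n)) \<longlonglongrightarrow> 0"
    using tendsto_mult_left [OF LIMSEQ_Suc [OF lim_1_over_n], of 4] by simp
  have ul: "uniform_limit X s \<phi> sequentially"
  proof (rule uniform_limitI)
    fix e :: real assume "e > 0"
    then have "\<forall>\<^sub>F n in sequentially. 4 / real (Suc n) < e"
      using lim0 by (rule order_tendstoD(2) [rotated])
    then show "\<forall>\<^sub>F n in sequentially. \<forall>x\<in>X. dist (s n x) (\<phi> x) < e"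
      by eventually_elim (use s1 in \<open>auto simp: dist_norm intro: le_less_trans\<close>)
  qed
  have "Cauchy (\<lambda>n. I (s n))"
  proof (rule metric_CauchyI)
    fix e :: real assume "e > 0"
    then have "\<forall>\<^sub>F n in sequentially. 4 / real (Suc n) < e / 4"
      using lim0 by (intro order_tendstoD(2) [of _ 0]) auto
    then obtain N where N: "\<And>n. n \<ge> N \<Longrightarrow> 4 / real (Suc n) < e / 4"
      by (auto simp: eventually_sequentially)
    have "dist (I (s m)) (I (s n)) < e" if mn: "m \<ge> N" "n \<ge> N" for m n
    proof -
      have st: "norm (s m x - s n x) \<le> e / 2" for x
        using N [OF mn(1)] N [OF mn(2)] s1 [of m x] s1 [of n x]
          norm_triangle_ineq4 [of "s m x - \<phi> x" "s n x - \<phi> x"] by simp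
      have sd: "simple_function M (\<lambda>x. s m x - s n x)"
        using sim by (intro simple_function_diff)
      have "I (\<lambda>x. (s m x - s n x) + s n x) = I (\<lambda>x. s m x - s n x) + I (s n)"
        by (rule simple_integral_add [OF sd sim])
      then have eq: "I (s m) - I (s n) = I (\<lambda>x. s m x - s n x)" by simp
      have "norm (I (s m) - I (s n)) \<le> e / 2"
      proof (rule norm_blinfun_bound)
        fix u
        interpret finite_measure "\<mu> u" by (rule finite_measure_\<mu>)
        have "(norm ((I (s m) - I (s n)) u))\<^sup>2 = (\<integral>x. (norm (s m x - s n x))\<^sup>2 \<partial>\<mu> u)"
          unfolding eq by (rule simple_integral_norm [OF sd])
        also have "\<dots> \<le> (\<integral>x. (e / 2)\<^sup>2 \<partial>\<mu> u)"
        proof (rule integral_mono)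
          show "integrable (\<mu> u) (\<lambda>x. (norm (s m x - s n x))\<^sup>2)"
            using st simple_borel [OF sd]
            by (intro integrable_const_bound [of _ "(e / 2)\<^sup>2"] AE_I2) (auto intro!: power_mono)
        qed (auto intro!: power_mono st)
        also have "\<dots> = (e / 2 * norm u)\<^sup>2"
          by (simp add: measure_\<mu> power_mult_distrib power_divide)
        finally show "norm ((I (s m) - I (s n)) u) \<le> e / 2 * norm u"
          by (rule power2_le_imp_le) (use \<open>e > 0\<close> in simp)
      qed (use \<open>e > 0\<close> in simp)
      then show ?thesis
        using \<open>e > 0\<close> by (simp add: dist_norm)
    qed
    then show "\<exists>N. \<forall>m\<ge>N. \<forall>n\<ge>N. dist (I (s m)) (I (s n)) < e" by blast
  qed
  then obtain A where "(\<lambda>n. I (s n)) \<longlonglongrightarrow> A"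
    using Cauchy_convergent_iff convergent_def by blast
  then show ?thesis
    using hasI [OF sim ul] by blast
qed

end

section \<open>The spectrum of an integral of the identity\<close>

lemma qabs_eqI:
  assumes S: "S \<in> qbounded_ops" and A: "A \<in> qbounded_ops" "pos_op A" "A o\<^sub>L A = radj S o\<^sub>L S"
  shows "qabs S = A"
  unfolding qabs_def qadj_eq_radj [OF S]
proof (rule the_equality)
  show "A \<in> qbounded_ops \<and> qpositive A \<and> A o\<^sub>L A = radj S o\<^sub>L S"
    using A pos_op_qpositive by blast
  fix B assume B: "B \<in> qbounded_ops \<and> qpositive B \<and> B o\<^sub>L B = radj S o\<^sub>L S"
  have "0 \<le> \<langle>u,B u\<rangle>" for u
    using B unfolding qpositive_def hinner_def by (metis atLeast_iff imageE quat_sel_of_real(1))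
  moreover have "selfadj B"
    using B by (intro qpositive_selfadj) auto
  ultimately have "pos_op B"
    by (simp add: pos_op_def)
  then show "B = A"
    using pos_op_sqrt_unique A B by metis
qed

lemma slice_mult_commute:
  assumes "\<iota> \<in> imag_units" "x \<in> slice \<iota>" "y \<in> slice \<iota>"
  shows "x * y = y * x"
proof -
  obtain a b c d where x: "x = of_real a + \<iota> * of_real b" and y: "y = of_real c + \<iota> * of_real d"
    using assms slice_eq by metis
  show ?thesis
    unfolding x y by (simp add: of_real_def ring_distribs algebra_simps)
qed

lemma imag_unit_in_slice: "\<iota> \<in> slice \<iota>"
  unfolding slice_def by (rule CollectI, intro exI [of _ 0] exI [of _ 1]) simp

lemma qcnj_slice:
  assumes "\<iota> \<in> imag_units"
  shows "qcnj (of_real a + \<iota> * of_real b) = of_real a + \<iota> * of_real (- b)"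
  using imag_unit_simps [OF assms] by (simp add: qcnj_add qcnj_mult) (simp add: of_real_def)

lemma qcnj_in_slice:
  assumes "\<iota> \<in> imag_units" "x \<in> slice \<iota>"
  shows "qcnj x \<in> slice \<iota>"
proof -
  have "qcnj x = of_real (qRe x) + \<iota> * of_real (- (\<iota> \<bullet> x))"
    using slice_eq [OF assms] qcnj_slice [OF assms(1)] by metis
  then show ?thesis unfolding slice_def by blast
qed

lemma slice_diff_qcnj:
  assumes "\<iota> \<in> imag_units" "x \<in> slice \<iota>"
  shows "x - qcnj x = \<iota> * of_real (2 * (\<iota> \<bullet> x))"
proof -
  define a b where "a = qRe x" and "b = \<iota> \<bullet> x"
  have x: "x = of_real a + \<iota> * of_real b"
    using slice_eq [OF assms] by (simp add: a_def b_def)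
  have "of_real a + \<iota> * of_real b - qcnj (of_real a + \<iota> * of_real b) = \<iota> * of_real (2 * b)"
    unfolding qcnj_slice [OF assms(1)] by (simp add: of_real_def flip: scaleR_add_left del: of_real_mult)
  then show ?thesis using x b_def by metis
qed

lemma slice_anticommute:
  assumes \<iota>: "\<iota> \<in> imag_units" and x: "x \<in> slice \<iota>" and j: "\<iota> * j = - (j * \<iota>)"
  shows "j * x = qcnj x * j"
proof -
  define a b where "a = qRe x" and "b = \<iota> \<bullet> x"
  have x': "x = of_real a + \<iota> * of_real b"
    using slice_eq [OF \<iota> x] by (simp add: a_def b_def)
  have "j * (of_real a + \<iota> * of_real b) = (of_real a + \<iota> * of_real (- b)) * j"
    using j by (simp add: of_real_def ring_distribs)
  then show ?thesis
    using x' qcnj_slice [OF \<iota>] by metis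
qed

text \<open>Both imaginary coordinates are nonnegative, so reflecting one of them can only increase
  the distance. This controls the factor of \<open>qDelta q T\<close> that belongs to the conjugate
  point.\<close>

lemma norm_diff_qcnj_ge:
  assumes \<iota>: "\<iota> \<in> imag_units" and x: "x \<in> half_slice \<iota>" and q: "q \<in> half_slice \<iota>"
  shows "norm (x - q) \<le> norm (x - qcnj q)"
proof -
  define a b c d where "a = qRe x" and "b = \<iota> \<bullet> x" and "c = qRe q" and "d = \<iota> \<bullet> q"
  have x': "x = of_real a + \<iota> * of_real b" "0 \<le> b" and q': "q = of_real c + \<iota> * of_real d" "0 \<le> d"
    using half_slice_iff [OF \<iota>] x q unfolding a_def b_def c_def d_def by blast+
  have e: "x - q = of_real (a - c) + \<iota> * of_real (b - d)"
    unfolding x' q' by (simp add: ring_distribs)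
  have e': "x - qcnj q = of_real (a - c) + \<iota> * of_real (b + d)"
    unfolding x' q' qcnj_slice [OF \<iota>] by (simp add: ring_distribs)
  have "(b - d)\<^sup>2 \<le> (b + d)\<^sup>2"
    using x' q' by (simp add: power2_eq_square algebra_simps)
  then have "(norm (x - q))\<^sup>2 \<le> (norm (x - qcnj q))\<^sup>2"
    unfolding e e' norm_slice_sq [OF \<iota>] by simp
  then show ?thesis
    by (rule power2_le_imp_le) simp
qed

lemma qDelta_radj:
  "radj (qDelta q T) = qDelta q (radj T)"
  by (simp add: qDelta_def radj_add radj_diff radj_compose radj_scaleR)

text \<open>The orthogonal complement of the range is the kernel of the adjoint.\<close>

lemma dense_range_radj:
  fixes S :: "'h::quat_hilbert \<Rightarrow>\<^sub>L 'h"
  assumes "qker (radj S) = {0}"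
  shows "dense_range S"
  unfolding dense_range_def
proof (rule closed_subspace_dense)
  show "subspace (closure (range (blinfun_apply S)))"
    by (intro subspace_closure linear_subspace_image subspace_UNIV)
      (rule bounded_linear.linear [OF blinfun.bounded_linear_right])
  fix u assume u: "\<And>v. v \<in> closure (range (blinfun_apply S)) \<Longrightarrow> \<langle>u,v\<rangle> = 0"
  have "\<langle>radj S u,v\<rangle> = 0" for v
    using u [of "S v"] closure_subset [of "range (blinfun_apply S)"] by (auto simp: radj)
  then have "radj S u = 0"
    by (intro hinner_eqI) simp
  then show "u = 0"
    using assms by (auto simp: qker_def)
qed simp

lemma bounded_inverse_iff:
  assumes "qker S = {0}"
  shows "bounded_inverse S \<longleftrightarrow> (\<exists>K. \<forall>u. norm u \<le> K * norm (S u))"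
proof -
  have "u = v" if "S u = S v" for u v
  proof -
    have "u - v \<in> qker S" using that by (simp add: qker_def blinfun.bilinear_simps)
    then show ?thesis using assms by simp
  qed
  then have "inj (blinfun_apply S)" by (rule injI)
  then show ?thesis
    by (simp add: bounded_inverse_def)
qed

section \<open>The support and the identity cut off outside it\<close>

context iq_measure
begin

abbreviation "S \<equiv> qsupp \<iota> P"

text \<open>The integrand that \<open>has_iq_integral\<close> prescribes for the identity. The
  default value 0 lies in the half-slice, so \<open>\<zeta>\<close> maps into the half-slice off the
  support as well.\<close>

definition "\<zeta> x = (if x \<in> S then x else 0)"

lemma S_subset: "S \<subseteq> X"
  by (auto simp: qsupp_def)

lemma zeta_X: "\<zeta> x \<in> X"
  using S_subset half_sliceI [OF unit, of 0 0] by (auto simp: \<zeta>_def)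

lemma zeta_slice: "\<zeta> x \<in> slice \<iota>"
  using zeta_X half_slice_subset by blast

lemma openin_sets: "openin (top_of_set X) U \<Longrightarrow> U \<in> sets M"
  by (auto simp: openin_open sets_restrict_space)

lemma closed_sets: "closed C \<Longrightarrow> C \<subseteq> X \<Longrightarrow> C \<in> sets M"
  by (auto simp: sets_restrict_space intro!: image_eqI [of _ _ C])

lemma S_sets: "S \<in> sets M"
proof -
  have "openin (top_of_set X) (\<Union>{U. openin (top_of_set X) U \<and> P U = 0})"
    by (rule openin_Union) auto
  then have "X - \<Union>{U. openin (top_of_set X) U \<and> P U = 0} \<in> sets M"
    using openin_sets sets.compl_sets [of _ M] by simp
  then show ?thesis by (simp add: qsupp_def)
qed

text \<open>The null open sets may be uncountably many, but by the Lindelof property countably many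
  of them have the same union.\<close>

lemma P_compl_S: "P (X - S) = 0"
proof -
  let ?F = "{U. openin (top_of_set X) U \<and> P U = 0}"
  obtain F' where F': "F' \<subseteq> ?F" "countable F'" "\<Union>F' = \<Union>?F"
    using Lindelof_openin [of ?F X] by blast
  have U: "\<Union>?F \<subseteq> X"
    using openin_subset by fastforce
  then have eq: "X - S = \<Union>?F" by (auto simp: qsupp_def)
  have "P (X - S) u = 0" for u
  proof -
    have "(\<Union>U\<in>F'. U) \<in> null_sets (\<mu> u)"
    proof (rule null_sets_UN' [OF F'(2)])
      fix U assume "U \<in> F'"
      then have "U \<in> sets M" "P U = 0" using F'(1) openin_sets by auto
      then show "U \<in> null_sets (\<mu> u)"
        by (simp add: null_sets_def emeasure_pvm_measure [OF pvm])
    qed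
    then have "emeasure (\<mu> u) (X - S) = 0"
      unfolding eq using F'(3) by (simp add: null_sets_def)
    moreover have XS: "X - S \<in> sets M" using S_sets sets.compl_sets [of S M] by simp
    ultimately show ?thesis
      by (simp add: emeasure_pvm_measure [OF pvm XS] pvm_hinner(1) [OF pvm XS])
  qed
  then show ?thesis by (intro blinfun_eqI) simp
qed

lemma AE_zeta: "AE x in \<mu> u. \<zeta> x = x"
proof -
  have e: "{x \<in> space M. \<not> x \<in> S} = X - S" by auto
  have "X - S \<in> sets M" using S_sets sets.compl_sets [of S M] by simp
  then have "AE x in \<mu> u. x \<in> S"
    using e P_compl_S by (subst AE_pvm_measure_iff [OF pvm]) auto
  then show ?thesis by eventually_elim (simp add: \<zeta>_def)
qed

lemma zeta_measurable: "\<zeta> \<in> borel_measurable M"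
  unfolding \<zeta>_def [abs_def]
proof (rule measurable_If_set)
  show "(\<lambda>x. x) \<in> borel_measurable M"
    by (rule measurable_restrict_space1) simp
  show "S \<inter> space M \<in> sets M"
    using S_sets by (simp add: Int_absorb2 S_subset)
qed simp

end

section \<open>The operator, its adjoint and the absolute value of its skew part\<close>

locale iq_operator = iq_measure +
  fixes T
  assumes hasT: "has_iq_integral \<iota> P L (\<lambda>x. x) T"
begin

lemma has_zeta: "has \<zeta> T"
  using hasT unfolding has_iq_integral_def \<zeta>_def [abs_def] .

lemma T_qbounded: "T \<in> qbounded_ops"
  using has_zeta by (rule has_qbounded)

lemma has_diff_adj: "has (\<lambda>x. \<iota> * of_real (2 * (\<iota> \<bullet> \<zeta> x))) (T - radj T)"
  using has_diff [OF has_zeta has_cnj [OF has_zeta]] slice_diff_qcnj [OF unit zeta_slice] by simp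

text \<open>\<open>T - radj T\<close> has integrand \<open>\<iota>\<close> times the real function
  \<open>2 * (\<iota> \<bullet> \<zeta> x)\<close>; multiplying by \<open>- \<iota>\<close> on the
  left leaves this nonnegative function. \<open>D\<close> is the absolute value of
  \<open>T - radj T\<close> (\<open>qabs_diff_adj\<close>).\<close>

definition "D = - (L \<iota> o\<^sub>L (T - radj T))"

lemma has_D: "has (\<lambda>x. of_real (2 * (\<iota> \<bullet> \<zeta> x))) D"
proof -
  have "L (- \<iota>) o\<^sub>L (T - radj T) = D"
    by (intro blinfun_eqI) (simp add: D_def left_mult_minus [OF L] blinfun.bilinear_simps)
  then show ?thesis
    using has_mult_left [OF has_diff_adj, of "- \<iota>"] imag_unit_simps [OF unit] by simp
qed

lemma D_qbounded: "D \<in> qbounded_ops"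
  using has_D by (rule has_qbounded)

lemma zeta_inner_nonneg: "0 \<le> \<iota> \<bullet> \<zeta> x"
  using half_slice_iff [OF unit] zeta_X by blast

lemma D_pos: "pos_op D"
proof -
  have "radj D = D"
    using has_unique [OF has_cnj [OF has_D]] has_D by (simp del: of_real_mult)
  moreover have "0 \<le> \<langle>u,D u\<rangle>" for u
    unfolding has_hinner [OF has_D] using zeta_inner_nonneg by (intro integral_nonneg_AE AE_I2) simp
  ultimately show ?thesis
    by (simp add: pos_op_def selfadj_radj)
qed

lemma L_unit_sq: "L \<iota> (L \<iota> u) = - u"
proof -
  have "L (\<iota> * \<iota>) = - id_blinfun"
    using imag_unit_simps(3) [OF unit] left_mult_minus [OF L] left_mult_1 [OF L] by simp
  then have "blinfun_apply (L (\<iota> * \<iota>)) u = - u"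
    by (simp add: blinfun.bilinear_simps)
  then show ?thesis by (simp add: left_mult_mult [OF L])
qed

lemma diff_adj_eq: "T - radj T = L \<iota> o\<^sub>L D"
  by (intro blinfun_eqI) (simp add: D_def blinfun.bilinear_simps L_unit_sq)

lemma D_sq: "D o\<^sub>L D = radj (T - radj T) o\<^sub>L (T - radj T)"
proof (rule blinfun_eqI)
  fix u
  have "radj (T - radj T) = D o\<^sub>L - L \<iota>"
    unfolding diff_adj_eq radj_compose left_mult_adj [OF L]
    using D_pos by (simp add: pos_op_def selfadj_radj imag_unit_simps [OF unit] left_mult_minus [OF L])
  then show "(D o\<^sub>L D) u = (radj (T - radj T) o\<^sub>L (T - radj T)) u"
    unfolding diff_adj_eq by (simp add: blinfun.bilinear_simps L_unit_sq)
qed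

lemma diff_adj_qbounded: "T - radj T \<in> qbounded_ops"
  using T_qbounded radj_qbounded by (intro qbounded_ops_simps)

theorem qabs_diff_adj: "qabs (T - radj T) = D"
  using qabs_eqI [OF diff_adj_qbounded D_qbounded D_pos D_sq] .

theorem has_qabs: "has_iq_integral \<iota> P L (\<lambda>x. of_real (2 * slice_im \<iota> x)) D"
  unfolding has_iq_integral_def
proof (rule has_cong [OF _ has_D])
  fix x assume "x \<in> X"
  then show "of_real (2 * (\<iota> \<bullet> \<zeta> x)) = (if x \<in> S then of_real (2 * slice_im \<iota> x) else 0 :: quat)"
    using slice_im_eq [OF unit, of x] half_slice_subset [of \<iota>] by (auto simp: \<zeta>_def subset_iff)
qed

text \<open>Scalars of one slice commute, so multiplying the integrand by \<open>q\<close> on the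
  left or on the right gives the same function, and integrals are unique.
  \<open>L_anticommutes\<close> makes the same comparison with
  \<open>j * x = qcnj x * j\<close>.\<close>

lemma L_commutes:
  assumes "q \<in> slice \<iota>"
  shows "L q o\<^sub>L T = T o\<^sub>L L q" "L q o\<^sub>L radj T = radj T o\<^sub>L L q"
proof -
  have "q * \<zeta> x = \<zeta> x * q" for x
    using slice_mult_commute [OF unit assms zeta_slice] .
  then show "L q o\<^sub>L T = T o\<^sub>L L q"
    using has_unique has_mult_left [OF has_zeta, of q] has_mult_right [OF has_zeta, of q] by simp
  have "q * qcnj (\<zeta> x) = qcnj (\<zeta> x) * q" for x
    using slice_mult_commute [OF unit assms qcnj_in_slice [OF unit zeta_slice]] .
  then show "L q o\<^sub>L radj T = radj T o\<^sub>L L q"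
    using has_unique has_mult_left [OF has_cnj [OF has_zeta], of q]
      has_mult_right [OF has_cnj [OF has_zeta], of q] by simp
qed

lemma L_anticommutes:
  assumes "\<iota> * j = - (j * \<iota>)"
  shows "L j o\<^sub>L T = radj T o\<^sub>L L j"
proof -
  have "j * \<zeta> x = qcnj (\<zeta> x) * j" for x
    using slice_anticommute [OF unit zeta_slice assms] .
  then show ?thesis
    using has_unique has_mult_left [OF has_zeta, of j] has_mult_right [OF has_cnj [OF has_zeta], of j]
    by simp
qed

lemma P_commutes_T: "E \<in> sets M \<Longrightarrow> commutes (P E) T"
  using has_zeta by (rule has_commutes)

lemma P_commutes_radj_T: "E \<in> sets M \<Longrightarrow> commutes (P E) (radj T)"
  using has_cnj [OF has_zeta] by (rule has_commutes)

lemma qRe_measurable: "qRe \<in> borel_measurable M"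
  by (intro measurable_restrict_space1 borel_measurable_continuous_onI
          linear_continuous_on bounded_linear_qRe)

lemma inner_measurable: "(\<lambda>x. \<iota> \<bullet> x) \<in> borel_measurable M"
  by (intro measurable_restrict_space1) measurable

text \<open>The scalar measures are carried by the support, where \<open>\<zeta>\<close> is the
  identity. As \<open>\<zeta>\<close> is bounded, \<open>F\<close> is integrable although it may be
  unbounded on the half-slice.\<close>

lemma integral_zeta_cong:
  fixes F :: "quat \<Rightarrow> real"
  assumes F: "continuous_on UNIV F"
  shows "integrable (\<mu> u) F" "(\<integral>x. F (\<zeta> x) \<partial>\<mu> u) = (\<integral>x. F x \<partial>\<mu> u)"
proof -
  have ae: "AE x in \<mu> u. F (\<zeta> x) = F x"
    using AE_zeta by eventually_elim simp
  have Fm: "F \<in> borel_measurable M"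
    using F by (intro measurable_restrict_space1 borel_measurable_continuous_onI)
  have Fm: "F \<in> borel_measurable (\<mu> u)"
    using Fm by simp
  have i: "integrable (\<mu> u) (\<lambda>x. F (\<zeta> x))"
    by (rule has_integrable [OF has_zeta F])
  show "integrable (\<mu> u) F"
    by (rule integrable_cong_AE_imp [OF i Fm]) (use ae in \<open>auto elim: eventually_mono\<close>)
  show "(\<integral>x. F (\<zeta> x) \<partial>\<mu> u) = (\<integral>x. F x \<partial>\<mu> u)"
    by (rule integral_cong_AE [OF borel_measurable_integrable [OF i] Fm ae])
qed

lemma hinner_T: "\<langle>u,T u\<rangle> = (\<integral>x. qRe x \<partial>\<mu> u)"
  unfolding has_hinner [OF has_zeta]
  by (rule integral_zeta_cong) (rule linear_continuous_on [OF bounded_linear_qRe])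

lemma hinner_D: "\<langle>u,D u\<rangle> = 2 * (\<integral>x. \<iota> \<bullet> x \<partial>\<mu> u)"
proof -
  have "(\<integral>x. \<iota> \<bullet> \<zeta> x \<partial>\<mu> u) = (\<integral>x. \<iota> \<bullet> x \<partial>\<mu> u)"
    by (rule integral_zeta_cong) (intro continuous_intros)
  then show ?thesis
    unfolding has_hinner [OF has_D] by (simp del: of_real_mult)
qed

section \<open>The factors of \<open>qDelta q T\<close> and the point spectrum\<close>

definition "G q = T - L q"

lemma has_G: "has (\<lambda>x. \<zeta> x - q) (G q)"
  unfolding G_def by (intro has_diff has_zeta has_const)

lemma G_norm: "(norm (G q u))\<^sup>2 = (\<integral>x. (norm (x - q))\<^sup>2 \<partial>\<mu> u)"
  unfolding has_norm [OF has_G]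
  by (rule integral_zeta_cong(2) [where F = "\<lambda>x. (norm (x - q))\<^sup>2"]) (intro continuous_intros)

lemma G_integrable: "integrable (\<mu> u) (\<lambda>x. (norm (x - q))\<^sup>2)"
  by (rule integral_zeta_cong(1)) (intro continuous_intros)

lemma G_norm_radj: "norm (radj (G q) u) = norm (G q u)"
proof -
  have "(norm (radj (G q) u))\<^sup>2 = (norm (G q u))\<^sup>2"
    unfolding has_norm [OF has_G] has_norm [OF has_cnj [OF has_G]] by simp
  then show ?thesis by simp
qed

lemma G_norm_le:
  assumes "q \<in> X"
  shows "norm (G q u) \<le> norm (G (qcnj q) u)"
proof -
  have "(norm (G q u))\<^sup>2 \<le> (norm (G (qcnj q) u))\<^sup>2"
    unfolding G_norm
    by (rule integral_mono [OF G_integrable G_integrable])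
      (use norm_diff_qcnj_ge [OF unit _ assms] in \<open>auto intro!: power_mono\<close>)
  then show ?thesis
    by (rule power2_le_imp_le) simp
qed

lemma qDelta_eq:
  assumes "q \<in> slice \<iota>"
  shows "qDelta q T u = G q (G (qcnj q) u)" "qDelta q T u = G (qcnj q) (G q u)"
proof -
  have c1: "L q (T v) = T (L q v)" for v
    using L_commutes(1) [OF assms] by (metis blinfun_apply_blinfun_compose)
  have c2: "L (qcnj q) (T v) = T (L (qcnj q) v)" for v
    using L_commutes(1) [OF qcnj_in_slice [OF unit assms]] by (metis blinfun_apply_blinfun_compose)
  have "q + qcnj q = of_real (2 * qRe q)"
    by (simp add: quat_eq_iff del: of_real_mult)
  then have "L q + L (qcnj q) = (2 * qRe q) *\<^sub>R id_blinfun"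
    by (metis left_mult_add [OF L] left_mult_of_real [OF L])
  then have "(L q + L (qcnj q)) v = ((2 * qRe q) *\<^sub>R id_blinfun) v" for v
    by simp
  then have s: "L q v + L (qcnj q) v = (2 * qRe q) *\<^sub>R v" for v
    by (simp add: blinfun.bilinear_simps)
  have "L (q * qcnj q) = (norm q)\<^sup>2 *\<^sub>R id_blinfun" "L (qcnj q * q) = (norm q)\<^sup>2 *\<^sub>R id_blinfun"
    unfolding qcnj_mult_self left_mult_of_real [OF L] by simp_all
  then have "(L q o\<^sub>L L (qcnj q)) v = ((norm q)\<^sup>2 *\<^sub>R id_blinfun) v"
    "(L (qcnj q) o\<^sub>L L q) v = ((norm q)\<^sup>2 *\<^sub>R id_blinfun) v" for v
    by (simp_all add: left_mult_mult [OF L])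
  then have p: "L q (L (qcnj q) v) = (norm q)\<^sup>2 *\<^sub>R v" "L (qcnj q) (L q v) = (norm q)\<^sup>2 *\<^sub>R v" for v
    by (simp_all add: blinfun.bilinear_simps)
  have "T (L q u) + T (L (qcnj q) u) = (2 * qRe q) *\<^sub>R T u"
    using arg_cong [OF s [of u], of "blinfun_apply T"] by (simp add: blinfun.bilinear_simps)
  then have t: "(2 * qRe q) *\<^sub>R T u = T (L q u) + T (L (qcnj q) u)" by simp
  have d: "qDelta q T u = T (T u) - (2 * qRe q) *\<^sub>R T u + (norm q)\<^sup>2 *\<^sub>R u"
    by (simp add: qDelta_def blinfun.bilinear_simps)
  show "qDelta q T u = G q (G (qcnj q) u)" "qDelta q T u = G (qcnj q) (G q u)"
    unfolding d t by (simp_all add: G_def blinfun.bilinear_simps c1 c2 p)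
qed

lemma qDelta_rep: "qDelta q T = qDelta (half_slice_rep \<iota> q) T"
  using half_slice_rep [OF unit] by (simp add: qDelta_def)

text \<open>The factor for the conjugate point is the larger one in norm, so lower bounds for
  \<open>qDelta q T\<close> reduce to lower bounds for \<open>G q\<close>.\<close>

lemma qDelta_norm_ge:
  assumes "q \<in> X"
  shows "norm (G q (G q u)) \<le> norm (qDelta q T u)"
  using qDelta_eq(2) [of q u] assms half_slice_subset G_norm_le [OF assms, of "G q u"] by force

text \<open>\<open>G q\<close> and its adjoint have equal norms at every vector, so
  \<open>radj (G q) (G q u) = 0\<close>, and pairing this with \<open>u\<close> gives
  \<open>(norm (G q u))\<^sup>2 = 0\<close>.\<close>

lemma G_twice_eq_0:
  assumes "G q (G q u) = 0"
  shows "G q u = 0"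
proof -
  have "radj (G q) (G q u) = 0"
    using G_norm_radj [of q "G q u"] assms by simp
  then have "\<langle>u,radj (G q) (G q u)\<rangle> = 0" by simp
  then show ?thesis by (simp add: radj' hinner_self)
qed

lemma qker_qDelta:
  assumes "q \<in> X"
  shows "qDelta q T u = 0 \<longleftrightarrow> G q u = 0"
proof
  assume "qDelta q T u = 0"
  then have "G q (G q u) = 0"
    using qDelta_norm_ge [OF assms, of u] by simp
  then show "G q u = 0" by (rule G_twice_eq_0)
next
  assume "G q u = 0"
  then show "qDelta q T u = 0"
    using qDelta_eq(2) [of q u] assms half_slice_subset by force
qed

lemma singleton_sets: "q \<in> X \<Longrightarrow> {q} \<in> sets M"
  by (intro closed_sets) auto

text \<open>By \<open>G_norm\<close> the integral of \<open>(norm (x - q))\<^sup>2\<close> vanishes,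
  which means that the scalar measure of \<open>u\<close> is carried by the single point
  \<open>q\<close>.\<close>

lemma G_eq_0_iff:
  assumes q: "q \<in> X"
  shows "G q u = 0 \<longleftrightarrow> P {q} u = u"
proof -
  have "G q u = 0 \<longleftrightarrow> (\<integral>x. (norm (x - q))\<^sup>2 \<partial>\<mu> u) = 0"
    using G_norm [of q u] by auto
  also have "\<dots> \<longleftrightarrow> (AE x in \<mu> u. (norm (x - q))\<^sup>2 = 0)"
    by (rule integral_nonneg_eq_0_iff_AE [OF G_integrable]) simp
  also have "\<dots> \<longleftrightarrow> (AE x in \<mu> u. x = q)" by simp
  also have "\<dots> \<longleftrightarrow> P (X - {q}) u = 0"
  proof -
    have "{x \<in> space M. \<not> x = q} = X - {q}" by auto
    then show ?thesis
      using singleton_sets [OF q] sets.compl_sets [of "{q}" M] by (subst AE_pvm_measure_iff [OF pvm]) auto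
  qed
  also have "\<dots> \<longleftrightarrow> P {q} u = u"
    using pvm_compl [OF pvm singleton_sets [OF q]] by (auto simp: blinfun.bilinear_simps)
  finally show ?thesis .
qed

theorem point_spectrum_iff:
  "q \<in> spherical_point_spectrum T \<longleftrightarrow> P (qsphere q \<inter> X) \<noteq> 0"
proof -
  define r where "r = half_slice_rep \<iota> q"
  have r: "r \<in> X" using half_slice_rep(1) [OF unit] by (simp add: r_def)
  have "qDelta q T = qDelta r T"
    unfolding r_def by (rule qDelta_rep)
  then have "q \<in> spherical_point_spectrum T \<longleftrightarrow> {u. qDelta r T u = 0} \<noteq> {0}"
    by (simp only: spherical_point_spectrum_def qker_def mem_Collect_eq)
  also have "\<dots> \<longleftrightarrow> (\<exists>u. u \<noteq> 0 \<and> qDelta r T u = 0)"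
    using blinfun.zero_right [of "qDelta r T"] by blast
  also have "\<dots> \<longleftrightarrow> (\<exists>u. u \<noteq> 0 \<and> P {r} u = u)"
    by (simp add: qker_qDelta [OF r] G_eq_0_iff [OF r])
  also have "\<dots> \<longleftrightarrow> P {r} \<noteq> 0"
  proof
    assume "P {r} \<noteq> 0"
    then obtain v where "P {r} v \<noteq> 0"
      using blinfun_eqI [of "P {r}" 0] by auto
    then show "\<exists>u. u \<noteq> 0 \<and> P {r} u = u"
      using pvm_hinner(3) [OF pvm singleton_sets [OF r]] by blast
  qed auto
  finally show ?thesis
    by (simp add: qsphere_Int_half_slice [OF unit] r_def)
qed

end

section \<open>The parts of the spherical spectrum in terms of \<open>P\<close>\<close>

locale iq_normal_operator = iq_operator +
  assumes normal: "commutes (radj T) T"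
begin

lemma normal_qDelta: "norm (radj (qDelta q T) u) = norm (qDelta q T u)"
proof -
  have "commutes (radj T) (qDelta q T)"
    unfolding qDelta_def by (intro commutes_simps normal)
  then have c1: "commutes (qDelta q T) (radj T)"
    by (rule commutes_sym)
  have "commutes (qDelta q T) (qDelta q (radj T))"
    unfolding qDelta_def [of q "radj T"] by (intro commutes_simps c1)
  then have c: "commutes (qDelta q T) (radj (qDelta q T))"
    by (simp add: qDelta_radj)
  have "(norm (radj (qDelta q T) u))\<^sup>2 = \<langle>u,qDelta q T (radj (qDelta q T) u)\<rangle>"
    by (simp add: hinner_self [symmetric] radj)
  also have "\<dots> = (norm (qDelta q T u))\<^sup>2"
    by (simp add: commutesD [OF c] radj' hinner_self)
  finally show ?thesis by simp
qed

lemma dense_range_qDelta: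
  assumes "qker (qDelta q T) = {0}"
  shows "dense_range (qDelta q T)"
proof (rule dense_range_radj)
  have "radj (qDelta q T) u = 0 \<longleftrightarrow> qDelta q T u = 0" for u
    using normal_qDelta [of q u] by (metis norm_eq_zero)
  then show "qker (radj (qDelta q T)) = {0}"
    using assms by (simp add: qker_def)
qed

theorem residual_spectrum_empty: "spherical_residual_spectrum T = {}"
  using dense_range_qDelta by (auto simp: spherical_residual_spectrum_def)

lemma ball_sets: "X \<inter> ball q r \<in> sets M"
  by (intro openin_sets) (auto simp: openin_open)

lemma support_iff:
  "q \<in> S \<longleftrightarrow> q \<in> X \<and> (\<forall>r>0. P (X \<inter> ball q r) \<noteq> 0)"
proof
  assume q: "q \<in> S"
  have "openin (top_of_set X) (X \<inter> ball q r)" for r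
    by (auto simp: openin_open)
  moreover have "q \<in> X \<inter> ball q r" if "r > 0" for r
    using q S_subset that by auto
  ultimately show "q \<in> X \<and> (\<forall>r>0. P (X \<inter> ball q r) \<noteq> 0)"
    using q S_subset unfolding qsupp_def by blast
next
  assume q: "q \<in> X \<and> (\<forall>r>0. P (X \<inter> ball q r) \<noteq> 0)"
  have "P U \<noteq> 0" if U: "openin (top_of_set X) U" "q \<in> U" for U
  proof
    assume PU: "P U = 0"
    obtain V where V: "open V" "U = X \<inter> V"
      using U by (auto simp: openin_open)
    then obtain r where r: "r > 0" "ball q r \<subseteq> V"
      using U(2) open_contains_ball by blast
    have "P (X \<inter> ball q r) u = 0" for u
      by (rule pvm_mono_eq_0 [OF pvm ball_sets openin_sets [OF U(1)]]) (use r V PU in auto)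
    then have "P (X \<inter> ball q r) = 0"
      by (intro blinfun_eqI) simp
    then show False using q r by blast
  qed
  then show "q \<in> S"
    using q unfolding qsupp_def by blast
qed

text \<open>The scalar measures do not charge the ball, so the integrand in \<open>G_norm\<close> is
  at least \<open>r\<^sup>2\<close> almost everywhere. \<open>G_norm_upper\<close> is the
  counterpart for vectors whose measure is carried by the ball.\<close>

lemma G_norm_lower:
  assumes "P (X \<inter> ball q r) = 0" "r > 0"
  shows "r * norm u \<le> norm (G q u)"
proof -
  interpret finite_measure "\<mu> u" by (rule finite_measure_\<mu>)
  have e: "{x \<in> space M. \<not> r \<le> dist q x} = X \<inter> ball q r" by auto
  have ae: "AE x in \<mu> u. r \<le> dist q x"
    using assms ball_sets by (subst AE_pvm_measure_iff [OF pvm]; simp only: e) simp_all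
  have "(r * norm u)\<^sup>2 = (\<integral>x. r\<^sup>2 \<partial>\<mu> u)"
    by (simp add: measure_\<mu> power_mult_distrib)
  also have "\<dots> \<le> (\<integral>x. (norm (x - q))\<^sup>2 \<partial>\<mu> u)"
  proof (rule integral_mono_AE)
    show "AE x in \<mu> u. r\<^sup>2 \<le> (norm (x - q))\<^sup>2"
      using ae by eventually_elim (use assms(2) in \<open>auto simp: dist_norm norm_minus_commute intro!: power_mono\<close>)
  qed (simp_all add: G_integrable)
  also have "\<dots> = (norm (G q u))\<^sup>2" by (rule G_norm [symmetric])
  finally show ?thesis
    by (rule power2_le_imp_le) simp
qed

lemma G_norm_upper:
  assumes u: "P (X \<inter> ball q r) u = u" and "r > 0"
  shows "norm (G q u) \<le> r * norm u"
proof -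
  interpret finite_measure "\<mu> u" by (rule finite_measure_\<mu>)
  have ae: "AE x in \<mu> u. x \<in> X \<inter> ball q r"
    using pvm_measure_restrict [OF pvm ball_sets, of q r u] unfolding u .
  have "(norm (G q u))\<^sup>2 = (\<integral>x. (norm (x - q))\<^sup>2 \<partial>\<mu> u)" by (rule G_norm)
  also have "\<dots> \<le> (\<integral>x. r\<^sup>2 \<partial>\<mu> u)"
  proof (rule integral_mono_AE)
    show "AE x in \<mu> u. (norm (x - q))\<^sup>2 \<le> r\<^sup>2"
      using ae by eventually_elim (auto simp: dist_norm norm_minus_commute intro!: power_mono)
  qed (simp_all add: G_integrable)
  also have "\<dots> = (r * norm u)\<^sup>2"
    by (simp add: measure_\<mu> power_mult_distrib)
  finally show ?thesis
    by (rule power2_le_imp_le) (use \<open>r > 0\<close> in simp)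
qed

lemma resolvent_iff:
  assumes q: "q \<in> X"
  shows "q \<in> spherical_resolvent_set T \<longleftrightarrow> q \<notin> S"
proof
  assume q': "q \<in> spherical_resolvent_set T"
  then have k: "qker (qDelta q T) = {0}" and "bounded_inverse (qDelta q T)"
    by (auto simp: spherical_resolvent_set_def)
  then obtain K where K: "\<And>u. norm u \<le> K * norm (qDelta q T u)"
    using bounded_inverse_iff by blast
  \<comment> \<open>For \<open>v\<close> in the range of the projection of the ball of radius
    \<open>1 / C\<close> the two estimates combine to
    \<open>norm v \<le> ((C - 1) / C) * norm v\<close>. The summand 1 makes \<open>C\<close>
    positive and the inequality contradictory for \<open>v \<noteq> 0\<close>.\<close>
  define C where "C = \<bar>K\<bar> * norm (G (qcnj q)) + 1"
  have C: "C > 0" by (simp add: C_def add_nonneg_pos)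
  have "P (X \<inter> ball q (1 / C)) u = 0" for u
  proof (rule ccontr)
    assume ne: "P (X \<inter> ball q (1 / C)) u \<noteq> 0"
    define v where "v = P (X \<inter> ball q (1 / C)) u"
    have Pv: "P (X \<inter> ball q (1 / C)) v = v"
      unfolding v_def by (rule pvm_hinner(3) [OF pvm ball_sets])
    have Gv: "norm (G q v) \<le> (1 / C) * norm v"
      using C by (intro G_norm_upper [OF Pv]) simp
    have v0: "norm v > 0" using ne by (simp add: v_def)
    have "norm v \<le> \<bar>K\<bar> * norm (qDelta q T v)"
      using K [of v] by (meson abs_ge_self mult_right_mono norm_ge_zero order_trans)
    also have "qDelta q T v = G (qcnj q) (G q v)"
      using q half_slice_subset by (intro qDelta_eq(2)) blast
    also have "norm \<dots> \<le> norm (G (qcnj q)) * ((1 / C) * norm v)"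
      using norm_blinfun [of "G (qcnj q)" "G q v"] Gv by (meson mult_left_mono norm_ge_zero order_trans)
    then have "\<bar>K\<bar> * norm (G (qcnj q) (G q v)) \<le> \<bar>K\<bar> * (norm (G (qcnj q)) * ((1 / C) * norm v))"
      by (intro mult_left_mono) auto
    also have "\<dots> = ((C - 1) / C) * norm v"
      by (simp add: C_def)
    also have "\<dots> < 1 * norm v"
      using C v0 by (intro mult_strict_right_mono) auto
    finally show False by simp
  qed
  then have "P (X \<inter> ball q (1 / C)) = 0"
    by (intro blinfun_eqI) simp
  then show "q \<notin> S"
    using C support_iff by force
next
  assume "q \<notin> S"
  then obtain r where r: "r > 0" "P (X \<inter> ball q r) = 0"
    using q support_iff by blast
  \<comment> \<open>The lower bound \<open>r\<close> for \<open>G q\<close> is used twice, once for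
    each factor.\<close>
  have low: "r * r * norm u \<le> norm (qDelta q T u)" for u
  proof -
    have "r * (r * norm u) \<le> r * norm (G q u)"
      using G_norm_lower [OF r(2,1)] r(1) by (intro mult_left_mono) auto
    also have "\<dots> \<le> norm (G q (G q u))"
      by (rule G_norm_lower [OF r(2,1)])
    also have "\<dots> \<le> norm (qDelta q T u)"
      by (rule qDelta_norm_ge [OF q])
    finally show ?thesis by simp
  qed
  have k: "qker (qDelta q T) = {0}"
  proof -
    have "u = 0" if "qDelta q T u = 0" for u
      using low [of u] that r(1) by (simp add: mult_le_0_iff)
    then show ?thesis by (auto simp: qker_def)
  qed
  moreover have "norm u \<le> (1 / (r * r)) * norm (qDelta q T u)" for u
    using low [of u] r(1) by (simp add: field_simps)
  then have "bounded_inverse (qDelta q T)"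
    unfolding bounded_inverse_iff [OF k] by blast
  ultimately show "q \<in> spherical_resolvent_set T"
    using dense_range_qDelta by (simp add: spherical_resolvent_set_def)
qed

theorem support_eq_spectrum: "S = spherical_spectrum T \<inter> X"
  using resolvent_iff S_subset by (auto simp: spherical_spectrum_def)

text \<open>A neighbourhood \<open>V\<close> isolating \<open>q\<close> has
  \<open>P (X \<inter> V) \<noteq> 0\<close>, since \<open>q\<close> is in the support, whereas
  \<open>X \<inter> V - {q}\<close> lies off the support and is null. What remains sits in
  \<open>{q}\<close>.\<close>

theorem isolated_point_spectrum:
  assumes "q isolated_in (spherical_spectrum T \<inter> X)"
  shows "q \<in> spherical_point_spectrum T"
proof -
  obtain V where V: "q \<in> S" "open V" "V \<inter> S = {q}"
    using assms unfolding support_eq_spectrum [symmetric] isolated_in_def by blast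
  have q: "q \<in> X" using V S_subset by blast
  have o: "openin (top_of_set X) (X \<inter> V)"
    using V by (auto simp: openin_open)
  have qV: "q \<in> V" using V by blast
  have "P (X \<inter> V) \<noteq> 0"
    using V(1) o q qV unfolding qsupp_def by blast
  moreover have "X \<inter> V = {q} \<union> (X \<inter> V - {q})" using q qV by blast
  moreover have s: "X \<inter> V - {q} \<in> sets M"
    using openin_sets [OF o] singleton_sets [OF q] by blast
  then have "P ({q} \<union> (X \<inter> V - {q})) = P {q} + P (X \<inter> V - {q})"
    using singleton_sets [OF q] by (intro pvm_union [OF pvm]) auto
  moreover have "P (X \<inter> V - {q}) u = 0" for u
    using S_sets sets.compl_sets [of S M] V P_compl_S
    by (intro pvm_mono_eq_0 [OF pvm s, of "X - S"]) auto
  then have "P (X \<inter> V - {q}) = 0" by (intro blinfun_eqI) simp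
  ultimately have "P {q} \<noteq> 0" by auto
  then show ?thesis
    using point_spectrum_iff [of q] qsphere_Int_half_slice [OF unit] half_slice_rep_id [OF unit q] by simp
qed

text \<open>An injective \<open>qDelta q T\<close> has dense range by normality, so a point of the
  spectrum outside the point spectrum can only fail to have a bounded inverse; and on the half-slice
  the spectrum is the support.\<close>

lemma continuous_spectrum_support:
  "q \<in> spherical_continuous_spectrum T \<longleftrightarrow>
    q \<notin> spherical_point_spectrum T \<and> half_slice_rep \<iota> q \<in> S"
proof -
  define r where "r = half_slice_rep \<iota> q"
  have r: "r \<in> X" using half_slice_rep(1) [OF unit] by (simp add: r_def)
  have D: "qDelta q T = qDelta r T" unfolding r_def by (rule qDelta_rep)
  have "r \<in> S \<longleftrightarrow> r \<notin> spherical_resolvent_set T"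
    using resolvent_iff [OF r] by blast
  then have "r \<in> S \<longleftrightarrow> \<not> (qker (qDelta r T) = {0} \<and> dense_range (qDelta r T) \<and> bounded_inverse (qDelta r T))"
    by (simp only: spherical_resolvent_set_def mem_Collect_eq)
  moreover have "q \<in> spherical_point_spectrum T \<longleftrightarrow> \<not> qker (qDelta r T) = {0}"
    by (simp only: spherical_point_spectrum_def mem_Collect_eq D)
  moreover have "q \<in> spherical_continuous_spectrum T \<longleftrightarrow>
      qker (qDelta r T) = {0} \<and> dense_range (qDelta r T) \<and> \<not> bounded_inverse (qDelta r T)"
    by (simp only: spherical_continuous_spectrum_def mem_Collect_eq D)
  ultimately show ?thesis
    using dense_range_qDelta [of r] unfolding r_def [symmetric] by argo
qed

theorem continuous_spectrum_iff:
  "q \<in> spherical_continuous_spectrum T \<longleftrightarrow> P (qsphere q \<inter> X) = 0 \<and>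
    (\<forall>U. openin (top_of_set X) U \<and> qsphere q \<inter> X \<subseteq> U \<longrightarrow> P U \<noteq> 0)"
  unfolding continuous_spectrum_support point_spectrum_iff qsphere_Int_half_slice [OF unit]
  using half_slice_rep(1) [OF unit, of q] by (auto simp: qsupp_def)

text \<open>The scalar in \<open>T u - u \<cdot>\<^sub>Q q\<close> acts on the right, while
  \<open>G r\<close> subtracts a left multiple; the two agree on vectors with
  \<open>L p v = v \<cdot>\<^sub>Q p\<close>. Projecting a basis vector of \<open>L\<close> by a
  small ball around the representative \<open>r\<close> gives such a vector that is nearly an
  eigenvector for \<open>r\<close>, and right multiplication by \<open>s\<close> turns
  \<open>r\<close> into \<open>q\<close>.\<close>

theorem approximate_eigenvector:
  assumes q: "q \<in> spherical_continuous_spectrum T" and \<epsilon>: "\<epsilon> > 0"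
  shows "\<exists>u. norm u = 1 \<and> norm (T u - u \<cdot>\<^sub>Q q) < \<epsilon>"
proof -
  define r where "r = half_slice_rep \<iota> q"
  have r: "r \<in> S" using q continuous_spectrum_support by (simp add: r_def)
  \<comment> \<open>Half of \<open>\<epsilon>\<close>, because the bound from
    \<open>G_norm_upper\<close> is not strict.\<close>
  let ?B = "X \<inter> ball r (\<epsilon> / 2)"
  have PB: "P ?B \<noteq> 0" using r support_iff \<epsilon> by simp
  obtain N where N: "hilbert_basis N" "\<And>z q. z \<in> N \<Longrightarrow> L q z = z \<cdot>\<^sub>Q q"
    using left_mult_basis [OF L] by blast
  have "\<exists>z\<in>N. P ?B z \<noteq> 0"
  proof (rule ccontr)
    assume "\<not> (\<exists>z\<in>N. P ?B z \<noteq> 0)"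
    then have "P ?B = 0"
      using P_qbounded [OF ball_sets]
      by (intro qbounded_ops_eqI [OF N(1)]) (auto simp: qbounded_ops_def)
    then show False using PB by blast
  qed
  then obtain z where z: "z \<in> N" "P ?B z \<noteq> 0" by blast
  define v where "v = P ?B z"
  have v0: "norm v > 0" using z by (simp add: v_def)
  \<comment> \<open>The projection is right linear and commutes with \<open>L\<close>, so it keeps
    this property of the basis vector.\<close>
  have Lv: "L p v = v \<cdot>\<^sub>Q p" for p
    using N(2) [OF z(1)] PL [OF ball_sets, of r "\<epsilon> / 2" p z] qbounded_opsD [OF P_qbounded [OF ball_sets]]
    by (simp add: v_def)
  have "norm (G r v) \<le> (\<epsilon> / 2) * norm v"
    using \<epsilon> by (intro G_norm_upper) (simp_all add: v_def pvm_hinner(3) [OF pvm ball_sets])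
  then have Tv: "norm (T v - v \<cdot>\<^sub>Q r) \<le> (\<epsilon> / 2) * norm v"
    by (simp add: G_def blinfun.bilinear_simps Lv)
  obtain s where s: "norm s = 1" "s * q = r * s"
    using half_slice_rep_conjugate [OF unit, of q] unfolding r_def by blast
  define u where "u = (1 / norm v) *\<^sub>R (v \<cdot>\<^sub>Q s)"
  have "T u - u \<cdot>\<^sub>Q q = (1 / norm v) *\<^sub>R ((T v - v \<cdot>\<^sub>Q r) \<cdot>\<^sub>Q s)"
    by (simp add: u_def blinfun.bilinear_simps qbounded_opsD [OF T_qbounded] scaleQ_scaleR_left
        scaleQ_mult [symmetric] s(2) scaleQ_diff_left scaleR_diff_right)
  then have "norm (T u - u \<cdot>\<^sub>Q q) = norm (T v - v \<cdot>\<^sub>Q r) / norm v"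
    by (simp add: norm_scaleQ s)
  also have "\<dots> \<le> \<epsilon> / 2"
    using Tv v0 by (simp add: field_simps)
  also have "\<dots> < \<epsilon>" using \<epsilon> by simp
  finally have "norm (T u - u \<cdot>\<^sub>Q q) < \<epsilon>" .
  moreover have "norm u = 1"
    using v0 by (simp add: u_def norm_scaleQ s)
  ultimately show ?thesis by blast
qed

section \<open>The real axis and the kernel of \<open>T - radj T\<close>\<close>

lemma Reals_subset: "\<real> \<subseteq> X"
proof
  fix x :: quat assume "x \<in> \<real>"
  then obtain a where "x = of_real a" by (auto simp: Reals_def)
  then show "x \<in> X" using half_sliceI [OF unit, of 0 a] by simp
qed

lemma Reals_iff:
  assumes "x \<in> X"
  shows "x \<in> \<real> \<longleftrightarrow> \<iota> \<bullet> x = 0"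
proof
  assume "x \<in> \<real>"
  then obtain a where "x = of_real a" by (auto simp: Reals_def)
  then show "\<iota> \<bullet> x = 0"
    using slice_coords(2) [OF unit, of a 0] by simp
next
  assume "\<iota> \<bullet> x = 0"
  then have "x = of_real (qRe x)"
    using assms half_slice_iff [OF unit] by (metis add.right_neutral mult_zero_right of_real_0)
  then show "x \<in> \<real>" by (metis Reals_of_real)
qed

lemma Reals_sets: "(\<real> :: quat set) \<in> sets M"
proof -
  have "\<real> = {x. x = of_real (qRe x)}"
    by (auto simp: Reals_def)
  moreover have "closed {x :: quat. x = of_real (qRe x)}"
    by (intro closed_Collect_eq continuous_intros linear_continuous_on [OF bounded_linear_qRe])
  ultimately show ?thesis
    using Reals_subset by (intro closed_sets) auto
qed

text \<open>\<open>\<langle>u,D u\<rangle>\<close> is twice the integral of the nonnegative function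
  \<open>\<iota> \<bullet> x\<close>, which vanishes exactly on the real axis.\<close>

lemma D_eq_0_iff: "D u = 0 \<longleftrightarrow> P \<real> u = u"
proof -
  have "D u = 0 \<longleftrightarrow> \<langle>u,D u\<rangle> = 0"
    using pos_op_eq_0 [OF D_pos] by auto
  also have "\<dots> \<longleftrightarrow> (\<integral>x. \<iota> \<bullet> x \<partial>\<mu> u) = 0"
    by (simp add: hinner_D)
  also have "\<dots> \<longleftrightarrow> (AE x in \<mu> u. \<iota> \<bullet> x = 0)"
  proof (rule integral_nonneg_eq_0_iff_AE)
    show "integrable (\<mu> u) (\<lambda>x. \<iota> \<bullet> x)"
      by (rule integral_zeta_cong(1)) (intro continuous_intros)
    show "AE x in \<mu> u. 0 \<le> \<iota> \<bullet> x"
      using half_slice_iff [OF unit] by (intro AE_I2) auto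
  qed
  also have "\<dots> \<longleftrightarrow> P (X - \<real>) u = 0"
  proof -
    have "{x \<in> space M. \<not> \<iota> \<bullet> x = 0} = X - \<real>" using Reals_iff by auto
    then show ?thesis
      using Reals_sets sets.compl_sets [of \<real> M] by (subst AE_pvm_measure_iff [OF pvm]) auto
  qed
  also have "\<dots> \<longleftrightarrow> P \<real> u = u"
    using pvm_compl [OF pvm Reals_sets] by (auto simp: blinfun.bilinear_simps)
  finally show ?thesis .
qed

lemma qker_diff_adj: "u \<in> qker (T - radj T) \<longleftrightarrow> D u = 0"
proof -
  have "(T - radj T) u = 0 \<longleftrightarrow> L \<iota> (D u) = 0"
    unfolding diff_adj_eq by simp
  also have "\<dots> \<longleftrightarrow> D u = 0"
    using left_mult_norm [OF L, of \<iota> "D u"] imag_unit_simps(2) [OF unit]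
    by (metis mult_1 norm_eq_zero)
  finally show ?thesis by (simp add: qker_def)
qed

theorem range_P_Reals: "range (blinfun_apply (P \<real>)) = qker (T - radj T)"
proof (intro equalityI subsetI)
  fix v assume "v \<in> range (blinfun_apply (P \<real>))"
  then show "v \<in> qker (T - radj T)"
    unfolding qker_diff_adj D_eq_0_iff using pvm_hinner(3) [OF pvm Reals_sets] by auto
next
  fix v assume "v \<in> qker (T - radj T)"
  then show "v \<in> range (blinfun_apply (P \<real>))"
    unfolding qker_diff_adj D_eq_0_iff by (metis rangeI)
qed

theorem range_P_compl_Reals:
  "range (blinfun_apply (P (X - \<real>))) = qperp (qker (T - radj T))"
proof -
  have c: "P (X - \<real>) u = u - P \<real> u" for u
    using pvm_compl [OF pvm Reals_sets] by (simp add: blinfun.bilinear_simps)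
  have "radj (P \<real>) = P \<real>"
    using pvmD(1) [OF pvm Reals_sets] by (simp add: proj_op_def selfadj_radj)
  then have qa: "qinner (P \<real> u) v = qinner u (P \<real> v)" for u v
    using radj_qinner [OF P_qbounded [OF Reals_sets], of u v] by simp
  have iff: "v \<in> qperp (qker (T - radj T)) \<longleftrightarrow> P \<real> v = 0" for v
  proof
    assume "v \<in> qperp (qker (T - radj T))"
    then have "qinner (P \<real> (P \<real> v)) v = 0"
      unfolding qperp_def range_P_Reals [symmetric] by blast
    then have "qinner (P \<real> v) (P \<real> v) = 0"
      by (simp add: qa)
    then show "P \<real> v = 0"
      by (simp add: qinner_self)
  next
    assume "P \<real> v = 0"
    then show "v \<in> qperp (qker (T - radj T))"
      unfolding qperp_def range_P_Reals [symmetric] by (auto simp: qa)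
  qed
  show ?thesis
  proof (intro equalityI subsetI)
    fix v assume "v \<in> range (blinfun_apply (P (X - \<real>)))"
    then show "v \<in> qperp (qker (T - radj T))"
      unfolding iff using pvm_hinner(3) [OF pvm Reals_sets] by (auto simp: c blinfun.bilinear_simps)
  next
    fix v assume "v \<in> qperp (qker (T - radj T))"
    then have "P (X - \<real>) v = v"
      unfolding iff by (simp add: c)
    then show "v \<in> range (blinfun_apply (P (X - \<real>)))" by (metis rangeI)
  qed
qed

end

section \<open>Uniqueness\<close>

lemma pvm_threshold_orthogonal:
  fixes f :: "'a \<Rightarrow> real"
  assumes P: "pvm M P" and P': "pvm M P'"
    and f: "f \<in> borel_measurable M"
    and int: "\<And>u. integrable (pvm_measure M P u) f" "\<And>u. integrable (pvm_measure M P' u) f"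
    and eq: "\<And>u. (\<integral>x. f x \<partial>pvm_measure M P u) = (\<integral>x. f x \<partial>pvm_measure M P' u)"
    and comm: "\<And>E F. E \<in> sets M \<Longrightarrow> F \<in> sets M \<Longrightarrow> commutes (P E) (P' F)"
  shows "P {x \<in> space M. f x \<le> t} (P' {x \<in> space M. \<not> f x \<le> t} w) = 0"
proof -
  define E F where "E = {x \<in> space M. f x \<le> t}" and "F = {x \<in> space M. \<not> f x \<le> t}"
  have EF: "E \<in> sets M" "F \<in> sets M"
    using f unfolding E_def F_def by measurable
  define u where "u = P E (P' F w)"
  have u1: "P E u = u"
    unfolding u_def by (rule pvm_hinner(3) [OF P EF(1)])
  have u2: "P' F u = u"
    unfolding u_def commutesD [OF comm [OF EF]] by (rule pvm_hinner(3) [OF P' EF(2)])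
  interpret p: finite_measure "pvm_measure M P u"
    by (rule finite_measure_pvm_measure [OF P])
  interpret p': finite_measure "pvm_measure M P' u"
    by (rule finite_measure_pvm_measure [OF P'])
  have a1: "AE x in pvm_measure M P u. x \<in> E"
    using pvm_measure_restrict [OF P EF(1), of u] unfolding u1 .
  have a2: "AE x in pvm_measure M P' u. x \<in> F"
    using pvm_measure_restrict [OF P' EF(2), of u] unfolding u2 .
  have "(\<integral>x. f x \<partial>pvm_measure M P u) \<le> (\<integral>x. t \<partial>pvm_measure M P u)"
  proof (rule integral_mono_AE)
    show "AE x in pvm_measure M P u. f x \<le> t"
      using a1 by eventually_elim (simp add: E_def)
  qed (simp_all add: int)
  \<comment> \<open>Both measures have total mass \<open>(norm u)\<^sup>2\<close>, so the bound
    obtained under \<open>P\<close> transfers to \<open>P'\<close>, where \<open>f - t\<close> is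
    positive almost everywhere.\<close>
  then have "(\<integral>x. f x - t \<partial>pvm_measure M P' u) \<le> 0"
    using int(2) [of u] by (simp add: eq measure_pvm_space [OF P] measure_pvm_space [OF P'])
  moreover have nn: "AE x in pvm_measure M P' u. 0 \<le> f x - t"
    using a2 by eventually_elim (simp add: F_def)
  then have "0 \<le> (\<integral>x. f x - t \<partial>pvm_measure M P' u)"
    by (rule integral_nonneg_AE)
  ultimately have "(\<integral>x. f x - t \<partial>pvm_measure M P' u) = 0"
    by simp
  then have "AE x in pvm_measure M P' u. f x - t = 0"
    using integral_nonneg_eq_0_iff_AE [OF _ nn] int(2) [of u] by simp
  with a2 have "AE x in pvm_measure M P' u. False"
    by eventually_elim (simp add: F_def)
  then have "P' (space M) u = 0"
    using AE_pvm_measure_iff [OF P', of "\<lambda>x. False" u] by simp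
  then show ?thesis
    using pvmD(2) [OF P'] by (simp add: u_def E_def F_def)
qed

text \<open>The two orthogonality relations give \<open>P E = P E o\<^sub>L P' E\<close> and
  \<open>P' E = P' E o\<^sub>L P E\<close> for the sublevel set \<open>E\<close>, and the two
  products coincide.\<close>

lemma pvm_threshold_unique:
  fixes f :: "'a \<Rightarrow> real"
  assumes P: "pvm M P" and P': "pvm M P'"
    and f: "f \<in> borel_measurable M"
    and int: "\<And>u. integrable (pvm_measure M P u) f" "\<And>u. integrable (pvm_measure M P' u) f"
    and eq: "\<And>u. (\<integral>x. f x \<partial>pvm_measure M P u) = (\<integral>x. f x \<partial>pvm_measure M P' u)"
    and comm: "\<And>E F. E \<in> sets M \<Longrightarrow> F \<in> sets M \<Longrightarrow> commutes (P E) (P' F)"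
  shows "P {x \<in> space M. f x \<le> t} = P' {x \<in> space M. f x \<le> t}"
proof (rule blinfun_eqI)
  fix w
  define E F where "E = {x \<in> space M. f x \<le> t}" and "F = {x \<in> space M. \<not> f x \<le> t}"
  have EF: "E \<in> sets M" "F \<in> sets M"
    using f unfolding E_def F_def by measurable
  have F: "F = space M - E" by (auto simp: E_def F_def)
  have "P E (P' F w) = 0"
    unfolding E_def F_def by (rule pvm_threshold_orthogonal [OF P P' f int eq comm])
  then have 1: "P E w = P E (P' E w)"
    unfolding F pvm_compl [OF P' EF(1)] by (simp add: blinfun.bilinear_simps)
  have "P' E (P F w) = 0"
    unfolding E_def F_def
    by (rule pvm_threshold_orthogonal [OF P' P f int(2,1) eq [symmetric] commutes_sym [OF comm]])
  then have 2: "P' E w = P' E (P E w)"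
    unfolding F pvm_compl [OF P EF(1)] by (simp add: blinfun.bilinear_simps)
  show "P {x \<in> space M. f x \<le> t} w = P' {x \<in> space M. f x \<le> t} w"
    using 1 2 commutesD [OF comm [OF EF(1) EF(1)], of w] by (simp add: E_def)
qed

text \<open>Half-planes in the two coordinates intersect in quadrants, which form an
  intersection-stable generator of the Borel sets of the plane, so Dynkin induction applies there.
  The half-slice is carried to the plane by \<open>h\<close>, and \<open>k\<close> is a left inverse
  through which its Borel sets are preimages.\<close>

theorem pvm_half_slice_unique:
  fixes P P' :: "quat set \<Rightarrow> 'h::quat_hilbert \<Rightarrow>\<^sub>L 'h" and \<iota> :: quat
  defines "X \<equiv> half_slice \<iota>" and "M \<equiv> borel_half_slice \<iota>"
  assumes \<iota>: "\<iota> \<in> imag_units" and P: "pvm M P" and P': "pvm M P'"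
    and a: "\<And>t. P {x \<in> X. qRe x \<le> t} = P' {x \<in> X. qRe x \<le> t}"
    and b: "\<And>t. P {x \<in> X. \<iota> \<bullet> x \<le> t} = P' {x \<in> X. \<iota> \<bullet> x \<le> t}"
    and E: "E \<in> sets M"
  shows "P E = P' E"
proof -
  define h where "h x = (qRe x, \<iota> \<bullet> x)" for x
  define k where "k p = of_real (fst p) + \<iota> * of_real (snd p)" for p
  have sp: "space M = X" by (simp add: M_def X_def space_restrict_space)
  have qm: "qRe \<in> borel_measurable M" and im: "(\<lambda>x. \<iota> \<bullet> x) \<in> borel_measurable M"
    unfolding M_def
    by (intro measurable_restrict_space1 borel_measurable_continuous_onI
          linear_continuous_on bounded_linear_qRe bounded_linear_inner_right)+
  have hm: "h \<in> M \<rightarrow>\<^sub>M borel"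
    unfolding h_def using qm im by (intro borel_measurable_Pair)
  let ?N = "borel :: (real \<times> real) measure"
  let ?P = "\<lambda>F. P (h -` F \<inter> space M)" and ?P' = "\<lambda>F. P' (h -` F \<inter> space M)"
  have Q: "pvm ?N ?P" and Q': "pvm ?N ?P'"
    using pvm_distr(1) [OF P hm] pvm_distr(1) [OF P' hm] by auto
  let ?G = "range (\<lambda>p :: real \<times> real. {..p})"
  have sB: "sets ?N = sigma_sets UNIV ?G"
    by (subst borel_eq_atMost) (simp add: sets_measure_of)
  have stable: "Int_stable ?G"
  proof -
    have "{..p} \<inter> {..q} = {..(min (fst p) (fst q), min (snd p) (snd q))}" for p q :: "real \<times> real"
      by (auto simp: less_eq_prod_def)
    then show ?thesis by (auto simp: Int_stable_def)
  qed
  have main: "?P F = ?P' F" if "F \<in> sigma_sets UNIV ?G" for F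
    using stable subset_Pow_UNIV that
  proof (induction rule: sigma_sets_induct_disjoint)
    fix F assume "F \<in> ?G"
    then obtain s t where F: "F = {..(s, t)}" by auto
    have e: "h -` F \<inter> space M = {x \<in> X. qRe x \<le> s} \<inter> {x \<in> X. \<iota> \<bullet> x \<le> t}"
      by (auto simp: F h_def sp)
    have s: "{x \<in> X. qRe x \<le> s} \<in> sets M" "{x \<in> X. \<iota> \<bullet> x \<le> t} \<in> sets M"
      unfolding sp [symmetric] using qm im by measurable
    show "?P F = ?P' F"
    proof (rule blinfun_eqI)
      fix u
      show "?P F u = ?P' F u"
        unfolding e pvmD(3) [OF P s, symmetric] pvmD(3) [OF P' s, symmetric] a b ..
    qed
  next
    show "?P {} = ?P' {}"
      using pvm_empty [OF P] pvm_empty [OF P'] by simp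
  next
    fix F assume "F \<in> sigma_sets UNIV ?G" and IH: "?P F = ?P' F"
    then have F: "F \<in> sets ?N" by (simp only: sB)
    have "?P (UNIV - F) = id_blinfun - ?P F" "?P' (UNIV - F) = id_blinfun - ?P' F"
      using pvm_compl [OF Q F] pvm_compl [OF Q' F] by simp_all
    then show "?P (UNIV - F) = ?P' (UNIV - F)" using IH by simp
  next
    fix A :: "nat \<Rightarrow> (real \<times> real) set"
    assume A: "disjoint_family A" "range A \<subseteq> sigma_sets UNIV ?G" and IH: "\<And>i. ?P (A i) = ?P' (A i)"
    have A': "range A \<subseteq> sets ?N" using A(2) by (simp only: sB)
    show "?P (\<Union>i. A i) = ?P' (\<Union>i. A i)"
    proof (rule blinfun_eqI)
      fix u
      have "(\<lambda>n. ?P (A n) u) sums ?P (\<Union>n. A n) u" "(\<lambda>n. ?P' (A n) u) sums ?P' (\<Union>n. A n) u"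
        using pvmD(4) [OF Q A' A(1)] pvmD(4) [OF Q' A' A(1)] by blast+
      then show "?P (\<Union>i. A i) u = ?P' (\<Union>i. A i) u"
        unfolding IH by (rule sums_unique2)
    qed
  qed
  obtain E' where E': "E = X \<inter> E'" "E' \<in> sets borel"
    using E by (auto simp: M_def X_def sets_restrict_space)
  have "k \<in> ?N \<rightarrow>\<^sub>M borel"
    unfolding k_def of_real_def by (intro borel_measurable_continuous_onI continuous_intros)
  then have "k -` E' \<in> sets ?N"
    using E'(2) measurable_sets [of k ?N borel E'] by simp
  then have "?P (k -` E') = ?P' (k -` E')"
    using main by (simp only: sB)
  moreover have "h -` (k -` E') \<inter> space M = E"
  proof -
    have "k (h x) = x" if "x \<in> X" for x
      using half_slice_iff [OF \<iota>] that by (simp add: k_def h_def X_def)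
    then have "k (h x) \<in> E' \<longleftrightarrow> x \<in> E'" if "x \<in> X" for x
      using that by simp
    then show ?thesis unfolding sp E'(1) vimage_def by blast
  qed
  ultimately show ?thesis by simp
qed

lemma slice_left_mult_eq:
  assumes L: "left_mult L" "left_mult L'" and \<iota>: "\<iota> \<in> imag_units" "q \<in> slice \<iota>" and u: "L \<iota> u = L' \<iota> u"
  shows "L q u = L' q u"
proof -
  define a b where "a = qRe q" and "b = \<iota> \<bullet> q"
  have q: "q = of_real a + \<iota> * of_real b"
    using slice_eq [OF \<iota>] by (simp add: a_def b_def)
  have "K q u = a *\<^sub>R u + b *\<^sub>R K \<iota> u" if K: "left_mult K" for K :: "quat \<Rightarrow> 'a \<Rightarrow>\<^sub>L 'a"
    unfolding q left_mult_add [OF K] left_mult_mult [OF K] left_mult_of_real [OF K]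
    by (simp add: blinfun.bilinear_simps)
  then show ?thesis using L u by simp
qed

text \<open>The orthogonal complement of the range of the self-adjoint \<open>D\<close> is its
  kernel, which is that of \<open>T - radj T\<close>. As \<open>L \<iota> (D v)\<close> is dictated
  by \<open>T\<close>, this fixes \<open>L \<iota>\<close> on the whole complement of the
  kernel.\<close>

lemma (in iq_normal_operator) qperp_closure_range:
  assumes u: "u \<in> qperp (qker (T - radj T))"
  shows "u \<in> closure (range (blinfun_apply D))"
proof -
  let ?K = "closure (range (blinfun_apply D))"
  have K: "subspace ?K"
    by (intro subspace_closure linear_subspace_image subspace_UNIV)
      (rule bounded_linear.linear [OF blinfun.bounded_linear_right])
  obtain m where m: "m \<in> ?K" "\<And>v. v \<in> ?K \<Longrightarrow> \<langle>u - m,v\<rangle> = 0"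
    using orthogonal_projection_exists [OF K closed_closure] by blast
  have "\<langle>D (u - m),v\<rangle> = 0" for v
  proof -
    have "\<langle>u - m,D v\<rangle> = 0"
      using m(2) closure_subset by blast
    then show ?thesis using D_pos by (simp add: pos_op_def selfadjD)
  qed
  then have "D (u - m) = 0"
    by (intro hinner_eqI) simp
  then have "u - m \<in> qker (T - radj T)"
    by (simp only: qker_diff_adj)
  then have "qinner (u - m) u = 0"
    using u by (simp add: qperp_def)
  then have "\<langle>u - m,u\<rangle> = 0" by (simp add: hinner_def)
  moreover have "\<langle>u - m,m\<rangle> = 0" using m by blast
  ultimately have "\<langle>u - m,u - m\<rangle> = 0" by (simp only: hinner_simps)
  then have "u = m" by (simp add: hinner_self)
  then show ?thesis using m by simp
qed

section \<open>Left multiplications from Hilbert bases\<close>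

definition qorthonormal :: "'h::quat_hilbert set \<Rightarrow> bool"
  where "qorthonormal N \<longleftrightarrow> (\<forall>z\<in>N. \<forall>w\<in>N. qinner z w = (if z = w then 1 else 0))"

lemma qorthonormal_norm_sq:
  assumes N: "qorthonormal N" and F: "finite F" "F \<subseteq> N"
  shows "(norm (\<Sum>z\<in>F. z \<cdot>\<^sub>Q c z))\<^sup>2 = (\<Sum>z\<in>F. (norm (c z))\<^sup>2)"
proof -
  have "(norm (\<Sum>z\<in>F. z \<cdot>\<^sub>Q c z))\<^sup>2 = (\<Sum>z\<in>F. (norm (z \<cdot>\<^sub>Q c z))\<^sup>2)"
  proof (rule norm_sq_sum_orthogonal [OF F(1)])
    fix z w assume "z \<in> F" "w \<in> F" "z \<noteq> w"
    then have "qinner z w = 0" using N F unfolding qorthonormal_def by (metis subsetD)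
    then show "\<langle>z \<cdot>\<^sub>Q c z,w \<cdot>\<^sub>Q c w\<rangle> = 0"
      by (simp add: hinner_def qinner_scaleQ_left qinner_scaleQ_right)
  qed
  also have "\<dots> = (\<Sum>z\<in>F. (norm (c z))\<^sup>2)"
  proof (rule sum.cong [OF refl])
    fix z assume "z \<in> F"
    then have "qinner z z = 1" using N F unfolding qorthonormal_def by (metis subsetD)
    then have "norm z = 1" by (simp add: norm_qinner)
    then show "(norm (z \<cdot>\<^sub>Q c z))\<^sup>2 = (norm (c z))\<^sup>2" by (simp add: norm_scaleQ)
  qed
  finally show ?thesis .
qed

lemma bessel_inequality:
  assumes N: "qorthonormal N" and F: "finite F" "F \<subseteq> N"
  shows "(\<Sum>z\<in>F. (norm (qinner z u))\<^sup>2) \<le> (norm u)\<^sup>2"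
proof -
  let ?p = "\<Sum>z\<in>F. z \<cdot>\<^sub>Q qinner z u"
  have p: "(norm ?p)\<^sup>2 = (\<Sum>z\<in>F. (norm (qinner z u))\<^sup>2)"
    by (rule qorthonormal_norm_sq [OF N F])
  have "\<langle>u,z \<cdot>\<^sub>Q qinner z u\<rangle> = (norm (qinner z u))\<^sup>2" for z
    unfolding hinner_scaleQ_right by (subst qinner_qcnj) (simp only: qcnj_mult_self quat_sel_of_real)
  then have "\<langle>u,?p\<rangle> = (\<Sum>z\<in>F. (norm (qinner z u))\<^sup>2)"
    by (simp add: bounded_bilinear.sum_right [OF bounded_bilinear_hinner])
  then have "0 \<le> (norm u)\<^sup>2 - (\<Sum>z\<in>F. (norm (qinner z u))\<^sup>2)"
    using norm_diff_sq [of u ?p] p zero_le_power2 [of "norm (u - ?p)"] by linarith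
  then show ?thesis by simp
qed

definition basis_sum :: "quat \<Rightarrow> 'h::quat_hilbert \<Rightarrow> 'h set \<Rightarrow> 'h"
  where "basis_sum q u F = (\<Sum>z\<in>F. z \<cdot>\<^sub>Q q \<cdot>\<^sub>Q qinner z u)"

lemma basis_sum_norm:
  assumes N: "qorthonormal N" and F: "finite F" "F \<subseteq> N"
  shows "norm (basis_sum q u F) \<le> norm q * norm u"
proof -
  have "(norm (basis_sum q u F))\<^sup>2 = (\<Sum>z\<in>F. (norm (q * qinner z u))\<^sup>2)"
    using qorthonormal_norm_sq [OF N F, of "\<lambda>z. q * qinner z u"] by (simp add: basis_sum_def scaleQ_mult)
  also have "\<dots> = (norm q)\<^sup>2 * (\<Sum>z\<in>F. (norm (qinner z u))\<^sup>2)"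
    by (simp add: norm_mult power_mult_distrib sum_distrib_left)
  also have "\<dots> \<le> (norm q)\<^sup>2 * (norm u)\<^sup>2"
    by (intro mult_left_mono bessel_inequality [OF N F]) simp
  finally have "(norm (basis_sum q u F))\<^sup>2 \<le> (norm q * norm u)\<^sup>2"
    by (simp add: power_mult_distrib)
  then show ?thesis
    by (rule power2_le_imp_le) simp
qed

lemma basis_sum_diff: "basis_sum q (u - v) F = basis_sum q u F - basis_sum q v F"
  by (simp add: basis_sum_def qinner_diff_right sum_subtractf scaleQ_diff_right)

lemma basis_sum_span:
  assumes N: "qorthonormal N" and u: "u = (\<Sum>z\<in>F. z \<cdot>\<^sub>Q c z)" and F: "F \<subseteq> N" "finite F"
    and G: "finite G" "F \<subseteq> G" "G \<subseteq> N"
  shows "basis_sum q u G = (\<Sum>z\<in>F. z \<cdot>\<^sub>Q (q * c z))"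
proof -
  have c: "qinner z u = (if z \<in> F then c z else 0)" if "z \<in> N" for z
  proof -
    have "qinner z u = (\<Sum>w\<in>F. qinner z w * c w)"
      unfolding u by (simp add: bounded_bilinear.sum_right [OF bounded_bilinear_qinner] qinner_scaleQ_right)
    also have "\<dots> = (\<Sum>w\<in>F. if w = z then c z else 0)"
      using N F(1) that subsetD [OF F(1)] by (intro sum.cong) (auto simp: qorthonormal_def)
    also have "\<dots> = (if z \<in> F then c z else 0)"
      using F(2) by simp
    finally show ?thesis .
  qed
  have "basis_sum q u G = (\<Sum>z\<in>G. if z \<in> F then z \<cdot>\<^sub>Q (q * c z) else 0)"
    unfolding basis_sum_def using G(3) by (intro sum.cong) (auto simp: c scaleQ_mult)
  also have "\<dots> = (\<Sum>z\<in>F. z \<cdot>\<^sub>Q (q * c z))"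
    using G by (simp add: sum.inter_restrict [symmetric] Int_absorb1)
  finally show ?thesis .
qed

text \<open>\<open>u\<close> is approximated by a finite combination \<open>v\<close> of vectors
  from \<open>F\<close>. For \<open>v\<close> the partial sums are constant once they contain
  \<open>F\<close>, and by Bessel replacing \<open>u\<close> by \<open>v\<close> costs at most
  \<open>norm q * norm (u - v)\<close>.\<close>

lemma basis_sum_convergent:
  fixes N :: "'h::quat_hilbert set"
  assumes N: "hilbert_basis N"
  shows "\<exists>l. ((\<lambda>z. z \<cdot>\<^sub>Q q \<cdot>\<^sub>Q qinner z u) has_sum l) N"
proof -
  have O: "qorthonormal N" and dense: "closure (qspan N) = UNIV"
    using N by (auto simp: hilbert_basis_def qorthonormal_def)
  have "cauchy_filter (filtermap (basis_sum q u) (finite_subsets_at_top N))"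
    unfolding cauchy_filter_metric_filtermap
  proof (intro allI impI)
    fix e :: real assume e: "e > 0"
    \<comment> \<open>Two partial sums are compared, each with an error of at most
      \<open>norm q * d\<close>; the summand 1 covers \<open>q = 0\<close>.\<close>
    define d where "d = e / (2 * (norm q + 1))"
    have d: "d > 0" using e by (simp add: d_def add_nonneg_pos)
    obtain v where v: "v \<in> qspan N" "dist v u < d"
      using dense d closure_approachable [of u "qspan N"] by auto
    then obtain F c where F: "v = (\<Sum>z\<in>F. z \<cdot>\<^sub>Q c z)" "finite F" "F \<subseteq> N"
      by (auto simp: qspan_def)
    define Q where "Q G \<longleftrightarrow> finite G \<and> F \<subseteq> G \<and> G \<subseteq> N" for G
    have "eventually Q (finite_subsets_at_top N)"
      unfolding eventually_finite_subsets_at_top Q_def using F by blast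
    moreover have "dist (basis_sum q u G) (basis_sum q u H) < e" if GH: "Q G" "Q H" for G H
    proof -
      define a where "a = (\<Sum>z\<in>F. z \<cdot>\<^sub>Q (q * c z))"
      have near: "norm (basis_sum q u G - a) \<le> norm q * norm (u - v)" if "Q G" for G
      proof -
        have "basis_sum q v G = a"
          unfolding a_def using that F by (intro basis_sum_span [OF O]) (auto simp: Q_def)
        then have "basis_sum q u G - a = basis_sum q (u - v) G"
          by (simp add: basis_sum_diff)
        then show ?thesis
          using basis_sum_norm [OF O, of G q "u - v"] that by (simp add: Q_def)
      qed
      have "dist (basis_sum q u G) (basis_sum q u H) \<le> norm q * norm (u - v) + norm q * norm (u - v)"
        using near [OF GH(1)] near [OF GH(2)] dist_triangle3 [of "basis_sum q u G" "basis_sum q u H" a]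
        by (simp add: dist_norm norm_minus_commute)
      also have "\<dots> \<le> 2 * ((norm q + 1) * norm (u - v))"
        by (simp add: algebra_simps)
      also have "\<dots> < 2 * ((norm q + 1) * d)"
        using v(2) by (intro mult_strict_left_mono) (auto simp: dist_norm norm_minus_commute add_nonneg_pos)
      also have "\<dots> = e"
      proof -
        have "norm q + 1 > 0" by (simp add: add_nonneg_pos)
        then show ?thesis by (simp add: d_def field_simps)
      qed
      finally show ?thesis .
    qed
    ultimately show "\<exists>Q. eventually Q (finite_subsets_at_top N) \<and>
        (\<forall>G H. Q G \<and> Q H \<longrightarrow> dist (basis_sum q u G) (basis_sum q u H) < e)" by blast
  qed
  moreover have "complete (UNIV :: 'h set)"
    by (meson Cauchy_convergent UNIV_I complete_def convergent_def)
  ultimately obtain l where "(basis_sum q u \<longlongrightarrow> l) (finite_subsets_at_top N)"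
    using complete_uniform [where S = "UNIV :: 'h set"] by (force simp add: filterlim_def)
  then show ?thesis
    by (auto simp: has_sum_def basis_sum_def [abs_def])
qed

theorem left_mult_exists:
  fixes N :: "'h::quat_hilbert set"
  assumes N: "hilbert_basis N"
  shows "\<exists>L. left_mult L \<and> (\<forall>z\<in>N. \<forall>q. blinfun_apply (L q) z = z \<cdot>\<^sub>Q q)"
proof -
  have O: "qorthonormal N"
    using N by (auto simp: hilbert_basis_def qorthonormal_def)
  define l where "l q u = (SOME l. ((\<lambda>z. z \<cdot>\<^sub>Q q \<cdot>\<^sub>Q qinner z u) has_sum l) N)" for q u
  have l: "((\<lambda>z. z \<cdot>\<^sub>Q q \<cdot>\<^sub>Q qinner z u) has_sum l q u) N" for q u
    unfolding l_def by (rule someI_ex [OF basis_sum_convergent [OF N]])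
  have lin: "bounded_linear (l q)" for q
  proof (rule bounded_linear_intro [of _ "norm q"])
    show "l q (u + v) = l q u + l q v" for u v
    proof (rule has_sum_unique [OF l])
      show "((\<lambda>z. z \<cdot>\<^sub>Q q \<cdot>\<^sub>Q qinner z (u + v)) has_sum l q u + l q v) N"
        using has_sum_add [OF l [of q u] l [of q v]] by (simp add: qinner_add_right scaleQ_add_right)
    qed
    show "l q (r *\<^sub>R u) = r *\<^sub>R l q u" for r u
    proof (rule has_sum_unique [OF l])
      show "((\<lambda>z. z \<cdot>\<^sub>Q q \<cdot>\<^sub>Q qinner z (r *\<^sub>R u)) has_sum r *\<^sub>R l q u) N"
        using has_sum_bounded_linear [OF bounded_linear_scaleR_right [of r] l [of q u]]
        by (simp add: qinner_scaleR_right scaleQ_scaleR_right)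
    qed
    show "norm (l q u) \<le> norm u * norm q" for u
    proof (rule Lim_norm_ubound)
      show "(sum (\<lambda>z. z \<cdot>\<^sub>Q q \<cdot>\<^sub>Q qinner z u) \<longlongrightarrow> l q u) (finite_subsets_at_top N)"
        using l [of q u] by (simp add: has_sum_def)
      show "\<forall>\<^sub>F F in finite_subsets_at_top N. norm (\<Sum>z\<in>F. z \<cdot>\<^sub>Q q \<cdot>\<^sub>Q qinner z u) \<le> norm u * norm q"
        by (rule eventually_finite_subsets_at_top_weakI)
          (use basis_sum_norm [OF O] in \<open>simp add: basis_sum_def mult.commute\<close>)
    qed simp
  qed
  define L where "L q = Blinfun (l q)" for q
  have L: "blinfun_apply (L q) u = l q u" for q u
    using lin by (simp add: L_def bounded_linear_Blinfun_apply)
  have "l q (u \<cdot>\<^sub>Q p) = l q u \<cdot>\<^sub>Q p" for q u p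
  proof (rule has_sum_unique [OF l])
    show "((\<lambda>z. z \<cdot>\<^sub>Q q \<cdot>\<^sub>Q qinner z (u \<cdot>\<^sub>Q p)) has_sum l q u \<cdot>\<^sub>Q p) N"
      using has_sum_bounded_linear [OF bounded_linear_scaleQ [of p] l [of q u]]
      by (simp add: qinner_scaleQ_right scaleQ_mult)
  qed
  then have "L q \<in> qbounded_ops" for q
    by (simp add: qbounded_ops_def L)
  then have "left_mult L"
    using N l unfolding left_mult_def L by blast
  moreover have "blinfun_apply (L q) w = w \<cdot>\<^sub>Q q" if "w \<in> N" for q w
    unfolding L using has_sum_unique [OF l has_sum_hilbert_basis [OF N that]] .
  ultimately show ?thesis by blast
qed

section \<open>A left multiplication adapted to a polar decomposition\<close>

lemma qspan_subspace: "subspace (qspan (N :: 'h::quat_hilbert set))"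
proof (rule subspaceI)
  show "0 \<in> qspan N"
    unfolding qspan_def by (rule CollectI, rule exI [of _ "{}"]) simp
next
  fix x y assume "x \<in> qspan N" "y \<in> qspan N"
  then obtain F c G d where F: "x = (\<Sum>z\<in>F. z \<cdot>\<^sub>Q c z)" "finite F" "F \<subseteq> N"
    and G: "y = (\<Sum>z\<in>G. z \<cdot>\<^sub>Q d z)" "finite G" "G \<subseteq> N"
    by (auto simp: qspan_def)
  define e where "e z = (if z \<in> F then c z else 0) + (if z \<in> G then d z else 0)" for z
  have "(\<Sum>z\<in>F \<union> G. z \<cdot>\<^sub>Q e z)
      = (\<Sum>z\<in>F \<union> G. if z \<in> F then z \<cdot>\<^sub>Q c z else 0) + (\<Sum>z\<in>F \<union> G. if z \<in> G then z \<cdot>\<^sub>Q d z else 0)"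
    unfolding sum.distrib [symmetric] by (intro sum.cong) (auto simp: e_def scaleQ_add_right)
  also have "\<dots> = x + y"
    using F G by (simp add: sum.inter_restrict [symmetric] Int_absorb1)
  finally have "x + y = (\<Sum>z\<in>F \<union> G. z \<cdot>\<^sub>Q e z)" by simp
  moreover have "finite (F \<union> G)" "F \<union> G \<subseteq> N" using F G by auto
  ultimately show "x + y \<in> qspan N"
    unfolding qspan_def by blast
next
  fix r x assume "x \<in> qspan N"
  then obtain F c where F: "x = (\<Sum>z\<in>F. z \<cdot>\<^sub>Q c z)" "finite F" "F \<subseteq> N"
    by (auto simp: qspan_def)
  have "r *\<^sub>R x = (\<Sum>z\<in>F. z \<cdot>\<^sub>Q (r *\<^sub>R c z))"
    by (simp add: F(1) scaleR_right.sum scaleQ_scaleR_right)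
  then show "r *\<^sub>R x \<in> qspan N"
    unfolding qspan_def using F(2,3)
    by (intro CollectI exI [of _ F] exI [of _ "\<lambda>z. r *\<^sub>R c z"]) blast
qed

lemma real_quat_iff: "q \<in> \<real> \<longleftrightarrow> q = of_real (qRe q)"
  by (auto simp: Reals_def)

lemma qinner_Reals_commute: "qinner u v \<in> \<real> \<Longrightarrow> qinner v u \<in> (\<real> :: quat set)"
  for u v :: "'h::quat_hilbert"
  by (subst qinner_qcnj) (auto simp: Reals_def)

lemma qinner_Reals_closed:
  fixes v :: "'h::quat_hilbert"
  shows "closed {u. qinner v u \<in> \<real>}" "subspace {u. qinner v u \<in> \<real>}"
proof -
  have "bounded_linear (\<lambda>u. qinner v u)"
    by (rule bounded_bilinear.bounded_linear_right [OF bounded_bilinear_qinner])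
  moreover from this have "bounded_linear (\<lambda>u. of_real (qRe (qinner v u)) :: quat)"
    by (intro bounded_linear_compose [OF bounded_linear_of_real]
        bounded_linear_compose [OF bounded_linear_qRe])
  ultimately show "closed {u. qinner v u \<in> \<real>}" "subspace {u. qinner v u \<in> \<real>}"
    unfolding real_quat_iff by (rule closed_subspace_equalizer)+
qed

locale polar_decomposition =
  fixes \<iota> :: quat and A B C :: "'h::quat_hilbert \<Rightarrow>\<^sub>L 'h"
  assumes unit: "\<iota> \<in> imag_units"
    and qb: "A \<in> qbounded_ops" "B \<in> qbounded_ops" "C \<in> qbounded_ops"
    and B: "selfadj B" and C: "radj C = - C"
    and comm: "commutes A B" "commutes C A" "commutes C B"
    and sq: "\<And>u. C (C u) = - B (B u)"
begin

text \<open>The self-adjoint operators in the bicommutant of \<open>A\<close> and \<open>B\<close>.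
  They commute with each other, with \<open>C\<close> and with the right multiplications, and
  products of two are again of this kind. All \<open>P E\<close> are among them, so one invariance
  condition covers every Borel set.\<close>

definition bic :: "('h \<Rightarrow>\<^sub>L 'h) \<Rightarrow> bool"
  where "bic Z \<longleftrightarrow> selfadj Z \<and> (\<forall>W. commutes W A \<longrightarrow> commutes W B \<longrightarrow> commutes W Z)"

lemma bic_B: "bic B"
  using B by (simp add: bic_def)

lemma bic_id: "bic id_blinfun"
  by (simp add: bic_def selfadj_simps commutes_simps)

lemma bic_commutes:
  assumes "bic Z"
  shows "commutes A Z" "commutes B Z" "commutes C Z" "commutes (right_mult q) Z"
proof -
  show "commutes A Z" "commutes B Z" "commutes C Z"
    using assms comm commutes_sym [OF comm(1)] by (auto simp: bic_def)
  show "commutes (right_mult q) Z"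
  proof -
    have "commutes (right_mult q) A" "commutes (right_mult q) B"
      using qbounded_opsD [OF qb(1)] qbounded_opsD [OF qb(2)] by (simp_all add: commutes_def)
    then show ?thesis using assms by (simp add: bic_def)
  qed
qed

lemma bic_qbounded: "bic Z \<Longrightarrow> Z \<in> qbounded_ops"
  using bic_commutes(4) by (auto simp: qbounded_ops_def commutes_def)

lemma bic_bic_commutes: "bic Y \<Longrightarrow> bic Z \<Longrightarrow> commutes Y Z"
  unfolding bic_def [of Z] using bic_commutes(1,2) [of Y] commutes_sym by blast

lemma bic_compose: "bic Y \<Longrightarrow> bic Z \<Longrightarrow> bic (Y o\<^sub>L Z)"
  using bic_bic_commutes [of Y Z] by (auto simp: bic_def intro!: selfadj_simps commutes_simps)

lemma bic_qinner: "bic Z \<Longrightarrow> qinner (Z u) v = qinner u (Z v)"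
  using radj_qinner [OF bic_qbounded, of Z u v] by (auto simp: bic_def selfadj_radj)

lemma bic_qinner_real:
  assumes "bic Z"
  shows "qinner u (Z u) \<in> \<real>"
proof -
  have "qinner u (Z u) = qcnj (qinner u (Z u))"
    using bic_qinner [OF assms, of u u] qinner_qcnj [of u "Z u"] by simp
  then show ?thesis
    by (simp add: real_quat_iff quat_eq_iff)
qed

text \<open>
  On such a set \<open>M\<close> the required left multiplication must be \<open>L\<^sub>q u = u q\<close>.
\<close>

definition admissible :: "'h set \<Rightarrow> bool"
  where "admissible M \<longleftrightarrow> (\<forall>u\<in>M. C u = B u \<cdot>\<^sub>Q \<iota>) \<and> (\<forall>u\<in>M. \<forall>v\<in>M. qinner u v \<in> \<real>) \<and>
    (\<forall>u\<in>M. \<forall>Z. bic Z \<longrightarrow> Z u \<in> M)"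

lemma admissible_closure_span:
  assumes M: "admissible M"
  shows "admissible (closure (span M))"
proof -
  let ?K = "closure (span M)"
  have K: "subspace ?K" "closed ?K" "M \<subseteq> ?K"
    using span_superset [of M] closure_subset [of "span M"] by (auto intro: subspace_closure)
  have "?K \<subseteq> {u. C u = right_mult \<iota> (B u)}"
    using M by (intro closure_span_minimal closed_subspace_equalizer
        bounded_linear_compose [OF blinfun.bounded_linear_right] blinfun.bounded_linear_right)
      (auto simp: admissible_def)
  \<comment> \<open>Realness of the inner products extends to the closed span in one argument at a
    time, with the symmetry of the condition in between.\<close>
  moreover have "?K \<subseteq> {u. qinner v u \<in> \<real>}" if "v \<in> M" for v
    using M that by (intro closure_span_minimal qinner_Reals_closed) (auto simp: admissible_def)
  then have "M \<subseteq> {v. qinner u v \<in> \<real>}" if "u \<in> ?K" for u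
    using that qinner_Reals_commute by blast
  then have "?K \<subseteq> {v. qinner u v \<in> \<real>}" if "u \<in> ?K" for u
    using that by (intro closure_span_minimal qinner_Reals_closed)
  moreover have "?K \<subseteq> {u. Z u \<in> ?K}" if Z: "bic Z" for Z
  proof (rule closure_span_minimal)
    show "M \<subseteq> {u. Z u \<in> ?K}"
      using M Z K(3) by (auto simp: admissible_def)
    show "closed {u. Z u \<in> ?K}"
      using closed_vimage [OF K(2), of "blinfun_apply Z"]
      by (simp add: vimage_def linear_continuous_on blinfun.bounded_linear_right)
    show "subspace {u. Z u \<in> ?K}"
      using K(1) by (auto simp: subspace_def blinfun.bilinear_simps)
  qed
  ultimately show ?thesis
    unfolding admissible_def right_mult_apply by blast
qed

text \<open>The orbit of \<open>v\<close> is adjoined.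
  \<open>qinner (Y v) (Z v) = qinner v (Y (Z v))\<close> is real because
  \<open>Y o\<^sub>L Z\<close> is again self-adjoint and right linear; orthogonality to
  \<open>M\<close> persists because \<open>Z\<close> maps \<open>M\<close> into itself; the relation
  for \<open>C\<close> passes along because \<open>Z\<close> commutes with \<open>B\<close> and
  \<open>C\<close>.\<close>

lemma admissible_extend:
  assumes M: "admissible M" and v: "v \<in> qperp M" "C v = B v \<cdot>\<^sub>Q \<iota>"
  shows "admissible (M \<union> {blinfun_apply Z v | Z. bic Z})"
  unfolding admissible_def
proof (intro conjI ballI allI impI)
  fix u assume "u \<in> M \<union> {blinfun_apply Z v | Z. bic Z}"
  then consider "u \<in> M" | Z where "bic Z" "u = Z v" by blast
  then show "C u = B u \<cdot>\<^sub>Q \<iota>"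
  proof cases
    case 2
    then show ?thesis
      using commutesD [OF bic_commutes(3) [OF 2(1)], of v] commutesD [OF bic_commutes(2) [OF 2(1)], of v]
        qbounded_opsD [OF bic_qbounded [OF 2(1)]] v(2) by simp
  qed (use M in \<open>auto simp: admissible_def\<close>)
next
  have o: "qinner m (Z v) = 0" if "m \<in> M" "bic Z" for m Z
    using that M v(1) bic_qinner [OF that(2), of m v] by (auto simp: admissible_def qperp_def)
  fix x y assume "x \<in> M \<union> {blinfun_apply Z v | Z. bic Z}" "y \<in> M \<union> {blinfun_apply Z v | Z. bic Z}"
  then consider "x \<in> M" "y \<in> M" | Z where "x \<in> M" "bic Z" "y = Z v" | Y where "bic Y" "x = Y v" "y \<in> M"
    | Y Z where "bic Y" "x = Y v" "bic Z" "y = Z v" by blast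
  then show "qinner x y \<in> \<real>"
  proof cases
    case 1
    then show ?thesis using M by (simp add: admissible_def)
  next
    case 2
    then show ?thesis by (simp add: o)
  next
    case 3
    then have "qinner y x \<in> \<real>" by (simp add: o)
    then show ?thesis by (rule qinner_Reals_commute)
  next
    case 4
    then show ?thesis
      using bic_qinner_real [OF bic_compose [OF 4(1,3)], of v] by (simp add: bic_qinner)
  qed
next
  fix u Z assume u: "u \<in> M \<union> {blinfun_apply Z v | Z. bic Z}" and Z: "bic Z"
  from u consider "u \<in> M" | Y where "bic Y" "u = Y v" by blast
  then show "Z u \<in> M \<union> {blinfun_apply Z v | Z. bic Z}"
  proof cases
    case 1
    then show ?thesis using M Z by (simp add: admissible_def)
  next
    case 2
    then have "Z u = (Z o\<^sub>L Y) v" by simp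
    then show ?thesis using bic_compose [OF Z 2(1)] by blast
  qed
qed

lemma maximal_admissible:
  "\<exists>M. admissible M \<and> (\<forall>M'. admissible M' \<longrightarrow> M \<subseteq> M' \<longrightarrow> M' = M)"
proof -
  have "\<exists>M\<in>{M. admissible M}. \<forall>M'\<in>{M. admissible M}. M \<subseteq> M' \<longrightarrow> M' = M"
  proof (rule subset_Zorn', rule CollectI)
    fix \<C> assume "subset.chain {M. admissible M} \<C>"
    then have ad: "\<And>M. M \<in> \<C> \<Longrightarrow> admissible M"
      and ch: "\<And>M M'. M \<in> \<C> \<Longrightarrow> M' \<in> \<C> \<Longrightarrow> M \<subseteq> M' \<or> M' \<subseteq> M"
      unfolding subset_chain_def by blast+
    show "admissible (\<Union>\<C>)"
      unfolding admissible_def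
    proof (intro conjI ballI allI impI)
      fix u v assume "u \<in> \<Union>\<C>" "v \<in> \<Union>\<C>"
      then obtain M where "M \<in> \<C>" "u \<in> M" "v \<in> M"
        using ch by blast
      then show "qinner u v \<in> \<real>"
        using ad by (auto simp: admissible_def)
    next
      fix u Z assume "u \<in> \<Union>\<C>" and Z: "bic Z"
      then obtain M where M: "M \<in> \<C>" "u \<in> M" by blast
      then have "Z u \<in> M"
        using ad [OF M(1)] Z by (simp add: admissible_def)
      then show "Z u \<in> \<Union>\<C>" using M(1) by blast
    next
      fix u assume "u \<in> \<Union>\<C>"
      then show "C u = B u \<cdot>\<^sub>Q \<iota>"
        using ad by (auto simp: admissible_def)
    qed
  qed
  then show ?thesis by blast
qed

text \<open>For a nonzero \<open>u\<close> orthogonal to \<open>M\<close> the vector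
  \<open>v = B u - C u \<cdot>\<^sub>Q \<iota>\<close> satisfies
  \<open>C v = B v \<cdot>\<^sub>Q \<iota>\<close>, because the squares of \<open>C\<close> and
  \<open>B\<close> are opposite. If it vanishes, then
  \<open>C u = - (B u \<cdot>\<^sub>Q \<iota>)\<close>, and multiplying \<open>u\<close> by a unit
  \<open>j\<close> anticommuting with \<open>\<iota>\<close> corrects the sign. Either way a nonzero
  vector can be adjoined by \<open>admissible_extend\<close>; by maximality it lies in
  \<open>M\<close> and is orthogonal to itself.\<close>

lemma admissible_total:
  assumes M: "admissible M" and max: "\<And>M'. admissible M' \<Longrightarrow> M \<subseteq> M' \<Longrightarrow> M' = M"
    and u: "u \<in> qperp M"
  shows "u = 0"
proof (rule ccontr)
  assume u0: "u \<noteq> 0"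
  \<comment> \<open>\<open>B\<close> maps \<open>M\<close> into itself and \<open>radj C\<close>
    maps \<open>m\<close> to \<open>- (B m \<cdot>\<^sub>Q \<iota>)\<close>, so \<open>B u\<close>
    and \<open>C u\<close> stay orthogonal to \<open>M\<close>.\<close>
  have Bu: "qinner m (B u) = 0" and Cu: "qinner m (C u) = 0" if m: "m \<in> M" for m
  proof -
    have Bm: "B m \<in> M" using M m bic_B by (simp add: admissible_def)
    then show "qinner m (B u) = 0"
      using u bic_qinner [OF bic_B, of m u] by (simp add: qperp_def)
    have "qinner m (C u) = qinner (radj C m) u"
      using radj_qinner [OF qb(3)] by simp
    also have "\<dots> = - (qcnj \<iota> * qinner (B m) u)"
      using M m by (simp add: C admissible_def blinfun.bilinear_simps qinner_minus_left qinner_scaleQ_left)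
    finally show "qinner m (C u) = 0"
      using u Bm by (simp add: qperp_def)
  qed
  have "\<exists>v. v \<noteq> 0 \<and> v \<in> qperp M \<and> C v = B v \<cdot>\<^sub>Q \<iota>"
  proof (cases "B u - C u \<cdot>\<^sub>Q \<iota> = 0")
    case False
    have "C (B u - C u \<cdot>\<^sub>Q \<iota>) = B (B u - C u \<cdot>\<^sub>Q \<iota>) \<cdot>\<^sub>Q \<iota>"
      using commutesD [OF comm(3)] imag_unit_simps(3) [OF unit]
      by (simp add: blinfun.bilinear_simps qbounded_opsD [OF qb(2)] qbounded_opsD [OF qb(3)] sq
          scaleQ_diff_left scaleQ_minus_left scaleQ_minus_right scaleQ_one flip: scaleQ_mult)
    moreover have "B u - C u \<cdot>\<^sub>Q \<iota> \<in> qperp M"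
      using Bu Cu by (simp add: qperp_def qinner_diff_right qinner_scaleQ_right)
    ultimately show ?thesis using False by blast
  next
    case True
    obtain j where j: "j \<in> imag_units" "\<iota> * j = - (j * \<iota>)"
      using anticommuting_imag_unit [OF unit] .
    have "C u \<cdot>\<^sub>Q \<iota> \<cdot>\<^sub>Q \<iota> = B u \<cdot>\<^sub>Q \<iota>" using True by simp
    then have Cu': "C u = - (B u \<cdot>\<^sub>Q \<iota>)"
      by (metis imag_unit_simps(3) minus_minus scaleQ_minus_right scaleQ_mult scaleQ_one unit)
    have "C (u \<cdot>\<^sub>Q j) = - (B u \<cdot>\<^sub>Q (\<iota> * j))"
      by (simp add: qbounded_opsD [OF qb(3)] Cu' scaleQ_minus_left scaleQ_mult)
    also have "\<dots> = B (u \<cdot>\<^sub>Q j) \<cdot>\<^sub>Q \<iota>"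
      by (simp add: j(2) scaleQ_minus_right qbounded_opsD [OF qb(2)] scaleQ_mult)
    finally have "C (u \<cdot>\<^sub>Q j) = B (u \<cdot>\<^sub>Q j) \<cdot>\<^sub>Q \<iota>" .
    moreover have "norm (u \<cdot>\<^sub>Q j) \<noteq> 0"
      using u0 imag_unit_simps(2) [OF j(1)] by (simp add: norm_scaleQ)
    then have "u \<cdot>\<^sub>Q j \<noteq> 0" by auto
    moreover have "u \<cdot>\<^sub>Q j \<in> qperp M"
      using u by (simp add: qperp_def qinner_scaleQ_right)
    ultimately show ?thesis by blast
  qed
  then obtain v where v: "v \<noteq> 0" "v \<in> qperp M" "C v = B v \<cdot>\<^sub>Q \<iota>" by blast
  have "M \<union> {blinfun_apply Z v | Z. bic Z} = M"
    by (rule max [OF admissible_extend [OF M v(2,3)]]) blast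
  moreover have "v \<in> {blinfun_apply Z v | Z. bic Z}"
    using bic_id by (intro CollectI exI [of _ id_blinfun]) simp
  ultimately have "v \<in> M" by blast
  then have "qinner v v = 0" using v(2) by (simp add: qperp_def)
  then show False using v(1) by (simp add: qinner_self)
qed

lemma maximal_orthonormal:
  "\<exists>N. N \<subseteq> M \<and> qorthonormal N \<and> (\<forall>N'. N' \<subseteq> M \<longrightarrow> qorthonormal N' \<longrightarrow> N \<subseteq> N' \<longrightarrow> N' = N)"
proof -
  let ?S = "{N. N \<subseteq> M \<and> qorthonormal N}"
  have "\<exists>N\<in>?S. \<forall>N'\<in>?S. N \<subseteq> N' \<longrightarrow> N' = N"
  proof (rule subset_Zorn', rule CollectI)
    fix \<C> assume "subset.chain ?S \<C>"
    then have ad: "\<And>N. N \<in> \<C> \<Longrightarrow> N \<subseteq> M \<and> qorthonormal N"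
      and ch: "\<And>N N'. N \<in> \<C> \<Longrightarrow> N' \<in> \<C> \<Longrightarrow> N \<subseteq> N' \<or> N' \<subseteq> N"
      unfolding subset_chain_def by blast+
    have "qorthonormal (\<Union>\<C>)"
      unfolding qorthonormal_def
    proof (intro ballI)
      fix z w assume "z \<in> \<Union>\<C>" "w \<in> \<Union>\<C>"
      then obtain N where "N \<in> \<C>" "z \<in> N" "w \<in> N"
        using ch by blast
      then show "qinner z w = (if z = w then 1 else 0)"
        using ad unfolding qorthonormal_def by blast
    qed
    then show "\<Union>\<C> \<subseteq> M \<and> qorthonormal (\<Union>\<C>)"
      using ad by blast
  qed
  then obtain N where "N \<in> ?S" "\<forall>N'\<in>?S. N \<subseteq> N' \<longrightarrow> N' = N"
    by (rule bexE)
  then show ?thesis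
    by (intro exI [of _ N]) simp
qed

text \<open>A maximal orthonormal subset \<open>N\<close> of a maximal admissible \<open>M\<close>
  has closed real span \<open>M\<close>, and by \<open>admissible_total\<close> its quaternionic
  span is dense, so it is a Hilbert basis. Its left multiplication acts on all of \<open>M\<close>
  as right multiplication; both identities are then verified on basis vectors.\<close>

theorem adapted_left_mult:
  shows "\<exists>L. left_mult L \<and> (\<forall>Z q. bic Z \<longrightarrow> Z o\<^sub>L L q = L q o\<^sub>L Z) \<and> C = L \<iota> o\<^sub>L B"
proof -
  obtain M where M: "admissible M" and max: "\<And>M'. admissible M' \<Longrightarrow> M \<subseteq> M' \<Longrightarrow> M' = M"
    using maximal_admissible by blast
  have MK: "closure (span M) = M"
    using span_superset [of M] closure_subset [of "span M"]
    by (intro max admissible_closure_span [OF M]) blast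
  have MS: "subspace M" "closed M"
    using subspace_closure [of "span M"] closed_closure [of "span M"] unfolding MK by simp_all
  have Mre: "qinner u v \<in> \<real>" if "u \<in> M" "v \<in> M" for u v
    using M that by (simp add: admissible_def)
  obtain N where N: "N \<subseteq> M" "qorthonormal N"
    and maxN: "\<And>N'. N' \<subseteq> M \<Longrightarrow> qorthonormal N' \<Longrightarrow> N \<subseteq> N' \<Longrightarrow> N' = N"
    using maximal_orthonormal by blast
  let ?K = "closure (span N)"
  have KM: "?K \<subseteq> M"
    using N(1) MS by (intro closure_span_minimal)
  have MsubK: "m \<in> ?K" if m: "m \<in> M" for m
  proof -
    obtain m' where m': "m' \<in> ?K" "\<And>v. v \<in> ?K \<Longrightarrow> \<langle>m - m',v\<rangle> = 0"
      using orthogonal_projection_exists [OF subspace_closure [OF subspace_span] closed_closure] by blast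
    define w where "w = m - m'"
    have wM: "w \<in> M"
      unfolding w_def using m m'(1) KM MS(1) by (intro subspace_diff) auto
    have wz: "qinner w z = 0" if z: "z \<in> N" for z
    proof -
      have "z \<in> ?K" using z span_superset [of N] closure_subset [of "span N"] by blast
      then have "qRe (qinner w z) = 0"
        using m'(2) by (simp add: w_def hinner_def)
      \<comment> \<open>Inner products within \<open>M\<close> are real, so orthogonality for the
        real product is orthogonality for the quaternionic one.\<close>
      moreover have "qinner w z = of_real (qRe (qinner w z))"
        using Mre wM z N(1) unfolding real_quat_iff [symmetric] by blast
      ultimately show ?thesis by simp
    qed
    then have zw: "qinner z w = 0" if "z \<in> N" for z
      using that by (subst qinner_qcnj) simp
    have "w = 0"
    proof (rule ccontr)
      assume w0: "w \<noteq> 0"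
      define z0 where "z0 = (1 / norm w) *\<^sub>R w"
      have z0: "z0 \<in> M" "norm z0 = 1"
        using wM MS(1) w0 by (auto simp: z0_def intro: subspace_scale)
      have "qinner z0 z0 = 1" by (simp add: qinner_self z0)
      moreover have "qinner z0 z = 0" "qinner z z0 = 0" if "z \<in> N" for z
        using wz [OF that] zw [OF that] by (simp_all add: z0_def qinner_scaleR_left qinner_scaleR_right)
      moreover have z0N: "z0 \<notin> N"
      proof
        assume "z0 \<in> N"
        then have "qinner z0 w = 0" by (rule zw)
        then show False using w0 by (simp add: z0_def qinner_scaleR_left qinner_self)
      qed
      ultimately have "qorthonormal (insert z0 N)"
        using N(2) unfolding qorthonormal_def by auto
      then have "insert z0 N = N"
        using z0(1) N(1) by (intro maxN) auto
      then show False using z0N by blast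
    qed
    then show ?thesis using m'(1) by (simp add: w_def)
  qed
  have "closure (qspan N) = UNIV"
  proof (rule closed_subspace_dense)
    show "subspace (closure (qspan N))"
      by (intro subspace_closure qspan_subspace)
    fix u assume u: "\<And>v. v \<in> closure (qspan N) \<Longrightarrow> \<langle>u,v\<rangle> = 0"
    have "qinner u z = 0" if z: "z \<in> N" for z
    proof -
      have "z \<cdot>\<^sub>Q q \<in> qspan N" for q
        unfolding qspan_def using z by (intro CollectI exI [of _ "{z}"] exI [of _ "\<lambda>_. q"]) simp
      then have "\<langle>u,z \<cdot>\<^sub>Q q\<rangle> = \<langle>0,0 \<cdot>\<^sub>Q q\<rangle>" for q
        using u closure_subset [of "qspan N"] by (simp add: subset_iff)
      then have "qinner u z = qinner 0 0" by (rule qinner_eqI)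
      then show ?thesis by simp
    qed
    then have "N \<subseteq> {v. qinner u v = 0}" by blast
    then have "?K \<subseteq> {v. qinner u v = 0}"
      by (intro closure_span_minimal closed_subspace_equalizer bounded_linear_zero
          bounded_bilinear.bounded_linear_right [OF bounded_bilinear_qinner])
    then have uv: "qinner u v = 0" if "v \<in> M" for v
      using MsubK [OF that] by blast
    have "u \<in> qperp M"
      unfolding qperp_def
    proof (intro CollectI ballI)
      fix v assume "v \<in> M"
      then show "qinner v u = 0" using uv by (subst qinner_qcnj) simp
    qed
    then show "u = 0" using admissible_total [OF M max] by blast
  qed simp
  then have HB: "hilbert_basis N"
    using N(2) by (simp add: hilbert_basis_def qorthonormal_def)
  obtain L where L: "left_mult L" "\<And>z q. z \<in> N \<Longrightarrow> L q z = z \<cdot>\<^sub>Q q"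
    using left_mult_exists [OF HB] by blast
  \<comment> \<open>The rule is extended from \<open>N\<close> to \<open>M\<close> because
    \<open>Z z\<close> and \<open>B z\<close> for a basis vector \<open>z\<close> are in
    \<open>M\<close>, but in general not in \<open>N\<close>.\<close>
  have LM: "L q m = m \<cdot>\<^sub>Q q" if "m \<in> M" for m q
  proof -
    have "?K \<subseteq> {u. L q u = u \<cdot>\<^sub>Q q}"
      using L(2) by (intro closure_span_minimal closed_subspace_equalizer bounded_linear_scaleQ
          blinfun.bounded_linear_right) auto
    then show ?thesis using MsubK [OF that] by blast
  qed
  note Lq = left_mult_qbounded [OF L(1)]
  have "Z o\<^sub>L L q = L q o\<^sub>L Z" if Z: "bic Z" for Z q
  proof (rule qbounded_ops_eqI [OF HB])
    show "Z o\<^sub>L L q \<in> qbounded_ops" "L q o\<^sub>L Z \<in> qbounded_ops"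
      using bic_qbounded [OF Z] Lq by (intro qbounded_ops_simps; blast)+
    fix z assume z: "z \<in> N"
    then have "Z z \<in> M" using N(1) M Z by (auto simp: admissible_def)
    then show "(Z o\<^sub>L L q) z = (L q o\<^sub>L Z) z"
      using L(2) [OF z] LM qbounded_opsD [OF bic_qbounded [OF Z]] by simp
  qed
  moreover have "C = L \<iota> o\<^sub>L B"
  proof (rule qbounded_ops_eqI [OF HB qb(3)])
    show "L \<iota> o\<^sub>L B \<in> qbounded_ops"
      using qb Lq by (intro qbounded_ops_simps)
    fix z assume z: "z \<in> N"
    then have "B z \<in> M" using N(1) M bic_B by (auto simp: admissible_def)
    moreover have "C z = B z \<cdot>\<^sub>Q \<iota>" using z N(1) M by (auto simp: admissible_def)
    ultimately show "C z = (L \<iota> o\<^sub>L B) z" using LM by simp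
  qed
  ultimately show ?thesis using L(1) by blast
qed

end

section \<open>The spectral theorem\<close>

text \<open>The commutation clause prepares uniqueness, where the projections of another measure
  take the part of \<open>Z\<close>.\<close>

theorem spectral_theorem_exists:
  fixes T :: "'h::quat_hilbert \<Rightarrow>\<^sub>L 'h"
  assumes \<iota>: "\<iota> \<in> imag_units" and T: "T \<in> qbounded_ops" and normal: "commutes (radj T) T"
  shows "\<exists>P L. bounded_iqPVM \<iota> P L \<and> has_iq_integral \<iota> P L (\<lambda>x. x) T \<and>
    (\<forall>E\<in>sets (borel_half_slice \<iota>). \<forall>Z. commutes Z T \<longrightarrow> commutes Z (radj T) \<longrightarrow> commutes Z (P E))"
proof -
  let ?M = "borel_half_slice \<iota>"
  define A where "A = (1/2) *\<^sub>R (T + radj T)"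
  define C where "C = (1/2) *\<^sub>R (T - radj T)"
  have rT: "radj T \<in> qbounded_ops" using T by (rule radj_qbounded)
  have A: "selfadj A"
    by (simp add: A_def selfadj_radj radj_scaleR radj_add add.commute)
  have C: "radj C = - C"
    by (simp add: C_def radj_scaleR radj_diff scaleR_diff_right)
  have cA: "commutes Z A" and cC: "commutes Z C" if "commutes Z T" "commutes Z (radj T)" for Z
    using that by (auto simp: A_def C_def intro!: commutes_simps)
  have TA: "commutes T A" "commutes (radj T) A" "commutes T C" "commutes (radj T) C"
    using cA cC normal commutes_sym [OF normal] by simp_all
  obtain B where Bs: "pos_op B" "B o\<^sub>L B = radj C o\<^sub>L C" "bicomm (radj C o\<^sub>L C) B"
    using pos_op_sqrt_exists [OF pos_op_radj_compose [of C]] by blast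
  \<comment> \<open>As \<open>radj C = - C\<close>, the square of \<open>B\<close> is minus the
    square of \<open>C\<close>, so commuting with \<open>C\<close> alone suffices.\<close>
  have cB: "commutes Z B" if "commutes Z C" for Z
  proof -
    have "commutes Z (- C o\<^sub>L C)"
      using that by (auto simp: commutes_def blinfun.bilinear_simps)
    then show ?thesis using Bs(3) by (simp add: bicomm_def C)
  qed
  have AC: "commutes A C"
    by (rule cC) (rule commutes_sym [OF TA(1)], rule commutes_sym [OF TA(2)])
  have AB: "commutes A B" by (rule cB [OF AC])
  have CB: "commutes C B" by (rule cB) simp
  have sq: "C (C u) = - B (B u)" for u
    using arg_cong [OF Bs(2), of "\<lambda>S. blinfun_apply S u"] by (simp add: C blinfun.bilinear_simps)
  have qA: "A \<in> qbounded_ops" and qC: "C \<in> qbounded_ops"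
    using T rT by (auto simp: A_def C_def intro!: qbounded_ops_simps)
  have rm: "commutes (right_mult q) S" if "S \<in> qbounded_ops" for q S
    using qbounded_opsD [OF that] by (simp add: commutes_def)
  have qB: "B \<in> qbounded_ops"
  proof -
    have "commutes (right_mult q) B" for q
      by (rule cB [OF rm [OF qC]])
    then show ?thesis by (simp add: commutes_def qbounded_ops_def)
  qed
  interpret polar_decomposition \<iota> A B C
  proof
    show "selfadj B" using Bs(1) by (simp add: pos_op_def)
  qed (fact \<iota> qA qB qC C AB commutes_sym [OF AC] CB sq)+
  obtain c P where PP: "pvm ?M P \<and>
    P (half_slice \<iota> \<inter> cball 0 c) = id_blinfun \<and>
    (\<forall>u. (\<integral>x. qRe x \<partial>pvm_measure ?M P u) = \<langle>u,A u\<rangle>) \<and>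
    (\<forall>u. (\<integral>x. \<iota> \<bullet> x \<partial>pvm_measure ?M P u) = \<langle>u,B u\<rangle>) \<and>
    (\<forall>E\<in>sets ?M. \<forall>Z. commutes Z A \<longrightarrow> commutes Z B \<longrightarrow> commutes Z (P E))"
    using joint_spectral_measure [OF \<iota> A Bs(1) AB] by (elim exE) (rule that)
  have P: "pvm ?M P" "P (half_slice \<iota> \<inter> cball 0 c) = id_blinfun"
    "\<And>u. (\<integral>x. qRe x \<partial>pvm_measure ?M P u) = \<langle>u,A u\<rangle>"
    "\<And>u. (\<integral>x. \<iota> \<bullet> x \<partial>pvm_measure ?M P u) = \<langle>u,B u\<rangle>"
    "\<And>E Z. E \<in> sets ?M \<Longrightarrow> commutes Z A \<Longrightarrow> commutes Z B \<Longrightarrow> commutes Z (P E)"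
    using PP by simp_all
  have bicP: "bic (P E)" if "E \<in> sets ?M" for E
    using pvmD(1) [OF P(1) that] P(5) [OF that] by (auto simp: bic_def proj_op_def)
  have qP: "qPVM \<iota> P"
    using P(1) bic_qbounded [OF bicP] by (rule pvm_qPVM)
  obtain L where L: "left_mult L" "\<And>Z q. bic Z \<Longrightarrow> Z o\<^sub>L L q = L q o\<^sub>L Z" "C = L \<iota> o\<^sub>L B"
    using adapted_left_mult by blast
  have iq: "iqPVM \<iota> P L"
    using qP L(1,2) bicP by (simp add: iqPVM_def)
  interpret iq: iq_measure \<iota> P L
    using \<iota> iq by unfold_locales
  have supp: "qsupp \<iota> P \<subseteq> cball 0 c"
  proof -
    have s: "half_slice \<iota> \<inter> cball 0 c \<in> sets ?M"
      by (auto simp: sets_restrict_space)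
    have "half_slice \<iota> - half_slice \<iota> \<inter> cball 0 c = half_slice \<iota> \<inter> - cball 0 c" by blast
    then have "P (half_slice \<iota> \<inter> - cball 0 c) = 0"
      using pvm_compl [OF P(1) s] P(2) by simp
    moreover have "openin (top_of_set (half_slice \<iota>)) (half_slice \<iota> \<inter> - cball 0 c)"
      by (auto simp: openin_open intro!: exI [of _ "- cball 0 c"])
    ultimately show ?thesis
      unfolding qsupp_def by blast
  qed
  then have bdd: "bounded (qsupp \<iota> P)"
    using bounded_subset bounded_cball by blast
  \<comment> \<open>The absolute value covers the default value 0 off the support, since no sign of
    \<open>c\<close> is recorded.\<close>
  have "norm (iq.\<zeta> x) \<le> \<bar>c\<bar>" for x
    using supp by (auto simp: iq.\<zeta>_def subset_iff)
  then obtain T' where T': "iq.has iq.\<zeta> T'"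
    using iq.has_exists [OF iq.zeta_measurable] by blast
  have hasT': "has_iq_integral \<iota> P L (\<lambda>x. x) T'"
    using T' unfolding has_iq_integral_def iq.\<zeta>_def .
  interpret op: iq_operator \<iota> P L T'
    using hasT' by unfold_locales
  have LB: "L \<iota> (B v) = (1/2) *\<^sub>R (T v - radj T v)" for v
    using arg_cong [OF L(3), of "\<lambda>S. blinfun_apply S v"] by (simp add: C_def blinfun.bilinear_simps)
  \<comment> \<open>The scalar integrals give only quadratic forms, and that of \<open>T'\<close>
    determines just its self-adjoint part. The skew part is reached through \<open>op.D\<close>,
    which is self-adjoint and hence determined by its form; \<open>C = L \<iota> o\<^sub>L B\<close>
    then leads back to \<open>T\<close>.\<close>
  have D2: "op.D = 2 *\<^sub>R B"
    using op.D_pos Bs(1) by (intro selfadj_eqI selfadj_simps)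
      (auto simp: pos_op_def op.hinner_D P(4) blinfun.bilinear_simps hinner_simps)
  have D: "T' - radj T' = T - radj T"
    unfolding op.diff_adj_eq D2
    by (intro blinfun_eqI) (simp add: blinfun.diff_left blinfun.scaleR_left blinfun.scaleR_right LB)
  have S: "(1/2) *\<^sub>R (T' + radj T') = A"
  proof (rule selfadj_eqI [OF _ A])
    show "selfadj ((1/2) *\<^sub>R (T' + radj T'))"
      by (simp add: selfadj_radj radj_scaleR radj_add add.commute)
    show "\<langle>u,((1/2) *\<^sub>R (T' + radj T')) u\<rangle> = \<langle>u,A u\<rangle>" for u
      using op.hinner_T [of u] P(3) [of u] hinner_commute [of u "T' u"]
      by (simp add: blinfun.bilinear_simps hinner_simps radj')
  qed
  have "T' = (1/2) *\<^sub>R (T' + radj T') + (1/2) *\<^sub>R (T' - radj T')"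
    by (intro blinfun_eqI) (simp add: blinfun.bilinear_simps algebra_simps flip: scaleR_add_left)
  also have "\<dots> = (1/2) *\<^sub>R (T + radj T) + (1/2) *\<^sub>R (T - radj T)"
    unfolding S D A_def ..
  also have "\<dots> = T"
    by (intro blinfun_eqI) (simp add: blinfun.bilinear_simps algebra_simps flip: scaleR_add_left)
  finally have "T' = T" .
  with hasT' have "has_iq_integral \<iota> P L (\<lambda>x. x) T" by simp
  moreover have "bounded_iqPVM \<iota> P L"
    using iq bdd by (simp add: bounded_iqPVM_def)
  moreover have "commutes Z (P E)" if "E \<in> sets ?M" "commutes Z T" "commutes Z (radj T)" for E Z
    using P(5) [OF that(1) cA [OF that(2,3)] cB [OF cC [OF that(2,3)]]] .
  ultimately show ?thesis
    by (intro exI [of _ P] exI [of _ L]) simp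
qed

theorem theorem4p1:
  fixes \<iota> :: quat and T :: "'h::quat_hilbert \<Rightarrow>\<^sub>L 'h"
  assumes "\<iota> \<in> imag_units" and "T \<in> qbounded_ops" and "qnormal T"
  shows "\<exists>P L. bounded_iqPVM \<iota> P L \<and> has_iq_integral \<iota> P L (\<lambda>x. x) T \<and>
    \<comment> \<open>(a)\<close>
    (\<forall>P' L'. bounded_iqPVM \<iota> P' L' \<and> has_iq_integral \<iota> P' L' (\<lambda>x. x) T \<longrightarrow>
      (\<forall>E\<in>sets (borel_half_slice \<iota>). P' E = P E) \<and>
      (\<forall>q\<in>slice \<iota>. \<forall>u\<in>qperp (qker (T - qadj T)). L' q u = L q u) \<and>
      L' \<iota> o\<^sub>L T = T o\<^sub>L L' \<iota> \<and> L' \<iota> o\<^sub>L qadj T = qadj T o\<^sub>L L' \<iota> \<and>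
      (\<forall>j\<in>imag_units. \<iota> * j = - (j * \<iota>) \<longrightarrow> L' j o\<^sub>L T = qadj T o\<^sub>L L' j) \<and>
      - (L' \<iota> o\<^sub>L (T - qadj T)) = qabs (T - qadj T) \<and>
      has_iq_integral \<iota> P' L' (\<lambda>x. of_real (2 * slice_im \<iota> x)) (qabs (T - qadj T))) \<and>
    \<comment> \<open>(b)\<close>
    qsupp \<iota> P = spherical_spectrum T \<inter> half_slice \<iota> \<and>
    \<comment> \<open>(c)\<close>
    range (blinfun_apply (P \<real>)) = qker (T - qadj T) \<and>
    range (blinfun_apply (P (half_slice \<iota> - \<real>))) = qperp (qker (T - qadj T)) \<and>
    \<comment> \<open>(d)\<close>
    (\<forall>q. q \<in> spherical_point_spectrum T \<longleftrightarrow> P (qsphere q \<inter> half_slice \<iota>) \<noteq> 0) \<and>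
    (\<forall>q. q isolated_in (spherical_spectrum T \<inter> half_slice \<iota>) \<longrightarrow>
      q \<in> spherical_point_spectrum T) \<and>
    spherical_residual_spectrum T = {} \<and>
    (\<forall>q. q \<in> spherical_continuous_spectrum T \<longleftrightarrow>
      P (qsphere q \<inter> half_slice \<iota>) = 0 \<and>
      (\<forall>U. openin (top_of_set (half_slice \<iota>)) U \<and> qsphere q \<inter> half_slice \<iota> \<subseteq> U \<longrightarrow> P U \<noteq> 0)) \<and>
    (\<forall>q\<in>spherical_continuous_spectrum T. \<forall>\<epsilon>>0. \<exists>u. norm u = 1 \<and> norm (T u - u \<cdot>\<^sub>Q q) < \<epsilon>)"
proof -
  have rT: "qadj T = radj T"
    using assms(2) by (rule qadj_eq_radj)
  have normal: "commutes (radj T) T"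
    using assms(3) unfolding qnormal_def rT commutes_def by (metis blinfun_apply_blinfun_compose)
  obtain P L where PL': "bounded_iqPVM \<iota> P L \<and> has_iq_integral \<iota> P L (\<lambda>x. x) T \<and>
    (\<forall>E\<in>sets (borel_half_slice \<iota>). \<forall>Z. commutes Z T \<longrightarrow> commutes Z (radj T) \<longrightarrow> commutes Z (P E))"
    using spectral_theorem_exists [OF assms(1,2) normal] by (elim exE) (rule that)
  have PL: "bounded_iqPVM \<iota> P L" "has_iq_integral \<iota> P L (\<lambda>x. x) T"
    "\<And>E Z. E \<in> sets (borel_half_slice \<iota>) \<Longrightarrow> commutes Z T \<Longrightarrow> commutes Z (radj T) \<Longrightarrow> commutes Z (P E)"
    using PL' by simp_all
  interpret op: iq_normal_operator \<iota> P L T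
    using assms(1) PL(1,2) normal by unfold_locales (auto simp: bounded_iqPVM_def)
  have uniq: "(\<forall>E\<in>sets (borel_half_slice \<iota>). P' E = P E) \<and>
      (\<forall>q\<in>slice \<iota>. \<forall>u\<in>qperp (qker (T - qadj T)). L' q u = L q u) \<and>
      L' \<iota> o\<^sub>L T = T o\<^sub>L L' \<iota> \<and> L' \<iota> o\<^sub>L qadj T = qadj T o\<^sub>L L' \<iota> \<and>
      (\<forall>j\<in>imag_units. \<iota> * j = - (j * \<iota>) \<longrightarrow> L' j o\<^sub>L T = qadj T o\<^sub>L L' j) \<and>
      - (L' \<iota> o\<^sub>L (T - qadj T)) = qabs (T - qadj T) \<and>
      has_iq_integral \<iota> P' L' (\<lambda>x. of_real (2 * slice_im \<iota> x)) (qabs (T - qadj T))"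
    if PL': "bounded_iqPVM \<iota> P' L'" "has_iq_integral \<iota> P' L' (\<lambda>x. x) T" for P' L'
  proof -
    interpret op': iq_normal_operator \<iota> P' L' T
      using assms(1) PL' normal by unfold_locales (auto simp: bounded_iqPVM_def)
    \<comment> \<open>Both are \<open>qabs (T - radj T)\<close>, which depends on \<open>T\<close>
      alone; hence the integrals of \<open>\<iota> \<bullet> x\<close> agree for the two
      measures.\<close>
    have DD: "op'.D = op.D"
      using op.qabs_diff_adj op'.qabs_diff_adj by simp
    have comm: "commutes (P E) (P' F)"
      if "E \<in> sets (borel_half_slice \<iota>)" "F \<in> sets (borel_half_slice \<iota>)" for E F
      by (intro commutes_sym [of "P' F"] PL(3) [OF that(1)] op'.P_commutes_T [OF that(2)]
          op'.P_commutes_radj_T [OF that(2)])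
    have cre: "continuous_on UNIV qRe" and cim: "continuous_on UNIV (\<lambda>x. \<iota> \<bullet> x)"
      by (rule linear_continuous_on [OF bounded_linear_qRe]) (intro continuous_intros)
    have ere: "(\<integral>x. qRe x \<partial>op.\<mu> u) = (\<integral>x. qRe x \<partial>op'.\<mu> u)" for u
      by (rule trans [OF op.hinner_T [symmetric] op'.hinner_T])
    have eim: "(\<integral>x. \<iota> \<bullet> x \<partial>op.\<mu> u) = (\<integral>x. \<iota> \<bullet> x \<partial>op'.\<mu> u)" for u
      using op.hinner_D [of u] op'.hinner_D [of u] unfolding DD by linarith
    have re: "P {x \<in> half_slice \<iota>. qRe x \<le> t} = P' {x \<in> half_slice \<iota>. qRe x \<le> t}" for t
      using pvm_threshold_unique [OF op.pvm op'.pvm op.qRe_measurable op.integral_zeta_cong(1) [OF cre]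
          op'.integral_zeta_cong(1) [OF cre] ere comm, of t] unfolding op.space_M .
    have im: "P {x \<in> half_slice \<iota>. \<iota> \<bullet> x \<le> t} = P' {x \<in> half_slice \<iota>. \<iota> \<bullet> x \<le> t}" for t
      using pvm_threshold_unique [OF op.pvm op'.pvm op.inner_measurable op.integral_zeta_cong(1) [OF cim]
          op'.integral_zeta_cong(1) [OF cim] eim comm, of t] unfolding op.space_M .
    have "P' E = P E" if "E \<in> sets (borel_half_slice \<iota>)" for E
      by (rule pvm_half_slice_unique [OF assms(1) op.pvm op'.pvm re im that, symmetric])
    moreover have "L' q u = L q u" if q: "q \<in> slice \<iota>" and u: "u \<in> qperp (qker (T - radj T))" for q u
    proof (rule slice_left_mult_eq [OF op'.L op.L assms(1) q])
      \<comment> \<open>Both sides are \<open>(T - radj T) v\<close>.\<close>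
      have "L' \<iota> (op.D v) = L \<iota> (op.D v)" for v
        using op.diff_adj_eq op'.diff_adj_eq DD by (metis blinfun_apply_blinfun_compose)
      then have "range (blinfun_apply op.D) \<subseteq> {v. L' \<iota> v = L \<iota> v}" by blast
      then have "closure (range (blinfun_apply op.D)) \<subseteq> {v. L' \<iota> v = L \<iota> v}"
        by (intro closure_minimal closed_subspace_equalizer blinfun.bounded_linear_right)
      then show "L' \<iota> u = L \<iota> u"
        using op.qperp_closure_range [OF u] by blast
    qed
    ultimately show ?thesis
      unfolding rT op'.qabs_diff_adj
      using op'.L_commutes [OF imag_unit_in_slice] op'.L_anticommutes op'.has_qabs
      by (simp add: op'.D_def)
  qed
  show ?thesis
  proof (intro exI [of _ P] exI [of _ L] conjI allI impI)
    show "bounded_iqPVM \<iota> P L" "has_iq_integral \<iota> P L (\<lambda>x. x) T" by (fact PL)+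
    show "qsupp \<iota> P = spherical_spectrum T \<inter> half_slice \<iota>"
      by (rule op.support_eq_spectrum)
    show "range (blinfun_apply (P \<real>)) = qker (T - qadj T)"
      unfolding rT by (rule op.range_P_Reals)
    show "range (blinfun_apply (P (half_slice \<iota> - \<real>))) = qperp (qker (T - qadj T))"
      unfolding rT by (rule op.range_P_compl_Reals)
    show "spherical_residual_spectrum T = {}"
      by (rule op.residual_spectrum_empty)
    show "q \<in> spherical_point_spectrum T \<longleftrightarrow> P (qsphere q \<inter> half_slice \<iota>) \<noteq> 0" for q
      by (rule op.point_spectrum_iff)
    show "q \<in> spherical_point_spectrum T" if "q isolated_in (spherical_spectrum T \<inter> half_slice \<iota>)" for q
      using that by (rule op.isolated_point_spectrum)
    show "q \<in> spherical_continuous_spectrum T \<longleftrightarrow>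
      P (qsphere q \<inter> half_slice \<iota>) = 0 \<and>
      (\<forall>U. openin (top_of_set (half_slice \<iota>)) U \<and> qsphere q \<inter> half_slice \<iota> \<subseteq> U \<longrightarrow> P U \<noteq> 0)" for q
      by (rule op.continuous_spectrum_iff)
    show "\<forall>q\<in>spherical_continuous_spectrum T. \<forall>\<epsilon>>0. \<exists>u. norm u = 1 \<and> norm (T u - u \<cdot>\<^sub>Q q) < \<epsilon>"
      using op.approximate_eigenvector by blast
  qed (use uniq in blast)+
qed

end
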